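(* For any $\epsilon>0$, there is a polynomial time two-sided distribution-free adaptive algorithm for $\epsilon$-testing Length-$k$ Decision List that makes $\tilde O(k^2/\epsilon)$ queries.
   Context: Boolean functions $f:\{0,1\}^n\to\{0,1\}$ are accessed through a membership-query oracle that returns $f(x)$ for a queried $x$. For a distribution $\mathcal D$ on $\{0,1\}^n$, $f$ is $\epsilon$-far from a class $C$ with respect to $\mathcal D$ if $\Pr_{x\sim\mathcal D}[f(x)\neq g(x)]\ge\epsilon$ for every $g\in C$. A two-sided distribution-free adaptive algorithm for $\epsilon$-testing $C$ is a randomized algorithm that, given $\epsilon$, membership-query access to an arbitrary $f$, and an oracle returning independent samples from an arbitrary unknown distribution $\mathcal D$ on $\{0,1\}^n$, chooses queries possibly adaptively and, for every $\mathcal D$, accepts with probability at least $2/3$ if $f\in C$ and rejects with probability at least $2/3$ if $f$ is $\epsilon$-far from every function in $C$ with respect to $\mathcal D$. Queries count membership queries and samples. $\tilde O(T)$ means $O(T\cdot\mathrm{poly}(\log T))$. A decision list is a sequence $(x_{i_1},\xi_1,a_1),\dots,(x_{i_s},\xi_s,a_s)$ with $\xi_j,a_j\in\{0,1\}$, representing the function: if $x_{i_1}=\xi_1$ output $a_1$, else if $x_{i_2}=\xi_2$ output $a_2$, \dots, else if $x_{i_s}=\xi_s$ output $a_s$. A length-$k$ decision list is one with $s\le k$; Length-$k$ Decision List is the class of all of them. *)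

theory Defs
  imports "HOL-Probability.Probability"
begin

definition cube :: "nat \<Rightarrow> bool list set" where
  "cube n = {x. length x = n}"


subsection \<open>Decision lists\<close>

text \<open>A rule \<open>(i, \<xi>, a)\<close> reads ``if \<open>x\<^sub>i = \<xi>\<close> then output \<open>a\<close>''; variables are numbered from 0.
  A sequence of rules alone need not determine the output on every point, so a list also
  carries the bit \<open>b\<close> that is output when no rule fires. This bit is free and is not counted in
  the length. (Fixing it to \<open>False\<close>, or to the negation of the last output, gives the
  same class for every length bound at least 2.)\<close>

type_synonym rule = "nat \<times> bool \<times> bool"

fun dl_eval :: "rule list \<Rightarrow> bool \<Rightarrow> bool list \<Rightarrow> bool" where
  "dl_eval [] b x = b"
| "dl_eval ((i, \<xi>, a) # L) b x = (if x ! i = \<xi> then a else dl_eval L b x)"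

text \<open>Boolean functions on \<open>{0,1}\<^sup>n\<close> are functions on \<open>bool list\<close> of which only the values on
  \<open>cube n\<close> matter.\<close>

definition length_decision_list :: "nat \<Rightarrow> nat \<Rightarrow> (bool list \<Rightarrow> bool) set" where
  "length_decision_list n k =
     {f. \<exists>L b. length L \<le> k \<and> (\<forall>(i, \<xi>, a) \<in> set L. i < n) \<and> (\<forall>x\<in>cube n. f x = dl_eval L b x)}"

definition far_from ::
    "bool list pmf \<Rightarrow> real \<Rightarrow> (bool list \<Rightarrow> bool) set \<Rightarrow> (bool list \<Rightarrow> bool) \<Rightarrow> bool" where
  "far_from D \<epsilon> C f \<longleftrightarrow> (\<forall>g\<in>C. measure_pmf.prob D {x. f x \<noteq> g x} \<ge> \<epsilon>)"


subsection \<open>Randomized oracle algorithms\<close>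

text \<open>Algorithms are programs of a random access machine with memory \<open>nat \<Rightarrow> nat\<close> and indirect
  addressing, extended by coin tosses and the two oracles. Every step has unit cost. The only
  arithmetic operations are addition and truncated subtraction, so that after \<open>t\<close> steps of a
  fixed program all numbers have bit length linear in \<open>t\<close> and the bit length of the inputs;
  hence polynomially many steps are polynomial time in the usual sense.\<close>

type_synonym memory = "nat \<Rightarrow> nat"

datatype expr = Const nat | Read expr | Add expr expr | Sub expr expr

primrec eval :: "expr \<Rightarrow> memory \<Rightarrow> nat" where
  "eval (Const c) s = c"
| "eval (Read e) s = s (eval e s)"
| "eval (Add d e) s = eval d s + eval e s"
| "eval (Sub d e) s = eval d s - eval e s"

text \<open>\<open>Assign d e\<close> stores the value of \<open>e\<close> at the address \<open>d\<close>. \<open>Toss d\<close> stores a fair random bit at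
  \<open>d\<close>. \<open>Query d e\<close> stores at \<open>d\<close> the value of the unknown function on the point stored in the \<open>n\<close>
  cells from address \<open>e\<close> on. \<open>Sample e\<close> stores a fresh sample in the \<open>n\<close> cells from \<open>e\<close> on.\<close>

datatype cmd =
    Skip
  | Assign expr expr
  | Seq cmd cmd
  | If expr cmd cmd
  | While expr cmd
  | Toss expr
  | Query expr expr
  | Sample expr

definition load_point :: "nat \<Rightarrow> nat \<Rightarrow> memory \<Rightarrow> bool list" where
  "load_point n p s = map (\<lambda>i. s (p + i) \<noteq> 0) [0..<n]"

definition store_point :: "nat \<Rightarrow> bool list \<Rightarrow> memory \<Rightarrow> memory" where
  "store_point p x s = (\<lambda>j. if p \<le> j \<and> j < p + length x then of_bool (x ! (j - p)) else s j)"

text \<open>A configuration consists of the commands still to be executed, the memory, and the number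
  of oracle calls (membership queries and samples) made so far.\<close>

type_synonym config = "cmd list \<times> memory \<times> nat"

fun step :: "nat \<Rightarrow> (bool list \<Rightarrow> bool) \<Rightarrow> bool list pmf \<Rightarrow> config \<Rightarrow> config pmf" where
  "step n f D ([], s, q) = return_pmf ([], s, q)"
| "step n f D (Skip # K, s, q) = return_pmf (K, s, q)"
| "step n f D (Assign d e # K, s, q) = return_pmf (K, s(eval d s := eval e s), q)"
| "step n f D (Seq c1 c2 # K, s, q) = return_pmf (c1 # c2 # K, s, q)"
| "step n f D (If e c1 c2 # K, s, q) =
     return_pmf ((if eval e s \<noteq> 0 then c1 else c2) # K, s, q)"
| "step n f D (While e c # K, s, q) =
     return_pmf (if eval e s \<noteq> 0 then c # While e c # K else K, s, q)"
| "step n f D (Toss d # K, s, q) =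
     map_pmf (\<lambda>b. (K, s(eval d s := of_bool b), q)) (bernoulli_pmf (1 / 2))"
| "step n f D (Query d e # K, s, q) =
     return_pmf (K, s(eval d s := of_bool (f (load_point n (eval e s) s))), q + 1)"
| "step n f D (Sample e # K, s, q) =
     map_pmf (\<lambda>x. (K, store_point (eval e s) x s, q + 1)) D"

primrec run :: "nat \<Rightarrow> (bool list \<Rightarrow> bool) \<Rightarrow> bool list pmf \<Rightarrow> nat \<Rightarrow> config \<Rightarrow> config pmf" where
  "run n f D 0 c = return_pmf c"
| "run n f D (Suc t) c = bind_pmf (step n f D c) (run n f D t)"

text \<open>The machine is given \<open>n\<close>, \<open>k\<close> and, in place of the real number \<open>\<epsilon>\<close>, the integer
  \<open>\<lfloor>1 / \<epsilon>\<rfloor>\<close>, which determines \<open>\<epsilon>\<close> up to a factor of 2 if \<open>\<epsilon> \<le> 1\<close> and is 0 if \<open>\<epsilon> > 1\<close>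
  (when no function is far from a nonempty class). The program itself does not depend on
  \<open>n\<close>, \<open>k\<close>, \<open>\<epsilon>\<close>, the function or the distribution.\<close>

definition init :: "cmd \<Rightarrow> nat \<Rightarrow> nat \<Rightarrow> real \<Rightarrow> config" where
  "init P n k \<epsilon> = ([P], (\<lambda>_. 0)(0 := n, 1 := k, 2 := nat \<lfloor>1 / \<epsilon>\<rfloor>), 0)"

text \<open>Distribution of the configuration reached after \<open>t\<close> steps.\<close>

definition exec ::
    "cmd \<Rightarrow> nat \<Rightarrow> nat \<Rightarrow> real \<Rightarrow> (bool list \<Rightarrow> bool) \<Rightarrow> bool list pmf \<Rightarrow> nat \<Rightarrow> config pmf" where
  "exec P n k \<epsilon> f D t = run n f D t (init P n k \<epsilon>)"

definition halted :: "config \<Rightarrow> bool" where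
  "halted c \<longleftrightarrow> fst c = []"

definition accepting :: "config \<Rightarrow> bool" where
  "accepting c \<longleftrightarrow> halted c \<and> fst (snd c) 0 \<noteq> 0"

definition rejecting :: "config \<Rightarrow> bool" where
  "rejecting c \<longleftrightarrow> halted c \<and> fst (snd c) 0 = 0"

definition query_count :: "config \<Rightarrow> nat" where
  "query_count c = snd (snd c)"

definition admissible :: "nat \<Rightarrow> nat \<Rightarrow> real \<Rightarrow> bool list pmf \<Rightarrow> bool" where
  "admissible n k \<epsilon> D \<longleftrightarrow> n \<ge> 1 \<and> k \<ge> 1 \<and> \<epsilon> > 0 \<and> set_pmf D \<subseteq> cube n"

text \<open>Halted configurations are final, so the probabilities below are nondecreasing in \<open>t\<close>.\<close>

definition distribution_free_tester :: "cmd \<Rightarrow> (nat \<Rightarrow> nat \<Rightarrow> (bool list \<Rightarrow> bool) set) \<Rightarrow> bool" where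
  "distribution_free_tester P C \<longleftrightarrow>
     (\<forall>n k \<epsilon> f D. admissible n k \<epsilon> D \<longrightarrow>
        (f \<in> C n k \<longrightarrow>
           (\<exists>t. measure_pmf.prob (exec P n k \<epsilon> f D t) {c. accepting c} \<ge> 2 / 3)) \<and>
        (far_from D \<epsilon> (C n k) f \<longrightarrow>
           (\<exists>t. measure_pmf.prob (exec P n k \<epsilon> f D t) {c. rejecting c} \<ge> 2 / 3)))"

text \<open>Both resource bounds are worst case, over all functions, distributions and outcomes of the
  coin tosses and samples.\<close>

definition polynomial_time :: "cmd \<Rightarrow> bool" where
  "polynomial_time P \<longleftrightarrow>
     (\<exists>A d. \<forall>n k \<epsilon> f D. admissible n k \<epsilon> D \<longrightarrow>
        (\<exists>t. real t \<le> A * (real n + real k + 1 / \<epsilon>) ^ d \<and>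
             (\<forall>c \<in> set_pmf (exec P n k \<epsilon> f D t). halted c)))"

text \<open>The bound soft-\<open>O(T)\<close>, that is \<open>A \<cdot> T \<cdot> (log T)\<^sup>d\<close> for constants \<open>A\<close>, \<open>d\<close>, where
  \<open>T\<close> may depend on \<open>k\<close> and \<open>\<epsilon>\<close> only. The logarithm is taken of \<open>T + 2\<close> since \<open>log T\<close> is not
  bounded away from 0 for small \<open>T\<close>.\<close>

definition soft_O_queries :: "cmd \<Rightarrow> (nat \<Rightarrow> real \<Rightarrow> real) \<Rightarrow> bool" where
  "soft_O_queries P T \<longleftrightarrow>
     (\<exists>A d. \<forall>n k \<epsilon> f D. admissible n k \<epsilon> D \<longrightarrow>
        (\<forall>t. \<forall>c \<in> set_pmf (exec P n k \<epsilon> f D t).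
           real (query_count c) \<le> A * T k \<epsilon> * ln (T k \<epsilon> + 2) ^ d))"

end

theory Submission imports Defs begin

text \<open>
  With a free default bit, a function is a length-\<open>k\<close> decision list iff it is a decision list and
  depends on at most \<open>k\<close> variables. The tester first collects disjoint blocks of variables. If
  \<open>f x\<close> differs from the value of \<open>f\<close> on the point that agrees with the sample \<open>x\<close> on the known
  blocks and is 0 elsewhere, then the two points differ in a relevant variable outside the
  blocks, and repeatedly replacing one of them by a random hybrid shrinks their difference to a
  new block. In the case of a decision list each block then contains exactly one relevant
  variable with high probability, because two variables stay together in a round with probability
  1/2; so more than \<open>k\<close> blocks never occur.

  On a block, with the other coordinates fixed to a witness of its relevance, \<open>f\<close> should be a
  literal. Blum-Luby-Rubinfeld self-correction (\<open>g u \<noteq> g (u \<oplus> x)\<close> for random \<open>u\<close>) turns any block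
  function that passes the test into an exact parity, and a test of compatibility with
  conjunction leaves only single variables and constants. Hence the block variables of a sample
  can be read off with a constant number of queries each, up to logarithmic factors, and it
  remains to find a decision list on at most \<open>k\<close> bits consistent with about \<open>k/\<epsilon>\<close> samples, which a greedy
  algorithm does; soundness is a union bound over the at most \<open>2 (4 k + 1)\<^sup>k\<close> candidates.

  The program is related to this algorithm in the probability mass monad by a coupling.
\<close>

subsection \<open>Execution of programs\<close>

text \<open>The number of queries must not depend on \<open>n\<close>, and soundness must hold for
  an arbitrary \<open>f\<close>. Hence candidates are lists over block indices, and their bits must
  be read reliably even when \<open>f\<close> has no structure. The table is labelled by
  \<open>f\<close> on the zeroed point instead of \<open>f\<close> on the sample: such labels depend
  on block variables only, so for a decision list without colliding variables all later phases
  succeed with certainty and two-sided error comes from collisions alone; soundness pays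
  \<open>\<epsilon> / 2\<close> for this replacement. Let \<open>N\<close> be the integer part of
  \<open>1 / \<epsilon>\<close> and \<open>W\<close> the bit length of \<open>k + N\<close>. An
  epoch uses \<open>16 * N * W\<close> samples, the table has \<open>64 * k * N * W\<close> rows,
  and both halving and repeated reading take \<open>4 * W + 10\<close> rounds; each number is chosen
  to beat one union bound. Rows times blocks times readings gives the quadratic dependence on
  \<open>k\<close>. Resource bounds are worst case, so every loop has a length fixed in advance, and
  early success or failure is only remembered in a flag.\<close>

lemma run_halted [simp]: "run n f D t ([], s) = return_pmf ([], s)"
proof (induction t)
  case (Suc t)
  then show ?case by (cases s) (simp add: bind_return_pmf)
qed simp

lemma run_add: "run n f D (t + t') c = bind_pmf (run n f D t c) (run n f D t')"
proof (induction t arbitrary: c)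
  case (Suc t)
  show ?case by (simp add: bind_assoc_pmf Suc.IH cong: bind_pmf_cong)
qed (simp add: bind_return_pmf)

lemma step_query_count: "c' \<in> set_pmf (step n f D c) \<Longrightarrow> query_count c \<le> query_count c'"
  by (induction n f D c rule: step.induct) (auto simp: query_count_def)

lemma run_query_count: "c' \<in> set_pmf (run n f D t c) \<Longrightarrow> query_count c \<le> query_count c'"
  by (induction t arbitrary: c) (auto intro: le_trans step_query_count)

text \<open>\<open>soft_O_queries\<close> speaks about every time, while programs are analysed at a
  halting time. Running an arbitrary configuration for \<open>t\<close> further steps ends in one
  that had already halted at time \<open>t\<close>, and counts never decrease.\<close>

lemma run_query_count_bound:
  assumes "\<And>c'. c' \<in> set_pmf (run n f D t c) \<Longrightarrow> halted c' \<and> query_count c' \<le> Q"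
    and "c' \<in> set_pmf (run n f D t' c)"
  shows "query_count c' \<le> Q"
proof -
  obtain c'' where c'': "c'' \<in> set_pmf (run n f D t c')"
    using set_pmf_not_empty by fast
  then have "c'' \<in> set_pmf (run n f D (t + t') c)"
    using assms(2) by (subst add.commute) (auto simp: run_add)
  then obtain d where d: "d \<in> set_pmf (run n f D t c)" "c'' \<in> set_pmf (run n f D t' d)"
    by (auto simp: run_add)
  with assms(1)[OF d(1)] have "c'' = d"
    by (cases d) (auto simp: halted_def)
  with assms(1)[OF d(1)] run_query_count[OF c''] show ?thesis by simp
qed

locale oracles =
  fixes n :: nat and f :: "bool list \<Rightarrow> bool" and D :: "bool list pmf"
begin

text \<open>Continuation-passing form: the number of steps may vary between the computation paths, so
  the distribution after \<open>c\<close> is only compared at halting time.\<close>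

definition reaches :: "cmd \<Rightarrow> memory \<times> nat \<Rightarrow> nat \<Rightarrow> (memory \<times> nat) pmf \<Rightarrow> bool" where
  "reaches c \<sigma> T M \<longleftrightarrow> (\<forall>K T' \<mu>.
     (\<forall>\<sigma>'\<in>set_pmf M. run n f D T' (K, \<sigma>') = map_pmf (Pair []) (\<mu> \<sigma>')) \<longrightarrow>
     run n f D (T' + T) (c # K, \<sigma>) = map_pmf (Pair []) (bind_pmf M \<mu>))"

lemma reachesI:
  assumes "\<And>K T' \<mu>. (\<And>\<sigma>'. \<sigma>' \<in> set_pmf M \<Longrightarrow> run n f D T' (K, \<sigma>') = map_pmf (Pair []) (\<mu> \<sigma>')) \<Longrightarrow>
     run n f D (T' + T) (c # K, \<sigma>) = map_pmf (Pair []) (bind_pmf M \<mu>)"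
  shows "reaches c \<sigma> T M"
  using assms unfolding reaches_def by blast

lemma reachesD:
  assumes "reaches c \<sigma> T M"
    and "\<And>\<sigma>'. \<sigma>' \<in> set_pmf M \<Longrightarrow> run n f D T' (K, \<sigma>') = map_pmf (Pair []) (\<mu> \<sigma>')"
  shows "run n f D (T' + T) (c # K, \<sigma>) = map_pmf (Pair []) (bind_pmf M \<mu>)"
  using assms unfolding reaches_def by blast

text \<open>The tag \<open>y\<close> may carry more than the final state \<open>g y\<close>, yet the
  continuation can be indexed by \<open>y\<close>: \<open>Pair []\<close> is injective, so
  \<open>\<mu> y\<close> can be recovered from the run started in \<open>g y\<close>.\<close>

lemma reaches_bindD:
  assumes "reaches c \<sigma> T (map_pmf g M)"
    and "\<And>y. y \<in> set_pmf M \<Longrightarrow> run n f D T' (K, g y) = map_pmf (Pair []) (\<mu> y)"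
  shows "run n f D (T' + T) (c # K, \<sigma>) = map_pmf (Pair []) (bind_pmf M \<mu>)"
proof -
  define \<mu>' where "\<mu>' \<sigma>' = map_pmf snd (run n f D T' (K, \<sigma>'))" for \<sigma>'
  have eq: "\<mu>' (g y) = \<mu> y" if "y \<in> set_pmf M" for y
    using assms(2)[OF that] by (simp add: \<mu>'_def pmf.map_comp o_def)
  have "run n f D (T' + T) (c # K, \<sigma>) = map_pmf (Pair []) (bind_pmf (map_pmf g M) \<mu>')"
    by (rule reachesD[OF assms(1)]) (use assms(2) eq in auto)
  also have "bind_pmf (map_pmf g M) \<mu>' = bind_pmf M \<mu>"
    unfolding bind_map_pmf by (intro bind_pmf_cong refl) (simp add: eq)
  finally show ?thesis .
qed

lemma reaches_run:
  assumes "reaches c \<sigma> T M"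
  shows "run n f D T ([c], \<sigma>) = map_pmf (Pair []) M"
proof -
  have "run n f D (0 + T) ([c], \<sigma>) = map_pmf (Pair []) (bind_pmf M return_pmf)"
    by (rule reachesD[OF assms]) (simp add: map_pmf_def bind_return_pmf)
  then show ?thesis by (simp add: bind_return_pmf')
qed

lemma run_halting_mono:
  assumes "run n f D T c = map_pmf (Pair []) \<mu>" "T \<le> T'"
  shows "run n f D T' c = map_pmf (Pair []) \<mu>"
proof -
  have "run n f D (T + (T' - T)) c = map_pmf (Pair []) \<mu>"
    unfolding run_add assms(1) bind_map_pmf by (simp add: map_pmf_def)
  with assms(2) show ?thesis by simp
qed

lemma reaches_mono: "reaches c \<sigma> T M \<Longrightarrow> T \<le> T' \<Longrightarrow> reaches c \<sigma> T' M"
  unfolding reaches_def by (meson add_left_mono run_halting_mono)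

lemma reaches_Skip: "reaches Skip \<sigma> 1 (return_pmf \<sigma>)"
  by (rule reachesI) (cases \<sigma>; simp add: bind_return_pmf)

lemma reaches_Assign: "reaches (Assign d e) (s, q) 1 (return_pmf (s(eval d s := eval e s), q))"
  by (rule reachesI) (simp add: bind_return_pmf)

lemma reaches_Toss:
  "reaches (Toss d) (s, q) 1 (map_pmf (\<lambda>b. (s(eval d s := of_bool b), q)) (bernoulli_pmf (1/2)))"
  by (rule reachesI)
    (auto simp: bind_map_pmf map_bind_pmf intro!: bind_pmf_cong simp del: set_pmf_bernoulli)

lemma reaches_Query:
  "reaches (Query d e) (s, q) 1
     (return_pmf (s(eval d s := of_bool (f (load_point n (eval e s) s))), q + 1))"
  by (rule reachesI) (simp add: bind_return_pmf)

lemma reaches_Sample: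
  "reaches (Sample e) (s, q) 1 (map_pmf (\<lambda>x. (store_point (eval e s) x s, q + 1)) D)"
  by (rule reachesI) (auto simp: bind_map_pmf map_bind_pmf intro!: bind_pmf_cong)

lemma reaches_Seq:
  assumes "reaches c1 \<sigma> T1 (map_pmf g M1)" "\<And>y. y \<in> set_pmf M1 \<Longrightarrow> reaches c2 (g y) T2 (M2 y)"
  shows "reaches (Seq c1 c2) \<sigma> (T1 + T2 + 1) (bind_pmf M1 M2)"
proof (rule reachesI)
  fix K T' \<mu>
  assume *: "\<And>\<sigma>'. \<sigma>' \<in> set_pmf (bind_pmf M1 M2) \<Longrightarrow> run n f D T' (K, \<sigma>') = map_pmf (Pair []) (\<mu> \<sigma>')"
  have "run n f D (T' + T2) (c2 # K, g y) = map_pmf (Pair []) (bind_pmf (M2 y) \<mu>)"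
    if "y \<in> set_pmf M1" for y
    by (rule reachesD[OF assms(2)[OF that]]) (use * that in auto)
  from reaches_bindD[OF assms(1) this]
  show "run n f D (T' + (T1 + T2 + 1)) (Seq c1 c2 # K, \<sigma>) = map_pmf (Pair []) (bind_pmf (bind_pmf M1 M2) \<mu>)"
    by (cases \<sigma>) (simp add: bind_return_pmf bind_assoc_pmf ac_simps)
qed

lemma reaches_If:
  assumes "reaches (if eval e s \<noteq> 0 then c1 else c2) (s, q) T M"
  shows "reaches (If e c1 c2) (s, q) (T + 1) M"
proof (rule reachesI)
  fix K T' \<mu>
  assume *: "\<And>\<sigma>'. \<sigma>' \<in> set_pmf M \<Longrightarrow> run n f D T' (K, \<sigma>') = map_pmf (Pair []) (\<mu> \<sigma>')"
  from reachesD[OF assms this]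
  show "run n f D (T' + (T + 1)) (If e c1 c2 # K, s, q) = map_pmf (Pair []) (bind_pmf M \<mu>)"
    by (simp add: bind_return_pmf)
qed

lemma reaches_While_end:
  assumes "eval e s = 0"
  shows "reaches (While e c) (s, q) 1 (return_pmf (s, q))"
  by (rule reachesI) (simp add: bind_return_pmf assms)

lemma reaches_While_step:
  assumes "eval e s \<noteq> 0" "reaches c (s, q) T1 (map_pmf g M1)"
    "\<And>y. y \<in> set_pmf M1 \<Longrightarrow> reaches (While e c) (g y) T2 (M2 y)"
  shows "reaches (While e c) (s, q) (T1 + T2 + 1) (bind_pmf M1 M2)"
proof (rule reachesI)
  fix K T' \<mu>
  assume "\<And>\<sigma>'. \<sigma>' \<in> set_pmf (bind_pmf M1 M2) \<Longrightarrow> run n f D T' (K, \<sigma>') = map_pmf (Pair []) (\<mu> \<sigma>')"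
  from reachesD[OF reaches_Seq[OF assms(2,3)] this]
  have "run n f D (T' + (T1 + T2 + 1)) (Seq c (While e c) # K, s, q)
     = map_pmf (Pair []) (bind_pmf (bind_pmf M1 M2) \<mu>)" by blast
  then show "run n f D (T' + (T1 + T2 + 1)) (While e c # K, s, q)
     = map_pmf (Pair []) (bind_pmf (bind_pmf M1 M2) \<mu>)"
    using assms(1) by (simp add: bind_return_pmf)
qed

text \<open>\<open>M\<close> couples the abstract result, distributed as \<open>a\<close>, with the final memory and the number
  of oracle calls.\<close>

definition refines :: "cmd \<Rightarrow> memory \<Rightarrow> nat \<Rightarrow> nat \<Rightarrow> 'x pmf \<Rightarrow> ('x \<Rightarrow> memory \<Rightarrow> bool) \<Rightarrow> bool" where
  "refines c s T Q a R \<longleftrightarrow> (\<exists>M :: ('x \<times> memory \<times> nat) pmf.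
     (\<forall>q. reaches c (s, q) T (map_pmf (\<lambda>(x, s', d). (s', q + d)) M)) \<and>
     map_pmf fst M = a \<and> (\<forall>(x, s', d)\<in>set_pmf M. R x s' \<and> d \<le> Q))"

lemma refinesE:
  assumes "refines c s T Q a R"
  obtains M where "\<And>q. reaches c (s, q) T (map_pmf (\<lambda>(x, s', d). (s', q + d)) M)"
    "map_pmf fst M = a" "\<And>x s' d. (x, s', d) \<in> set_pmf M \<Longrightarrow> R x s' \<and> d \<le> Q"
  using assms unfolding refines_def by fast

lemma refines_weaken:
  assumes "refines c s T Q a R" "T \<le> T'" "Q \<le> Q'"
    "\<And>x s'. x \<in> set_pmf a \<Longrightarrow> R x s' \<Longrightarrow> R' x s'"
  shows "refines c s T' Q' a R'"
proof -
  from assms(1) obtain M where M: "\<And>q. reaches c (s, q) T (map_pmf (\<lambda>(x, s', d). (s', q + d)) M)"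
    "map_pmf fst M = a" "\<And>x s' d. (x, s', d) \<in> set_pmf M \<Longrightarrow> R x s' \<and> d \<le> Q"
    by (rule refinesE) blast
  have "R' x s' \<and> d \<le> Q'" if "(x, s', d) \<in> set_pmf M" for x s' d
  proof -
    from that have "x \<in> set_pmf a" unfolding M(2)[symmetric] by force
    with M(3)[OF that] assms(3,4) show ?thesis by auto
  qed
  then show ?thesis unfolding refines_def
    using M(2) reaches_mono[OF M(1) assms(2)] by (intro exI[of _ M]) auto
qed

lemma refines_return:
  assumes "\<And>q. reaches c (s, q) T (return_pmf (s', q + d))" "R x s'" "d \<le> Q"
  shows "refines c s T Q (return_pmf x) R"
  unfolding refines_def by (rule exI[of _ "return_pmf (x, s', d)"]) (use assms in auto)

lemma refines_Skip: "R x s \<Longrightarrow> refines Skip s 1 0 (return_pmf x) R"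
  by (rule refines_return[of _ _ _ s 0]) (simp_all add: reaches_Skip[simplified])

lemma refines_Assign:
  "R x (s(eval d s := eval e s)) \<Longrightarrow> refines (Assign d e) s 1 0 (return_pmf x) R"
  by (rule refines_return[of _ _ _ "s(eval d s := eval e s)" 0])
    (simp_all add: reaches_Assign[simplified])

lemma refines_Query:
  "R x (s(eval d s := of_bool (f (load_point n (eval e s) s)))) \<Longrightarrow>
   refines (Query d e) s 1 1 (return_pmf x) R"
  by (rule refines_return[of _ _ _ "s(eval d s := of_bool (f (load_point n (eval e s) s)))" 1])
    (simp_all add: reaches_Query[simplified])

lemma refines_Toss:
  assumes "\<And>b. R b (s(eval d s := of_bool b))"
  shows "refines (Toss d) s 1 0 (bernoulli_pmf (1/2)) R"
  unfolding refines_def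
  by (rule exI[of _ "map_pmf (\<lambda>b. (b, s(eval d s := of_bool b), 0)) (bernoulli_pmf (1/2))"])
    (use assms reaches_Toss in \<open>auto simp: pmf.map_comp o_def pmf.map_ident\<close>)

lemma refines_Sample:
  assumes "\<And>x. x \<in> set_pmf D \<Longrightarrow> R x (store_point (eval e s) x s)"
  shows "refines (Sample e) s 1 1 D R"
  unfolding refines_def
  by (rule exI[of _ "map_pmf (\<lambda>x. (x, store_point (eval e s) x s, 1)) D"])
    (use assms reaches_Sample in \<open>auto simp: pmf.map_comp o_def pmf.map_ident\<close>)

text \<open>Couplings compose: one for \<open>c2\<close> is chosen for each reachable pair of
  abstract value and memory, and the call counts add up. The premise \<open>c\<close> abstracts from
  the control flow, so a single proof serves sequencing and the unrolling of a loop.\<close>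

lemma refines_bind:
  assumes c: "\<And>q (M1 :: ('x \<times> memory \<times> nat) pmf) g M2. reaches c1 (s, q) T1 (map_pmf g M1) \<Longrightarrow>
      (\<And>y. y \<in> set_pmf M1 \<Longrightarrow> reaches c2 (g y) T2 (M2 y)) \<Longrightarrow> reaches c (s, q) T (bind_pmf M1 M2)"
    and 1: "refines c1 s T1 Q1 (a :: 'x pmf) R1"
    and 2: "\<And>x s'. x \<in> set_pmf a \<Longrightarrow> R1 x s' \<Longrightarrow> refines c2 s' T2 Q2 (b x) R2"
  shows "refines c s T (Q1 + Q2) (bind_pmf a b) R2"
proof -
  from 1 obtain M where M: "\<And>q. reaches c1 (s, q) T1 (map_pmf (\<lambda>(x, s', d). (s', q + d)) M)"
    "map_pmf fst M = a" "\<And>x s' d. (x, s', d) \<in> set_pmf M \<Longrightarrow> R1 x s' \<and> d \<le> Q1"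
    by (rule refinesE) blast
  have "\<exists>N. \<forall>x s'. x \<in> set_pmf a \<and> R1 x s' \<longrightarrow>
     (\<forall>q. reaches c2 (s', q) T2 (map_pmf (\<lambda>(x, s', d). (s', q + d)) (N x s'))) \<and>
     map_pmf fst (N x s') = b x \<and> (\<forall>(y, s'', d)\<in>set_pmf (N x s'). R2 y s'' \<and> d \<le> Q2)"
    using 2 unfolding refines_def by metis
  then obtain N where N: "x \<in> set_pmf a \<Longrightarrow> R1 x s' \<Longrightarrow>
     (\<forall>q. reaches c2 (s', q) T2 (map_pmf (\<lambda>(x, s', d). (s', q + d)) (N x s'))) \<and>
     map_pmf fst (N x s') = b x \<and> (\<forall>(y, s'', d)\<in>set_pmf (N x s'). R2 y s'' \<and> d \<le> Q2)" for x s'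
    by blast
  have a: "x \<in> set_pmf a" if "(x, s', d) \<in> set_pmf M" for x s' d
    using that unfolding M(2)[symmetric] by force
  define P where "P = bind_pmf M (\<lambda>(x, s', d). map_pmf (\<lambda>(y, s'', d'). (y, s'', d + d')) (N x s'))"
  have P1: "map_pmf fst P = bind_pmf a b"
  proof -
    have "map_pmf fst P = bind_pmf M (\<lambda>(x, s', d). map_pmf fst (N x s'))"
      unfolding P_def map_bind_pmf
      by (intro bind_pmf_cong refl) (auto simp: pmf.map_comp o_def case_prod_beta)
    also have "\<dots> = bind_pmf M (\<lambda>(x, s', d). b x)"
      by (intro bind_pmf_cong refl) (use N a M(3) in auto)
    also have "\<dots> = bind_pmf (map_pmf fst M) b"
      unfolding bind_map_pmf by (intro bind_pmf_cong refl) auto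
    finally show ?thesis by (simp add: M(2))
  qed
  have P2: "R2 y s'' \<and> d \<le> Q1 + Q2" if "(y, s'', d) \<in> set_pmf P" for y s'' d
  proof -
    from that obtain x s' d1 d2 where *: "(x, s', d1) \<in> set_pmf M" "(y, s'', d2) \<in> set_pmf (N x s')"
      "d = d1 + d2"
      unfolding P_def by auto
    show ?thesis using M(3)[OF *(1)] N[OF a[OF *(1)], of s'] *(2,3) by fastforce
  qed
  have P3: "reaches c (s, q) T (map_pmf (\<lambda>(x, s', d). (s', q + d)) P)" for q
  proof -
    have "reaches c (s, q) T (bind_pmf M (\<lambda>(x, s', d).
        map_pmf (\<lambda>(y, s'', d'). (s'', q + d + d')) (N x s')))"
      by (rule c[OF M(1)]) (use N a M(3) in \<open>auto split: prod.splits\<close>)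
    also have "bind_pmf M (\<lambda>(x, s', d). map_pmf (\<lambda>(y, s'', d'). (s'', q + d + d')) (N x s'))
       = map_pmf (\<lambda>(x, s', d). (s', q + d)) P"
      unfolding P_def map_bind_pmf
      by (intro bind_pmf_cong refl)
        (auto simp: pmf.map_comp o_def split_def add.assoc)
    finally show ?thesis .
  qed
  show ?thesis unfolding refines_def using P1 P2 P3 by (intro exI[of _ P]) auto
qed

lemma refines_Seq:
  assumes "refines c1 s T1 Q1 a R1"
    and "\<And>x s'. x \<in> set_pmf a \<Longrightarrow> R1 x s' \<Longrightarrow> refines c2 s' T2 Q2 (b x) R2"
  shows "refines (Seq c1 c2) s (T1 + T2 + 1) (Q1 + Q2) (bind_pmf a b) R2"
  by (rule refines_bind[OF reaches_Seq assms])

lemma refines_Seq_return: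
  assumes "refines c1 s T1 Q1 (return_pmf x) R1"
    and "\<And>s'. R1 x s' \<Longrightarrow> refines c2 s' T2 Q2 b R2"
  shows "refines (Seq c1 c2) s (T1 + T2 + 1) (Q1 + Q2) b R2"
  using refines_Seq[OF assms(1), of c2 T2 Q2 "\<lambda>_. b" R2] assms(2)
  by (simp add: bind_return_pmf)

lemma refines_Assign_Seq:
  assumes "refines c (s(eval d s := eval e s)) T Q b R"
  shows "refines (Seq (Assign d e) c) s (T + 2) Q b R"
proof -
  have "refines (Assign d e) s 1 0 (return_pmf ()) (\<lambda>_ s'. s' = s(eval d s := eval e s))"
    by (rule refines_Assign) simp
  from refines_Seq_return[OF this, of c T Q b R] assms show ?thesis
    by simp
qed

lemma refines_Query_Seq:
  assumes "refines c (s(eval d s := of_bool (f (load_point n (eval e s) s)))) T Q b R"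
  shows "refines (Seq (Query d e) c) s (T + 2) (Q + 1) b R"
proof -
  have "refines (Query d e) s 1 1 (return_pmf ())
      (\<lambda>_ s'. s' = s(eval d s := of_bool (f (load_point n (eval e s) s))))"
    by (rule refines_Query) simp
  from refines_Seq_return[OF this, of c T Q b R] assms show ?thesis
    by simp
qed

lemma refines_Toss_Seq:
  assumes "\<And>b. refines c (s(eval d s := of_bool b)) T Q (g b) R"
  shows "refines (Seq (Toss d) c) s (T + 2) Q (bind_pmf (bernoulli_pmf (1/2)) g) R"
proof -
  have "refines (Toss d) s 1 0 (bernoulli_pmf (1/2)) (\<lambda>b s'. s' = s(eval d s := of_bool b))"
    by (rule refines_Toss) simp
  from refines_Seq[OF this, of c T Q g R] assms show ?thesis
    by simp
qed

lemma refines_Sample_Seq: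
  assumes "\<And>x. x \<in> set_pmf D \<Longrightarrow> refines c (store_point (eval e s) x s) T Q (g x) R"
  shows "refines (Seq (Sample e) c) s (T + 2) (Q + 1) (bind_pmf D g) R"
proof -
  have "refines (Sample e) s 1 1 D (\<lambda>x s'. x \<in> set_pmf D \<and> s' = store_point (eval e s) x s)"
    by (rule refines_Sample) simp
  from refines_Seq[OF this, of c T Q g R] assms show ?thesis
    by simp
qed

lemma refines_While_step:
  assumes "eval e s \<noteq> 0" "refines c s T1 Q1 a R1"
    and "\<And>x s'. x \<in> set_pmf a \<Longrightarrow> R1 x s' \<Longrightarrow> refines (While e c) s' T2 Q2 (b x) R2"
  shows "refines (While e c) s (T1 + T2 + 1) (Q1 + Q2) (bind_pmf a b) R2"
  by (rule refines_bind[OF reaches_While_step[OF assms(1)] assms(2,3)])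

lemma refines_While_end:
  "eval e s = 0 \<Longrightarrow> R x s \<Longrightarrow> refines (While e c) s 1 0 (return_pmf x) R"
  by (rule refines_return[of _ _ _ s 0]) (simp_all add: reaches_While_end[simplified])

lemma refines_If:
  assumes "eval e s \<noteq> 0 \<Longrightarrow> refines c1 s T1 Q1 a R" "eval e s = 0 \<Longrightarrow> refines c2 s T2 Q2 a R"
  shows "refines (If e c1 c2) s (max T1 T2 + 1) (max Q1 Q2) a R"
proof -
  have "refines (if eval e s \<noteq> 0 then c1 else c2) s (max T1 T2) (max Q1 Q2) a R"
  proof (cases "eval e s = 0")
    case True
    then show ?thesis using refines_weaken[OF assms(2)[OF True], of "max T1 T2" "max Q1 Q2" R] by simp
  next
    case False
    then show ?thesis using refines_weaken[OF assms(1)[OF False], of "max T1 T2" "max Q1 Q2" R] by simp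
  qed
  then obtain M where M: "\<And>q. reaches (if eval e s \<noteq> 0 then c1 else c2) (s, q) (max T1 T2)
      (map_pmf (\<lambda>(x, s', d). (s', q + d)) M)" "map_pmf fst M = a"
    "\<And>x s' d. (x, s', d) \<in> set_pmf M \<Longrightarrow> R x s' \<and> d \<le> max Q1 Q2"
    by (rule refinesE) blast
  then show ?thesis unfolding refines_def by (intro exI[of _ M]) (use reaches_If[OF M(1)] in auto)
qed

end

section \<open>Bounded loops and their abstract counterpart\<close>

primrec iter_pmf :: "nat \<Rightarrow> nat \<Rightarrow> (nat \<Rightarrow> 'x \<Rightarrow> 'x pmf) \<Rightarrow> 'x \<Rightarrow> 'x pmf" where
  "iter_pmf 0 i g x = return_pmf x"
| "iter_pmf (Suc m) i g x = bind_pmf (g i x) (iter_pmf m (Suc i) g)"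

text \<open>The recursion peels off the first round, as \<open>While\<close> does; probability
  estimates need the last round, conditioned on the state before it.\<close>

lemma iter_pmf_snoc: "iter_pmf (Suc m) i g x = bind_pmf (iter_pmf m i g x) (g (i + m))"
proof (induction m arbitrary: i x)
  case 0
  have "iter_pmf 0 (Suc i) g = return_pmf" by auto
  then show ?case by (simp add: bind_return_pmf bind_return_pmf')
next
  case (Suc m)
  have "iter_pmf (Suc (Suc m)) i g x = bind_pmf (g i x) (\<lambda>y. iter_pmf (Suc m) (Suc i) g y)"
    by (subst iter_pmf.simps(2)) (rule refl)
  also have "\<dots> = bind_pmf (g i x) (\<lambda>y. bind_pmf (iter_pmf m (Suc i) g y) (g (Suc i + m)))"
    by (simp only: Suc.IH)
  finally show ?case by (simp add: bind_assoc_pmf)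
qed

text \<open>Truncated subtraction makes the guard nonzero exactly while the counter is below the
  bound. The bound \<open>e\<close> is evaluated anew in each round, so its value has to be stable
  under the body.\<close>

definition For :: "nat \<Rightarrow> expr \<Rightarrow> cmd \<Rightarrow> cmd" where
  "For r e c = Seq (Assign (Const r) (Const 0))
     (While (Sub e (Read (Const r))) (Seq c (Assign (Const r) (Add (Read (Const r)) (Const 1)))))"

context oracles begin

text \<open>The invariant of the next round is stated for the memory with the counter already
  incremented. A round costs three extra steps (loop test, sequencing, increment); the final 3 pays
  for initialisation, sequencing and the exit test.\<close>

lemma refines_For:
  assumes I0: "I 0 x (s(r := 0))"
    and e: "\<And>i x s. i \<le> N \<Longrightarrow> I i x s \<Longrightarrow> s r = i \<Longrightarrow> eval e s = N"
    and step: "\<And>i x s. i < N \<Longrightarrow> I i x s \<Longrightarrow> s r = i \<Longrightarrow>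
      refines c s T Q (g i x) (\<lambda>x' s'. s' r = i \<and> I (Suc i) x' (s'(r := Suc i)))"
    and R: "\<And>x s. I N x s \<Longrightarrow> s r = N \<Longrightarrow> R x s"
  shows "refines (For r e c) s (N * (T + 3) + 3) (N * Q) (iter_pmf N 0 g x) R"
proof -
  let ?b = "Seq c (Assign (Const r) (Add (Read (Const r)) (Const 1)))"
  let ?w = "While (Sub e (Read (Const r))) ?b"
  have w: "refines ?w s (j * (T + 3) + 1) (j * Q) (iter_pmf j i g x) R"
    if "I i x s" "s r = i" "i + j = N" for i j x s
    using that
  proof (induction j arbitrary: i x s)
    case 0
    then have "eval (Sub e (Read (Const r))) s = 0" "R x s"
      using e[of i x s] R[of x s] by auto
    from refines_While_end[where R = R, OF this] show ?case by simp
  next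
    case (Suc j)
    have ev: "eval (Sub e (Read (Const r))) s \<noteq> 0"
      using Suc.prems e[of i x s] by simp
    have b: "refines ?b s (T + 1 + 1) (Q + 0) (bind_pmf (g i x) return_pmf)
       (\<lambda>x s. s r = Suc i \<and> I (Suc i) x s)"
    proof (rule refines_Seq[OF step])
      fix y s'
      assume "s' r = i \<and> I (Suc i) y (s'(r := Suc i))"
      then show "refines (Assign (Const r) (Add (Read (Const r)) (Const 1))) s' 1 0 (return_pmf y)
         (\<lambda>x s. s r = Suc i \<and> I (Suc i) x s)"
        by (intro refines_Assign) simp
    qed (use Suc.prems in auto)
    have "refines ?w s ((T + 1 + 1) + (j * (T + 3) + 1) + 1) ((Q + 0) + j * Q)
        (bind_pmf (bind_pmf (g i x) return_pmf) (iter_pmf j (Suc i) g)) R"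
      by (rule refines_While_step[OF ev b]) (use Suc.prems Suc.IH in auto)
    then show ?case unfolding bind_return_pmf' iter_pmf.simps
      by (rule refines_weaken) (simp_all add: algebra_simps)
  qed
  have "refines (For r e c) s (1 + (N * (T + 3) + 1) + 1) (0 + N * Q)
     (bind_pmf (return_pmf x) (iter_pmf N 0 g)) R"
    unfolding For_def
  proof (rule refines_Seq)
    show "refines (Assign (Const r) (Const 0)) s 1 0 (return_pmf x) (\<lambda>y s'. y = x \<and> s' = s(r := 0))"
      by (rule refines_Assign) simp
  qed (use I0 w[of 0] in auto)
  then show ?thesis unfolding bind_return_pmf
    by (rule refines_weaken) simp_all
qed

end

subsection \<open>Probabilities in the probability mass monad\<close>

lemma prob_bind_pmf:
  "measure_pmf.prob (bind_pmf p g) B = measure_pmf.expectation p (\<lambda>x. measure_pmf.prob (g x) B)"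
  unfolding measure_pmf_bind
  by (subst measure_pmf.measure_bind[where N = "count_space UNIV"])
    (auto simp: space_subprob_algebra prob_space_imp_subprob_space measure_pmf.prob_space_axioms)

lemma integrable_prob_pmf [simp, intro]:
  "integrable (measure_pmf p) (\<lambda>x. measure_pmf.prob (g x) B)"
  by (rule measure_pmf.integrable_const_bound[where B = 1]) auto

lemma integrable_indicator_pmf [simp, intro]:
  "integrable (measure_pmf p) (indicator A :: _ \<Rightarrow> real)"
  by (rule measure_pmf.integrable_const_bound[where B = 1]) auto

lemma prob_bind_mono:
  assumes "\<And>x. x \<in> set_pmf p \<Longrightarrow> measure_pmf.prob (g x) B \<le> measure_pmf.prob (g' x) B'"
  shows "measure_pmf.prob (bind_pmf p g) B \<le> measure_pmf.prob (bind_pmf p g') B'"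
  unfolding prob_bind_pmf by (intro integral_mono_AE) (auto simp: AE_measure_pmf_iff assms)

lemma prob_bind_le_mult:
  assumes "\<And>x. x \<in> set_pmf p \<Longrightarrow> x \<in> A \<Longrightarrow> measure_pmf.prob (g x) B \<le> c"
    and "\<And>x. x \<in> set_pmf p \<Longrightarrow> x \<notin> A \<Longrightarrow> measure_pmf.prob (g x) B = 0"
  shows "measure_pmf.prob (bind_pmf p g) B \<le> measure_pmf.prob p A * c"
proof -
  have "measure_pmf.prob (bind_pmf p g) B \<le> measure_pmf.expectation p (\<lambda>x. indicator A x * c)"
    unfolding prob_bind_pmf
    by (intro integral_mono_AE integrable_prob_pmf integrable_mult_left integrable_indicator_pmf)
      (auto simp: AE_measure_pmf_iff assms indicator_def)
  then show ?thesis by simp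
qed

lemma prob_bind_le_add:
  assumes "\<And>x. x \<in> set_pmf p \<Longrightarrow> x \<notin> A \<Longrightarrow> measure_pmf.prob (g x) B \<le> c" "c \<ge> 0"
  shows "measure_pmf.prob (bind_pmf p g) B \<le> measure_pmf.prob p A + c"
proof -
  have *: "measure_pmf.prob (g x) B \<le> indicator A x + c" if "x \<in> set_pmf p" for x
    using assms(1)[OF that] assms(2) order_trans[OF measure_pmf.prob_le_1[of "g x" B]]
    by (cases "x \<in> A") (simp_all add: indicator_def)
  have "measure_pmf.prob (bind_pmf p g) B \<le> measure_pmf.expectation p (\<lambda>x. indicator A x + c)"
    unfolding prob_bind_pmf
    by (intro integral_mono_AE integrable_prob_pmf Bochner_Integration.integrable_add integrable_indicator_pmf)
      (auto simp: AE_measure_pmf_iff *)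
  also have "\<dots> = measure_pmf.prob p A + c" by (subst Bochner_Integration.integral_add) auto
  finally show ?thesis .
qed

lemma prob_bind_le:
  assumes "\<And>x. x \<in> set_pmf p \<Longrightarrow> measure_pmf.prob (g x) B \<le> c" 
  shows "measure_pmf.prob (bind_pmf p g) B \<le> c"
  using prob_bind_le_mult[of p UNIV g B c] assms by simp

lemma prob_bind_ge_mult:
  assumes "\<And>x. x \<in> set_pmf p \<Longrightarrow> x \<in> A \<Longrightarrow> c \<le> measure_pmf.prob (g x) B"
  shows "measure_pmf.prob p A * c \<le> measure_pmf.prob (bind_pmf p g) B"
proof -
  have "measure_pmf.expectation p (\<lambda>x. indicator A x * c) \<le> measure_pmf.prob (bind_pmf p g) B"
    unfolding prob_bind_pmf
    by (intro integral_mono_AE integrable_prob_pmf integrable_mult_left integrable_indicator_pmf)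
      (auto simp: AE_measure_pmf_iff assms indicator_def)
  then show ?thesis by simp
qed

lemma prob_eq_0_iff: "measure_pmf.prob p A = 0 \<longleftrightarrow> set_pmf p \<inter> A = {}"
  by (simp add: measure_pmf_zero_iff)

lemma prob_Un_le: "measure_pmf.prob p (A \<union> B) \<le> measure_pmf.prob p A + measure_pmf.prob p B"
  by (rule measure_Un_le) auto

lemma prob_UN_le:
  "finite I \<Longrightarrow> measure_pmf.prob p (\<Union>i\<in>I. A i) \<le> (\<Sum>i\<in>I. measure_pmf.prob p (A i))"
  by (rule measure_UNION_le) auto

lemma prob_mono_set:
  assumes "\<And>x. x \<in> set_pmf p \<Longrightarrow> x \<in> A \<Longrightarrow> x \<in> B"
  shows "measure_pmf.prob p A \<le> measure_pmf.prob p B"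
  by (rule measure_pmf.finite_measure_mono_AE) (auto simp: AE_measure_pmf_iff assms)

section \<open>Error probabilities of repeated random rounds\<close>

lemma iter_pmf_invariant:
  assumes "y \<in> set_pmf (iter_pmf m i g x)" "I i x"
    and "\<And>j x y. I j x \<Longrightarrow> y \<in> set_pmf (g j x) \<Longrightarrow> I (Suc j) y"
  shows "I (i + m) y"
  using assms(1,2)
proof (induction m arbitrary: i x)
  case (Suc m)
  then show ?case using assms(3) by (fastforce simp del: add_Suc_right simp: add_Suc_right[symmetric])
qed simp

text \<open>Leaving \<open>A\<close> is final, so the process ends in \<open>A\<close> only if it
  stayed there in every round, and the factors multiply. In the applications \<open>A\<close> says
  that no round has exposed an error.\<close>

lemma prob_iter_pmf_le_power:
  assumes "\<And>i x. x \<in> A \<Longrightarrow> measure_pmf.prob (g i x) A \<le> c"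
    and "\<And>i x. x \<notin> A \<Longrightarrow> set_pmf (g i x) \<inter> A = {}" and "c \<ge> 0"
  shows "measure_pmf.prob (iter_pmf m i g x) A \<le> c ^ m"
proof (induction m)
  case (Suc m)
  have "measure_pmf.prob (iter_pmf (Suc m) i g x) A
      \<le> measure_pmf.prob (iter_pmf m i g x) A * c"
    unfolding iter_pmf_snoc
    by (rule prob_bind_le_mult) (use assms in \<open>auto simp: prob_eq_0_iff\<close>)
  also have "\<dots> \<le> c ^ m * c" using Suc.IH \<open>c \<ge> 0\<close> by (rule mult_right_mono)
  finally show ?case by (simp add: mult.commute)
qed simp

text \<open>Union bound over the rounds: to end in \<open>A\<close>, some round must enter it from a
  state outside \<open>A\<close> that satisfies the invariant.\<close>

lemma prob_iter_pmf_le_mult: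
  assumes "I i x" "\<And>j x y. I j x \<Longrightarrow> y \<in> set_pmf (g j x) \<Longrightarrow> I (Suc j) y"
    and "x \<notin> A" "\<And>j x. j < i + m \<Longrightarrow> I j x \<Longrightarrow> x \<notin> A \<Longrightarrow> measure_pmf.prob (g j x) A \<le> c" "c \<ge> 0"
  shows "measure_pmf.prob (iter_pmf m i g x) A \<le> real m * c"
  using assms(4)
proof (induction m)
  case 0
  then show ?case using assms(3) by simp
next
  case (Suc m)
  have "measure_pmf.prob (iter_pmf (Suc m) i g x) A \<le> measure_pmf.prob (iter_pmf m i g x) A + c"
    unfolding iter_pmf_snoc
  proof (rule prob_bind_le_add)
    fix y assume "y \<in> set_pmf (iter_pmf m i g x)" "y \<notin> A"
    moreover have "I (i + m) y" using calculation(1) assms(1,2) by (rule iter_pmf_invariant)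
    ultimately show "measure_pmf.prob (g (i + m) y) A \<le> c" using Suc.prems by simp
  qed fact
  also have "\<dots> \<le> real m * c + c" using Suc by simp
  finally show ?case by (simp add: algebra_simps)
qed

text \<open>Since \<open>A\<close> cannot be entered again, one round that rarely ends in
  \<open>A\<close> is enough, whatever the other rounds do. This serves the case of a single faulty
  block.\<close>

lemma prob_iter_pmf_le_single:
  assumes "l < m" "\<And>x. measure_pmf.prob (g (i + l) x) A \<le> c"
    and "\<And>i x. x \<notin> A \<Longrightarrow> set_pmf (g i x) \<inter> A = {}"
  shows "measure_pmf.prob (iter_pmf m i g x) A \<le> c"
  using assms(1)
proof (induction m)
  case (Suc m)
  show ?case
  proof (cases "l = m")
    case True
    then show ?thesis unfolding iter_pmf_snoc using assms(2) by (intro prob_bind_le) auto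
  next
    case False
    have "measure_pmf.prob (iter_pmf (Suc m) i g x) A \<le> measure_pmf.prob (iter_pmf m i g x) A * 1"
      unfolding iter_pmf_snoc
      by (rule prob_bind_le_mult) (use assms(3) in \<open>auto simp: prob_eq_0_iff\<close>)
    with Suc False show ?thesis by auto
  qed
qed simp

subsection \<open>Decision lists and the greedy fit\<close>

definition rule_vars :: "rule list \<Rightarrow> nat set" where
  "rule_vars L = fst ` set L"

lemma rule_vars_simps [simp]:
  "rule_vars [] = {}" "rule_vars ((i, \<xi>, a) # L) = insert i (rule_vars L)"
  "rule_vars (L @ M) = rule_vars L \<union> rule_vars M"
  by (auto simp: rule_vars_def)

lemma card_rule_vars: "finite (rule_vars L)" "card (rule_vars L) \<le> length L"
  using card_image_le[of "set L" fst] card_length[of L] by (auto simp: rule_vars_def)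

lemma length_decision_list_iff:
  "f \<in> length_decision_list n k \<longleftrightarrow>
     (\<exists>L b. length L \<le> k \<and> rule_vars L \<subseteq> {..<n} \<and> (\<forall>x\<in>cube n. f x = dl_eval L b x))"
  unfolding length_decision_list_def rule_vars_def by fastforce

lemma dl_eval_append: "dl_eval (L @ M) b x = dl_eval L (dl_eval M b x) x"
  by (induction L b x rule: dl_eval.induct) auto

lemma dl_eval_cong:
  "(\<And>i. i \<in> rule_vars L \<Longrightarrow> x ! i = y ! i) \<Longrightarrow> dl_eval L b x = dl_eval L b y"
  by (induction L b x rule: dl_eval.induct) auto

text \<open>Substituting coordinates (\<open>Some\<close>) or the constant \<open>False\<close> (\<open>None\<close>) for the variables.\<close>

lemma dl_eval_subst:
  "\<exists>L' b'. length L' \<le> length L \<and> rule_vars L' \<subseteq> {j. \<exists>i\<in>rule_vars L. \<sigma> i = Some j} \<and>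
     (\<forall>x y. (\<forall>i\<in>rule_vars L. y ! i = (case \<sigma> i of None \<Rightarrow> False | Some j \<Rightarrow> x ! j)) \<longrightarrow>
        dl_eval L b y = dl_eval L' b' x)"
proof (induction L)
  case Nil
  show ?case by (rule exI[of _ "[]"], rule exI[of _ b]) simp
next
  case (Cons r L)
  obtain i \<xi> a where r: "r = (i, \<xi>, a)" by (cases r)
  from Cons.IH obtain L' b' where *: "length L' \<le> length L"
    "rule_vars L' \<subseteq> {j. \<exists>i\<in>rule_vars L. \<sigma> i = Some j}"
    "\<forall>x y. (\<forall>i\<in>rule_vars L. y ! i = (case \<sigma> i of None \<Rightarrow> False | Some j \<Rightarrow> x ! j)) \<longrightarrow>
        dl_eval L b y = dl_eval L' b' x" by auto
  \<comment> \<open>A variable replaced by the constant False either never triggers its rule, which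
    is dropped, or always triggers it, which cuts the list and turns the output into the
    default.\<close>
  consider j where "\<sigma> i = Some j" | "\<sigma> i = None" \<xi> | "\<sigma> i = None" "\<not> \<xi>"
    by (cases "\<sigma> i") auto
  then show ?case
  proof cases
    case 1
    then show ?thesis using *
      by (intro exI[of _ "(j, \<xi>, a) # L'"] exI[of _ b']) (auto simp: r)
  next
    case 2
    then show ?thesis using *
      by (intro exI[of _ L'] exI[of _ b']) (auto simp: r)
  next
    case 3
    then show ?thesis
      by (intro exI[of _ "[]"] exI[of _ a]) (auto simp: r)
  qed
qed

lemma dl_restrict:
  "\<exists>L' b'. rule_vars L' \<subseteq> rule_vars L - {i} \<and> length L' \<le> length L \<and>
     (\<forall>x. x ! i = v \<longrightarrow> dl_eval L b x = dl_eval L' b' x)"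
proof (induction L)
  case Nil
  show ?case by (rule exI[of _ "[]"], rule exI[of _ b]) simp
next
  case (Cons r L)
  obtain j \<xi> a where r: "r = (j, \<xi>, a)" by (cases r)
  from Cons.IH obtain L' b' where *: "rule_vars L' \<subseteq> rule_vars L - {i}" "length L' \<le> length L"
     "\<forall>x. x ! i = v \<longrightarrow> dl_eval L b x = dl_eval L' b' x" by auto
  consider "j \<noteq> i" | "j = i" "\<xi> = v" | "j = i" "\<xi> \<noteq> v" by auto
  then show ?case
  proof cases
    case 1
    then show ?thesis using *
      by (intro exI[of _ "(j, \<xi>, a) # L'"] exI[of _ b']) (auto simp: r)
  next
    case 2
    then show ?thesis
      by (intro exI[of _ "[]"] exI[of _ a]) (auto simp: r)
  next
    case 3
    then show ?thesis using *
      by (intro exI[of _ L'] exI[of _ b']) (auto simp: r)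
  qed
qed

text \<open>Behind the first test of a variable its value is known, so \<open>dl_restrict\<close>
  eliminates the variable from the rest and each variable is tested only once. This makes the number
  of variables as good a bound as the length.\<close>

lemma dl_compress:
  "\<exists>L' b'. rule_vars L' \<subseteq> rule_vars L \<and> length L' \<le> card (rule_vars L) \<and>
     (\<forall>x. dl_eval L b x = dl_eval L' b' x)"
proof (induction "length L" arbitrary: L b rule: less_induct)
  case less
  show ?case
  proof (cases L)
    case Nil
    then show ?thesis by (intro exI[of _ "[]"] exI[of _ b]) auto
  next
    case (Cons r M)
    obtain i \<xi> a where r: "r = (i, \<xi>, a)" by (cases r)
    obtain M1 b1 where 1: "rule_vars M1 \<subseteq> rule_vars M - {i}" "length M1 \<le> length M"
      "\<And>x. x ! i = (\<not> \<xi>) \<Longrightarrow> dl_eval M b x = dl_eval M1 b1 x"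
      using dl_restrict[of M i "\<not> \<xi>" b] by auto
    obtain M2 b2 where 2: "rule_vars M2 \<subseteq> rule_vars M1" "length M2 \<le> card (rule_vars M1)"
      "\<And>x. dl_eval M1 b1 x = dl_eval M2 b2 x"
      using less[of M1 b1] 1(2) Cons by auto
    have "card (rule_vars M1) < card (rule_vars L)"
      using 1(1) by (intro psubset_card_mono card_rule_vars) (auto simp: Cons r)
    then show ?thesis using 1 2
      by (intro exI[of _ "(i, \<xi>, a) # M2"] exI[of _ b2]) (auto simp: Cons r)
  qed
qed

section \<open>Greedy construction of a decision list from a table\<close>

definition monochromatic :: "(bool list \<times> bool) list \<Rightarrow> nat set \<Rightarrow> bool" where
  "monochromatic tab S \<longleftrightarrow> \<not> ((\<exists>i\<in>S. snd (tab ! i)) \<and> (\<exists>i\<in>S. \<not> snd (tab ! i)))"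

text \<open>Rivest's elimination step: if the surviving rows satisfying a literal share a label, the
  literal becomes a rule and these rows are explained.\<close>

definition kill :: "(bool list \<times> bool) list \<Rightarrow> nat \<Rightarrow> bool \<Rightarrow> nat set \<Rightarrow> nat set" where
  "kill tab l \<xi> A = (if monochromatic tab {i\<in>A. fst (tab ! i) ! l = \<xi>}
     then A - {i\<in>A. fst (tab ! i) ! l = \<xi>} else A)"

text \<open>Trying all literals in a fixed order avoids any choice of the next rule; one pass
  removes at least the rows that a single well chosen rule would remove.\<close>

primrec sweep :: "(bool list \<times> bool) list \<Rightarrow> nat \<Rightarrow> nat set \<Rightarrow> nat set" where
  "sweep tab 0 A = A"
| "sweep tab (Suc l) A = kill tab l True (kill tab l False (sweep tab l A))"

definition survivors :: "(bool list \<times> bool) list \<Rightarrow> nat \<Rightarrow> nat \<Rightarrow> nat set" where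
  "survivors tab q j = (sweep tab q ^^ j) {..<length tab}"

definition greedy_fit :: "(bool list \<times> bool) list \<Rightarrow> nat \<Rightarrow> nat \<Rightarrow> bool" where
  "greedy_fit tab q k \<longleftrightarrow> monochromatic tab (survivors tab q k)"

lemma kill_subset: "kill tab l \<xi> A \<subseteq> A"
  by (auto simp: kill_def)

lemma sweep_subset: "sweep tab q A \<subseteq> A"
  by (induction q) (use kill_subset in \<open>simp_all, blast\<close>)

text \<open>Quantifying over the default \<open>b\<close> expresses that the rows of
  \<open>A\<close> fall through all rules of \<open>L\<close>, so that \<open>L\<close> can be
  extended at its end.\<close>

definition partial_fit :: "(bool list \<times> bool) list \<Rightarrow> nat \<Rightarrow> nat set \<Rightarrow> bool" where
  "partial_fit tab q A \<longleftrightarrow> (\<exists>L. rule_vars L \<subseteq> {..<q} \<and> (\<forall>i<length tab. \<forall>b.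
     dl_eval L b (fst (tab ! i)) = (if i \<in> A then b else snd (tab ! i))))"

lemma partial_fit_kill:
  assumes "partial_fit tab q A" "l < q"
  shows "partial_fit tab q (kill tab l \<xi> A)"
proof (cases "monochromatic tab {i\<in>A. fst (tab ! i) ! l = \<xi>}")
  case True
  then obtain a where a: "\<And>i. i \<in> A \<Longrightarrow> fst (tab ! i) ! l = \<xi> \<Longrightarrow> snd (tab ! i) = a"
    unfolding monochromatic_def by blast
  from assms obtain L where L: "rule_vars L \<subseteq> {..<q}" "\<And>i b. i < length tab \<Longrightarrow>
     dl_eval L b (fst (tab ! i)) = (if i \<in> A then b else snd (tab ! i))"
    unfolding partial_fit_def by blast
  show ?thesis unfolding partial_fit_def
    by (rule exI[of _ "L @ [(l, \<xi>, a)]"])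
      (use True L a assms(2) in \<open>auto simp: kill_def dl_eval_append\<close>)
qed (use assms in \<open>simp add: kill_def\<close>)

lemma partial_fit_sweep: "partial_fit tab q A \<Longrightarrow> l \<le> q \<Longrightarrow> partial_fit tab q (sweep tab l A)"
  by (induction l) (simp_all add: partial_fit_kill)

text \<open>The rules collected by the sweeps may outnumber \<open>q\<close> by far;
  \<open>dl_compress\<close> bounds the length by the number of columns, which keeps the later union
  bound small.\<close>

lemma greedy_fit_sound:
  assumes "greedy_fit tab q k"
  shows "\<exists>L b. rule_vars L \<subseteq> {..<q} \<and> length L \<le> q \<and> (\<forall>(vs, y)\<in>set tab. dl_eval L b vs = y)"
proof -
  have "partial_fit tab q (survivors tab q k)" unfolding survivors_def
  proof (induction k)
    case 0
    show ?case unfolding partial_fit_def by (intro exI[of _ "[]"]) auto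
  qed (simp add: partial_fit_sweep)
  then obtain L where L: "rule_vars L \<subseteq> {..<q}" "\<And>i b. i < length tab \<Longrightarrow>
     dl_eval L b (fst (tab ! i)) = (if i \<in> survivors tab q k then b else snd (tab ! i))"
    unfolding partial_fit_def by blast
  from assms obtain b where b: "\<And>i. i \<in> survivors tab q k \<Longrightarrow> snd (tab ! i) = b"
    unfolding greedy_fit_def monochromatic_def by blast
  obtain L' b' where L': "rule_vars L' \<subseteq> rule_vars L" "length L' \<le> card (rule_vars L)"
     "\<And>x. dl_eval L b x = dl_eval L' b' x"
    using dl_compress[of L b] by blast
  have "card (rule_vars L) \<le> q" using card_mono[OF _ L(1)] by simp
  moreover have "dl_eval L b (fst (tab ! i)) = snd (tab ! i)" if "i < length tab" for i
    using L(2)[OF that, of b] b[of i] by auto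
  ultimately show ?thesis using L(1) L' by (intro exI[of _ L'] exI[of _ b']) (force simp: in_set_conv_nth)
qed

text \<open>A literal that is uniform on \<open>A\<close> stays uniform when rows disappear, so its
  turn in the sweep removes its rows although earlier literals have already changed the set.\<close>

lemma sweep_removes:
  assumes "l < q" "\<And>i. i \<in> A \<Longrightarrow> fst (tab ! i) ! l = \<xi> \<Longrightarrow> snd (tab ! i) = a"
    and "i \<in> sweep tab q A"
  shows "fst (tab ! i) ! l \<noteq> \<xi>"
  using assms(1,3)
proof (induction q)
  case (Suc q)
  show ?case
  proof (cases "l = q")
    case True
    have mono: "monochromatic tab {i\<in>B. fst (tab ! i) ! l = \<xi>}" if "B \<subseteq> A" for B
      using that assms(2) unfolding monochromatic_def by blast
    have rm: "i \<notin> kill tab l \<xi> B" if "B \<subseteq> A" "fst (tab ! i) ! l = \<xi>" for B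
      using mono[OF that(1)] that(2) by (auto simp: kill_def)
    show ?thesis
    proof
      assume eq: "fst (tab ! i) ! l = \<xi>"
      have s: "sweep tab l A \<subseteq> A" "kill tab l False (sweep tab l A) \<subseteq> A"
        using sweep_subset kill_subset by blast+
      from Suc.prems(2) have i: "i \<in> kill tab l True (kill tab l False (sweep tab l A))"
        using True by simp
      then have "i \<in> kill tab l False (sweep tab l A)" using kill_subset by blast
      with i rm[OF s(1) eq] rm[OF s(2) eq] show False by (cases \<xi>) auto
    qed
  next
    case False
    with Suc.prems(1) have "l < q" by simp
    moreover have "i \<in> sweep tab q A" using Suc.prems(2) kill_subset by (simp, blast)
    ultimately show ?thesis using Suc.IH by blast
  qed
qed simp

text \<open>After \<open>j\<close> sweeps the first \<open>j\<close> rules of the consistent list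
  \<open>L\<close> fire on no surviving row; the next rule is then uniform on the survivors and is
  used up by the next sweep. After \<open>k\<close> sweeps only rows with the default label
  remain.\<close>

lemma greedy_fit_complete:
  assumes "rule_vars L \<subseteq> {..<q}" "length L \<le> k" "\<And>vs y. (vs, y) \<in> set tab \<Longrightarrow> dl_eval L b vs = y"
  shows "greedy_fit tab q k"
proof -
  have lt: "i < length tab" if "i \<in> survivors tab q j" for i j
    using that unfolding survivors_def by (induction j) (use sweep_subset in auto)
  have fit: "dl_eval L b (fst (tab ! i)) = snd (tab ! i)" if "i < length tab" for i
    using assms(3)[of "fst (tab ! i)" "snd (tab ! i)"] that by simp
  have "dl_eval (take j L) c (fst (tab ! i)) = c" if "i \<in> survivors tab q j" for i j c
    using that
  proof (induction j arbitrary: i c)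
    case (Suc j)
    let ?A = "survivors tab q j"
    have i: "i \<in> sweep tab q ?A" using Suc.prems by (simp add: survivors_def)
    then have iA: "i \<in> ?A" using sweep_subset by blast
    show ?case
    proof (cases "j < length L")
      case True
      obtain l \<xi> a where r: "L ! j = (l, \<xi>, a)" by (cases "L ! j")
      have "(l, \<xi>, a) \<in> set L" using True r nth_mem by metis
      then have "l < q" using assms(1) by (force simp: rule_vars_def)
      have L: "L = take j L @ (l, \<xi>, a) # drop (Suc j) L"
        using True r by (metis id_take_nth_drop)
      \<comment> \<open>By induction a survivor falls through the first \<open>j\<close> rules, so
        satisfying the next literal forces the label \<open>a\<close>.\<close>
      have "snd (tab ! i') = a" if "i' \<in> ?A" "fst (tab ! i') ! l = \<xi>" for i'
        using fit[OF lt[OF that(1)]] Suc.IH[OF that(1)] that(2)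
        by (subst (asm) L) (simp add: dl_eval_append)
      from sweep_removes[OF \<open>l < q\<close> this i] have "fst (tab ! i) ! l \<noteq> \<xi>" by blast
      then show ?thesis using Suc.IH[OF iA] True r
        by (simp add: take_Suc_conv_app_nth dl_eval_append)
    qed (use Suc.IH[OF iA] in simp)
  qed simp
  from this[of _ k b] have "snd (tab ! i) = b" if "i \<in> survivors tab q k" for i
    using that assms(2) fit[OF lt[OF that]] by simp
  then show ?thesis unfolding greedy_fit_def monochromatic_def by blast
qed

subsection \<open>Points of the cube and linearity testing\<close>

abbreviation coin :: "bool pmf" where
  "coin \<equiv> bernoulli_pmf (1 / 2)"

abbreviation uniform_point :: "nat \<Rightarrow> bool list pmf" where
  "uniform_point n \<equiv> replicate_pmf n coin"

definition xor_point :: "bool list \<Rightarrow> bool list \<Rightarrow> bool list" where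
  "xor_point u x = map2 (\<noteq>) u x"

definition and_point :: "bool list \<Rightarrow> bool list \<Rightarrow> bool list" where
  "and_point u x = map2 (\<and>) u x"

definition unit_point :: "nat \<Rightarrow> nat \<Rightarrow> bool list" where
  "unit_point n i = (replicate n False)[i := True]"

lemma cube_iff [simp]: "x \<in> cube n \<longleftrightarrow> length x = n"
  by (simp add: cube_def)

lemma set_uniform_point: "set_pmf (uniform_point n) = cube n"
  by (auto simp: set_replicate_pmf cube_def lists_eq_set)

lemma point_cube [simp]:
  "u \<in> cube n \<Longrightarrow> x \<in> cube n \<Longrightarrow> xor_point u x \<in> cube n"
  "u \<in> cube n \<Longrightarrow> x \<in> cube n \<Longrightarrow> and_point u x \<in> cube n"
  "unit_point n i \<in> cube n" "replicate n b \<in> cube n"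
  by (simp_all add: cube_def xor_point_def and_point_def unit_point_def)

lemma length_point [simp]:
  "length (xor_point u x) = min (length u) (length x)"
  "length (and_point u x) = min (length u) (length x)"
  "length (unit_point n i) = n"
  by (simp_all add: xor_point_def and_point_def unit_point_def)

lemma point_nth:
  "i < length u \<Longrightarrow> i < length x \<Longrightarrow> xor_point u x ! i \<longleftrightarrow> u ! i \<noteq> x ! i"
  "i < length u \<Longrightarrow> i < length x \<Longrightarrow> and_point u x ! i \<longleftrightarrow> u ! i \<and> x ! i"
  "i < n \<Longrightarrow> unit_point n j ! i \<longleftrightarrow> i = j"
proof -
  show "unit_point n j ! i \<longleftrightarrow> i = j" if "i < n"
    using that by (cases "j < n") (auto simp: unit_point_def nth_list_update list_update_beyond)
qed (simp_all add: xor_point_def and_point_def)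

lemmas point_simps = point_nth

lemma point_eqI: "u \<in> cube n \<Longrightarrow> x \<in> cube n \<Longrightarrow> (\<And>i. i < n \<Longrightarrow> u ! i = x ! i) \<Longrightarrow> u = x"
  by (auto simp: cube_def intro: nth_equalityI)

lemma xor_point_cancel: "u \<in> cube n \<Longrightarrow> x \<in> cube n \<Longrightarrow> xor_point (xor_point u x) x = u"
  by (rule point_eqI[of _ n]) (auto simp: point_simps)

lemma xor_point_assoc:
  "u \<in> cube n \<Longrightarrow> v \<in> cube n \<Longrightarrow> w \<in> cube n \<Longrightarrow>
   xor_point (xor_point u v) w = xor_point u (xor_point v w)"
  by (rule point_eqI[of _ n]) (auto simp: point_simps)

lemma xor_point_commute: "u \<in> cube n \<Longrightarrow> v \<in> cube n \<Longrightarrow> xor_point u v = xor_point v u"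
  by (rule point_eqI[of _ n]) (auto simp: point_simps)

lemma coin_flip: "map_pmf (\<lambda>b. b \<noteq> c) coin = coin"
proof (cases c)
  case True
  have "map_pmf Not coin = coin"
    by (subst bernoulli_pmf_half_conv_pmf_of_set)+ (subst map_pmf_of_set_bij_betw[of _ UNIV UNIV];
      auto simp: bij_betw_def inj_on_def image_iff)
  then show ?thesis using True by simp
qed (simp add: pmf.map_ident)

lemma uniform_point_shift:
  "x \<in> cube n \<Longrightarrow> map_pmf (\<lambda>u. xor_point u x) (uniform_point n) = uniform_point n"
proof (induction n arbitrary: x)
  case 0
  then show ?case by (simp add: xor_point_def cube_def)
next
  case (Suc n)
  obtain c y where x: "x = c # y" "y \<in> cube n"
    using Suc.prems by (cases x) (auto simp: cube_def)
  have "map_pmf (\<lambda>u. xor_point u x) (uniform_point (Suc n)) =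
      bind_pmf coin (\<lambda>b. bind_pmf (uniform_point n) (\<lambda>u. return_pmf ((b \<noteq> c) # xor_point u y)))"
    by (simp add: map_bind_pmf x(1) xor_point_def)
  also have "\<dots> = bind_pmf (map_pmf (\<lambda>b. b \<noteq> c) coin) (\<lambda>b.
      bind_pmf (map_pmf (\<lambda>u. xor_point u y) (uniform_point n)) (\<lambda>u. return_pmf (b # u)))"
    by (simp add: bind_map_pmf)
  also have "\<dots> = uniform_point (Suc n)"
    unfolding coin_flip Suc.IH[OF x(2)] by simp
  finally show ?case .
qed

lemma bind_uniform_shift:
  assumes "x \<in> cube n"
  shows "bind_pmf (uniform_point n) F = bind_pmf (uniform_point n) (\<lambda>u. F (xor_point u x))"
  by (subst uniform_point_shift[OF assms, symmetric]) (simp add: bind_map_pmf)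

text \<open>Translation by a unit point exchanges the two outcomes, so the probability equals that
  of the complement.\<close>

lemma uniform_point_nth_eq:
  assumes "i < n" "j < n" "i \<noteq> j"
  shows "measure_pmf.prob (uniform_point n) {u. u ! i = u ! j} = 1 / 2"
proof -
  let ?P = "measure_pmf.prob (uniform_point n)"
  have "?P {u. u ! i = u ! j} = measure_pmf.prob (map_pmf (\<lambda>u. xor_point u (unit_point n i)) (uniform_point n)) {u. u ! i = u ! j}"
    by (subst uniform_point_shift) auto
  also have "\<dots> = ?P {u. u ! i \<noteq> u ! j}"
    unfolding measure_map_pmf
    by (rule measure_pmf.finite_measure_eq_AE)
      (use assms in \<open>auto simp: AE_measure_pmf_iff set_uniform_point point_simps\<close>)
  also have "\<dots> = 1 - ?P {u. u ! i = u ! j}"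
    by (subst measure_pmf.prob_compl[symmetric]) (auto intro: arg_cong[where f = ?P])
  finally show ?thesis by simp
qed

text \<open>The self-correcting decoder for parities. Taking a difference cancels an additive
  constant, so a variable and its negation are both decoded as the variable.\<close>

definition parity_at :: "nat \<Rightarrow> (bool list \<Rightarrow> bool) \<Rightarrow> bool list \<Rightarrow> bool pmf" where
  "parity_at n g x = map_pmf (\<lambda>u. g u \<noteq> g (xor_point u x)) (uniform_point n)"

text \<open>Comparing two decodings at the same random point is a linearity test; the comparison at
  \<open>and_point\<close> excludes parities of two or more variables. Constant functions pass as
  well and are decoded as False.\<close>

definition literal_test :: "nat \<Rightarrow> (bool list \<Rightarrow> bool) \<Rightarrow> bool pmf" where
  "literal_test n g = do {
     u \<leftarrow> uniform_point n; v \<leftarrow> uniform_point n;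
     a \<leftarrow> parity_at n g u; a' \<leftarrow> parity_at n g u;
     b \<leftarrow> parity_at n g v; c \<leftarrow> parity_at n g (and_point u v);
     return_pmf (a \<noteq> a' \<or> (a \<and> b) \<noteq> c)}"

definition parity_gap :: "nat \<Rightarrow> (bool list \<Rightarrow> bool) \<Rightarrow> real" where
  "parity_gap n g = measure_pmf.prob (do {
     x \<leftarrow> uniform_point n; a \<leftarrow> parity_at n g x; b \<leftarrow> parity_at n g x;
     return_pmf (a \<noteq> b)}) {True}"

definition corrected :: "nat \<Rightarrow> (bool list \<Rightarrow> bool) \<Rightarrow> bool list \<Rightarrow> bool" where
  "corrected n g x \<longleftrightarrow> measure_pmf.prob (parity_at n g x) {True} \<ge> 1 / 2"

lemma prob_neq_le:
  "measure_pmf.prob (map_pmf (\<lambda>t. A t \<noteq> B t) p) {True} \<le>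
   measure_pmf.prob (map_pmf A p) {True} + measure_pmf.prob (map_pmf B p) {True}"
proof -
  have "measure_pmf.prob (map_pmf (\<lambda>t. A t \<noteq> B t) p) {True} \<le> measure_pmf.prob p ({t. A t} \<union> {t. B t})"
    by (auto intro!: measure_pmf.finite_measure_mono)
  also have "\<dots> \<le> measure_pmf.prob p {t. A t} + measure_pmf.prob p {t. B t}" by (rule prob_Un_le)
  finally show ?thesis by (simp add: vimage_def)
qed

text \<open>Translating \<open>x\<close> by \<open>u\<close> turns the two decodings into the
  four-point affinity test, the exclusive or of \<open>g\<close> at \<open>u\<close>,
  \<open>v\<close>, \<open>w\<close> and their sum.\<close>

lemma parity_gap_triple:
  "parity_gap n g = measure_pmf.prob (do {
     u \<leftarrow> uniform_point n; v \<leftarrow> uniform_point n; w \<leftarrow> uniform_point n;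
     return_pmf ((g u \<noteq> g v) \<noteq> (g w \<noteq> g (xor_point (xor_point u v) w)))}) {True}"
proof -
  let ?U = "uniform_point n"
  have "(do {x \<leftarrow> ?U; a \<leftarrow> parity_at n g x; b \<leftarrow> parity_at n g x; return_pmf (a \<noteq> b)}) =
    (do {x \<leftarrow> ?U; u \<leftarrow> ?U; w \<leftarrow> ?U;
     return_pmf ((g u \<noteq> g (xor_point u x)) \<noteq> (g w \<noteq> g (xor_point w x)))})"
    by (simp add: parity_at_def bind_map_pmf)
  also have "\<dots> = (do {u \<leftarrow> ?U; x \<leftarrow> ?U; w \<leftarrow> ?U;
     return_pmf ((g u \<noteq> g (xor_point u x)) \<noteq> (g w \<noteq> g (xor_point w x)))})"
    by (rule bind_commute_pmf)
  also have "\<dots> = (do {u \<leftarrow> ?U; x \<leftarrow> ?U; w \<leftarrow> ?U;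
     return_pmf ((g u \<noteq> g x) \<noteq> (g w \<noteq> g (xor_point (xor_point u x) w)))})"
  proof (rule bind_pmf_cong[OF refl])
    fix u assume u: "u \<in> set_pmf ?U"
    then have u: "u \<in> cube n" by (simp add: set_uniform_point)
    show "(do {x \<leftarrow> ?U; w \<leftarrow> ?U;
       return_pmf ((g u \<noteq> g (xor_point u x)) \<noteq> (g w \<noteq> g (xor_point w x)))}) =
       (do {x \<leftarrow> ?U; w \<leftarrow> ?U;
       return_pmf ((g u \<noteq> g x) \<noteq> (g w \<noteq> g (xor_point (xor_point u x) w)))})"
      apply (subst bind_uniform_shift[OF u])
      apply (intro bind_pmf_cong refl)
      using u by (simp add: set_uniform_point xor_point_cancel xor_point_commute[of u]
          xor_point_commute[of _ n "xor_point _ _"])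
  qed
  finally show ?thesis by (simp add: parity_gap_def)
qed

text \<open>From average to worst case: the disagreement at \<open>x\<close> is the exclusive or of
  the four-point test on \<open>u\<close>, \<open>v\<close>, \<open>w\<close> and the same test with
  \<open>u\<close> and \<open>v\<close> translated by \<open>x\<close>. The sum of \<open>u\<close>
  and \<open>v\<close> is unchanged, so all terms involving \<open>w\<close> cancel. Both triples
  are uniform, hence the factor 2.\<close>

lemma parity_pair_le:
  assumes x: "x \<in> cube n"
  shows "measure_pmf.prob (do {a \<leftarrow> parity_at n g x; b \<leftarrow> parity_at n g x; return_pmf (a \<noteq> b)}) {True}
    \<le> 2 * parity_gap n g"
proof -
  let ?U = "uniform_point n"
  define p where "p = (do {u \<leftarrow> ?U; v \<leftarrow> ?U; w \<leftarrow> ?U; return_pmf (u, v, w)})"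
  define A where "A = (\<lambda>(u, v, w). (g u \<noteq> g v) \<noteq> (g w \<noteq> g (xor_point (xor_point u v) w)))"
  define B where "B = (\<lambda>(u, v, w). A (xor_point u x, xor_point v x, w))"
  have A: "measure_pmf.prob (map_pmf A p) {True} = parity_gap n g"
    by (simp add: parity_gap_triple p_def A_def map_bind_pmf)
  have "map_pmf B p = (do {u \<leftarrow> ?U; v \<leftarrow> ?U; w \<leftarrow> ?U; return_pmf (A (xor_point u x, xor_point v x, w))})"
    by (simp add: B_def p_def map_bind_pmf)
  also have "\<dots> = (do {u \<leftarrow> ?U; v \<leftarrow> ?U; w \<leftarrow> ?U; return_pmf (A (u, v, w))})"
    by (subst (4) bind_uniform_shift[OF x], subst (5) bind_uniform_shift[OF x]) (rule refl)
  also have "\<dots> = map_pmf A p" by (simp add: p_def map_bind_pmf)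
  finally have B: "measure_pmf.prob (map_pmf B p) {True} = parity_gap n g" using A by simp
  have "(do {a \<leftarrow> parity_at n g x; b \<leftarrow> parity_at n g x; return_pmf (a \<noteq> b)}) =
     (do {u \<leftarrow> ?U; v \<leftarrow> ?U; return_pmf ((g u \<noteq> g (xor_point u x)) \<noteq> (g v \<noteq> g (xor_point v x)))})"
    by (simp add: parity_at_def bind_map_pmf)
  also have "\<dots> = (do {u \<leftarrow> ?U; v \<leftarrow> ?U; w \<leftarrow> ?U; return_pmf (A (u, v, w) \<noteq> B (u, v, w))})"
  proof (intro bind_pmf_cong refl)
    fix u v assume "u \<in> set_pmf ?U" "v \<in> set_pmf ?U"
    then have uv: "u \<in> cube n" "v \<in> cube n" by (simp_all add: set_uniform_point)
    have e: "xor_point (xor_point u x) (xor_point v x) = xor_point u v"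
      using uv x by (intro point_eqI[of _ n]) (auto simp: point_simps)
    show "return_pmf ((g u \<noteq> g (xor_point u x)) \<noteq> (g v \<noteq> g (xor_point v x))) =
       (do {w \<leftarrow> ?U; return_pmf (A (u, v, w) \<noteq> B (u, v, w))})"
    proof -
      have "(A (u, v, w) \<noteq> B (u, v, w)) =
         ((g u \<noteq> g (xor_point u x)) \<noteq> (g v \<noteq> g (xor_point v x)))" for w
        by (auto simp: A_def B_def e)
      then show ?thesis by simp
    qed
  qed
  also have "\<dots> = map_pmf (\<lambda>t. A t \<noteq> B t) p" by (simp add: p_def map_bind_pmf)
  finally show ?thesis using prob_neq_le[of A B p] A B by simp
qed

lemma prob_pair_neq:
  fixes p :: "bool pmf"
  shows "measure_pmf.prob (do {a \<leftarrow> p; b \<leftarrow> p; return_pmf (a \<noteq> b)}) {True} =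
    2 * (measure_pmf.prob p {True} * (1 - measure_pmf.prob p {True}))"
proof -
  have F: "measure_pmf.prob p {False} = 1 - measure_pmf.prob p {True}"
    by (subst measure_pmf.prob_compl[symmetric])
      (auto intro!: arg_cong[where f = "measure_pmf.prob p"])
  have "measure_pmf.prob (bind_pmf p (\<lambda>b. return_pmf (a \<noteq> b))) {True} =
      (if a then measure_pmf.prob p {False} else measure_pmf.prob p {True})" for a
    by (auto simp: map_pmf_def[symmetric] vimage_def intro!: arg_cong[where f = "measure_pmf.prob p"])
  then show ?thesis
    unfolding prob_bind_pmf[of p "\<lambda>a. bind_pmf p (\<lambda>b. return_pmf (a \<noteq> b))"]
    by (subst integral_measure_pmf_real[where A = UNIV])
      (auto simp: UNIV_bool F pmf.rep_eq algebra_simps)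
qed

text \<open>Two independent readings disagree with probability \<open>2 * (p * (1 - p))\<close>,
  which is at least the probability of the minority value because the majority factor is at least
  \<open>1 / 2\<close>.\<close>

lemma corrected_error:
  assumes "x \<in> cube n"
  shows "measure_pmf.prob (parity_at n g x) {a. a \<noteq> corrected n g x} \<le> 2 * parity_gap n g"
proof -
  define p where "p = measure_pmf.prob (parity_at n g x) {True}"
  have F: "measure_pmf.prob (parity_at n g x) {False} = 1 - p"
    unfolding p_def by (subst measure_pmf.prob_compl[symmetric])
      (auto intro!: arg_cong[where f = "measure_pmf.prob _"])
  have p: "0 \<le> p" "p \<le> 1" by (simp_all add: p_def)
  have "2 * (p * (1 - p)) \<le> 2 * parity_gap n g"
    using parity_pair_le[OF assms, of g] unfolding prob_pair_neq p_def .
  moreover have "p * (1 - p) \<ge> (1 - p) / 2" if "p \<ge> 1 / 2"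
    using mult_right_mono[OF that, of "1 - p"] p by simp
  moreover have "p * (1 - p) \<ge> p / 2" if "p < 1 / 2"
    using mult_left_mono[of "1/2" "1 - p" p] that p by simp
  moreover have "measure_pmf.prob (parity_at n g x) {a. a \<noteq> corrected n g x} =
      (if p \<ge> 1 / 2 then 1 - p else p)"
  proof -
    have "{a. a \<noteq> corrected n g x} = (if p \<ge> 1 / 2 then {False} else {True})"
      by (auto simp: corrected_def p_def)
    then show ?thesis using F p_def by simp
  qed
  ultimately show ?thesis by (auto split: if_splits)
qed

text \<open>The decodings at \<open>x\<close>, \<open>y\<close> and \<open>xor_point x y\<close>
  start from \<open>u\<close>, \<open>xor_point u x\<close> and \<open>u\<close>, so their
  differences telescope. Each errs with probability below \<open>1 / 3\<close>, hence some
  \<open>u\<close> is good for all three, and the identity holds exactly.\<close>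

lemma corrected_additive:
  assumes "x \<in> cube n" "y \<in> cube n" "parity_gap n g < 1 / 6"
  shows "corrected n g (xor_point x y) \<longleftrightarrow> corrected n g x \<noteq> corrected n g y"
proof -
  let ?U = "uniform_point n"
  define W where "W z = {u. (g u \<noteq> g (xor_point u z)) \<noteq> corrected n g z}" for z
  have W: "measure_pmf.prob ?U (W z) \<le> 2 * parity_gap n g" if "z \<in> cube n" for z
    using corrected_error[OF that, of g] by (simp add: W_def parity_at_def vimage_def)
  define W' where "W' = {u. xor_point u x \<in> W y}"
  have "measure_pmf.prob ?U W' = measure_pmf.prob (map_pmf (\<lambda>u. xor_point u x) ?U) (W y)"
    by (simp add: W'_def vimage_def)
  then have W': "measure_pmf.prob ?U W' \<le> 2 * parity_gap n g"
    using W[OF assms(2)] uniform_point_shift[OF assms(1)] by simp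
  have "measure_pmf.prob ?U (W x \<union> W' \<union> W (xor_point x y)) < 1"
    using prob_Un_le[of ?U "W x \<union> W'" "W (xor_point x y)"] prob_Un_le[of ?U "W x" W']
      W[OF assms(1)] W' W[of "xor_point x y"] assms by simp
  then have "\<not> set_pmf ?U \<subseteq> W x \<union> W' \<union> W (xor_point x y)"
    by (metis measure_pmf.prob_eq_1 AE_measure_pmf_iff less_irrefl sets_measure_pmf subsetD UNIV_I)
  then obtain u where u: "u \<in> cube n" "u \<notin> W x" "xor_point u x \<notin> W y" "u \<notin> W (xor_point x y)"
    by (fastforce simp: set_uniform_point W'_def)
  have "xor_point (xor_point u x) y = xor_point u (xor_point x y)"
    using u(1) assms by (simp add: xor_point_assoc)
  with u(2-4) show ?thesis unfolding W_def by auto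
qed

section \<open>Additive functions compatible with conjunction\<close>

context
  fixes n :: nat and \<phi> :: "bool list \<Rightarrow> bool"
  assumes add: "x \<in> cube n \<Longrightarrow> y \<in> cube n \<Longrightarrow> \<phi> (xor_point x y) \<longleftrightarrow> \<phi> x \<noteq> \<phi> y"
begin

lemma additive_eq_False:
  "x \<in> cube n \<Longrightarrow> (\<And>i. i < n \<Longrightarrow> x ! i \<Longrightarrow> \<not> \<phi> (unit_point n i)) \<Longrightarrow> \<not> \<phi> x"
proof (induction "card {i. i < n \<and> x ! i}" arbitrary: x)
  case 0
  then have "xor_point x x = x" by (intro point_eqI[of _ n]) (auto simp: point_simps)
  then show ?case using add[of x x] 0 by simp
next
  case (Suc m)
  then obtain j where j: "j < n" "x ! j" by (metis (mono_tags, lifting) card.empty empty_Collect_eq nat.distinct(1))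
  define y where "y = xor_point x (unit_point n j)"
  have y: "y \<in> cube n" using Suc.prems by (simp add: y_def)
  have yn: "y ! i \<longleftrightarrow> x ! i \<and> i \<noteq> j" if "i < n" for i
    using that Suc.prems(1) j by (auto simp: y_def point_nth)
  have "{i. i < n \<and> y ! i} = {i. i < n \<and> x ! i} - {j}" using yn by auto
  then have "m = card {i. i < n \<and> y ! i}" using Suc.hyps(2) j by simp
  then have "\<not> \<phi> y" using Suc.hyps(1)[of y] Suc.prems yn y by auto
  moreover have "\<phi> y \<longleftrightarrow> \<phi> x \<noteq> \<phi> (unit_point n j)"
    unfolding y_def using Suc.prems(1) by (intro add) auto
  ultimately show ?case using Suc.prems(2) j by blast
qed

lemma additive_literal:
  assumes "\<And>i j. i < n \<Longrightarrow> j < n \<Longrightarrow> \<phi> (unit_point n i) \<Longrightarrow> \<phi> (unit_point n j) \<Longrightarrow> i = j"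
  shows "\<exists>\<sigma>. (\<forall>i. \<sigma> = Some i \<longrightarrow> i < n) \<and>
     (\<forall>x\<in>cube n. \<phi> x \<longleftrightarrow> (case \<sigma> of None \<Rightarrow> False | Some i \<Rightarrow> x ! i))"
proof (cases "\<exists>i<n. \<phi> (unit_point n i)")
  case True
  then obtain i where i: "i < n" "\<phi> (unit_point n i)" by blast
  have "\<phi> x \<longleftrightarrow> x ! i" if x: "x \<in> cube n" for x
  proof -
    have z: "\<not> \<phi> y" if "y \<in> cube n" "\<not> y ! i" for y
      using additive_eq_False[OF that(1)] assms i that by blast
    show ?thesis
    proof (cases "x ! i")
      case True
      then have "\<not> \<phi> (xor_point x (unit_point n i))" using x i by (intro z) (auto simp: point_simps)
      then show ?thesis using add[OF x, of "unit_point n i"] i True by auto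
    qed (use z x in auto)
  qed
  then show ?thesis using i by (intro exI[of _ "Some i"]) auto
next
  case False
  then show ?thesis using additive_eq_False by (intro exI[of _ None]) auto
qed

text \<open>Let \<open>s\<close> be the sum of the two unit points. As \<open>\<phi> s\<close> is
  False, translating \<open>u\<close> by \<open>s\<close> keeps \<open>\<phi> u\<close>; but if
  \<open>v\<close> contains exactly one of \<open>i\<close> and \<open>j\<close>, it changes
  \<open>and_point u v\<close> by one unit point and flips its value. So one of the two choices of
  \<open>u\<close> fails, for half of all \<open>v\<close>.\<close>

lemma additive_not_multiplicative:
  assumes ij: "i < n" "j < n" "i \<noteq> j" "\<phi> (unit_point n i)" "\<phi> (unit_point n j)"
  shows "measure_pmf.prob (do {u \<leftarrow> uniform_point n; v \<leftarrow> uniform_point n; return_pmf (u, v)})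
     {(u, v). (\<phi> u \<and> \<phi> v) \<noteq> \<phi> (and_point u v)} \<ge> 1 / 4"
proof -
  let ?U = "uniform_point n"
  let ?B = "\<lambda>v. {u. (\<phi> u \<and> \<phi> v) \<noteq> \<phi> (and_point u v)}"
  define s where "s = xor_point (unit_point n i) (unit_point n j)"
  have s: "s \<in> cube n" "\<not> \<phi> s" using ij add by (auto simp: s_def)
  have half: "measure_pmf.prob ?U (?B v) \<ge> 1 / 2" if v: "v \<in> cube n" "v ! i \<noteq> v ! j" for v
  proof -
    have "(\<phi> u \<and> \<phi> v) \<noteq> \<phi> (and_point u v) \<or> (\<phi> (xor_point u s) \<and> \<phi> v) \<noteq> \<phi> (and_point (xor_point u s) v)"
      if u: "u \<in> cube n" for u
    proof -
      let ?e = "unit_point n (if v ! i then i else j)"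
      have "and_point (xor_point u s) v = xor_point (and_point u v) ?e"
        using u v s ij by (intro point_eqI[of _ n]) (auto simp: point_simps s_def)
      then have "\<phi> (and_point (xor_point u s) v) \<longleftrightarrow> \<not> \<phi> (and_point u v)"
        using add[of "and_point u v" ?e] u v ij by auto
      moreover have "\<phi> (xor_point u s) = \<phi> u" using add[OF u s(1)] s(2) by simp
      ultimately show ?thesis by auto
    qed
    then have "1 \<le> measure_pmf.prob ?U (?B v \<union> {u. xor_point u s \<in> ?B v})"
      by (subst measure_pmf.prob_eq_1[THEN iffD2]) (auto simp: AE_measure_pmf_iff set_uniform_point)
    also have "\<dots> \<le> measure_pmf.prob ?U (?B v) + measure_pmf.prob ?U {u. xor_point u s \<in> ?B v}"
      by (rule prob_Un_le)
    also have "measure_pmf.prob ?U {u. xor_point u s \<in> ?B v}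
        = measure_pmf.prob (map_pmf (\<lambda>u. xor_point u s) ?U) (?B v)" by (simp add: vimage_def)
    also have "\<dots> = measure_pmf.prob ?U (?B v)" using uniform_point_shift[OF s(1)] by simp
    finally show ?thesis by simp
  qed
  have "measure_pmf.prob ?U {v. v ! i \<noteq> v ! j} = 1 - measure_pmf.prob ?U {v. v ! i = v ! j}"
    by (subst measure_pmf.prob_compl[symmetric])
      (auto intro!: arg_cong[where f = "measure_pmf.prob ?U"])
  then have "1 / 4 = measure_pmf.prob ?U {v. v ! i \<noteq> v ! j} * (1 / 2)"
    using uniform_point_nth_eq[OF ij(1-3)] by simp
  also have "\<dots> \<le> measure_pmf.prob (do {v \<leftarrow> ?U; u \<leftarrow> ?U; return_pmf (u, v)})
      {(u, v). (\<phi> u \<and> \<phi> v) \<noteq> \<phi> (and_point u v)}"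
    by (rule prob_bind_ge_mult)
      (use half in \<open>auto simp: set_uniform_point map_pmf_def[symmetric] vimage_def\<close>)
  also have "(do {v \<leftarrow> ?U; u \<leftarrow> ?U; return_pmf (u, v)}) = (do {u \<leftarrow> ?U; v \<leftarrow> ?U; return_pmf (u, v)})"
    by (rule bind_commute_pmf)
  finally show ?thesis .
qed

end

subsection \<open>Literal test and reading of the block variables\<close>

abbreviation literal_value :: "nat option \<Rightarrow> bool list \<Rightarrow> bool" where
  "literal_value \<sigma> x \<equiv> (case \<sigma> of None \<Rightarrow> False | Some i \<Rightarrow> x ! i)"

lemma power_one_minus_le:
  fixes x :: real
  assumes "0 \<le> x" "x \<le> 1" "real j \<le> x * real m"
  shows "(1 - x) ^ m \<le> (1 / 2) ^ j"
proof -
  have "(1 - x) ^ m \<le> exp (- x) ^ m"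
    using assms exp_ge_add_one_self[of "- x"] by (intro power_mono) auto
  also have "\<dots> = exp (- (x * real m))" by (simp add: exp_of_nat_mult[symmetric] mult.commute)
  also have "\<dots> \<le> exp (- real j)" using assms by simp
  also have "\<dots> = exp (- 1) ^ j" by (simp add: exp_of_nat_mult[symmetric])
  also have "\<dots> \<le> (1 / 2) ^ j"
    using exp_ge_add_one_self[of 1] by (intro power_mono) (auto simp: exp_minus field_simps)
  finally show ?thesis .
qed

lemma literal_test_unfold:
  "literal_test n g = bind_pmf (do {u \<leftarrow> uniform_point n; v \<leftarrow> uniform_point n; return_pmf (u, v)})
     (\<lambda>(u, v). do {a \<leftarrow> parity_at n g u; a' \<leftarrow> parity_at n g u;
       b \<leftarrow> parity_at n g v; c \<leftarrow> parity_at n g (and_point u v);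
       return_pmf (a \<noteq> a' \<or> (a \<and> b) \<noteq> c)})"
  by (simp add: literal_test_def bind_assoc_pmf bind_return_pmf)

lemma parity_gap_le_literal_test: "parity_gap n g \<le> measure_pmf.prob (literal_test n g) {True}"
proof -
  have "parity_gap n g = measure_pmf.prob (do {
     u \<leftarrow> uniform_point n; v \<leftarrow> uniform_point n;
     a \<leftarrow> parity_at n g u; a' \<leftarrow> parity_at n g u;
     b \<leftarrow> parity_at n g v; c \<leftarrow> parity_at n g (and_point u v);
     return_pmf (a \<noteq> a')}) {True}"
    by (simp add: parity_gap_def)
  also have "\<dots> \<le> measure_pmf.prob (literal_test n g) {True}"
    unfolding literal_test_def by (intro prob_bind_mono) (simp add: indicator_def)
  finally show ?thesis .
qed

text \<open>A small rejection probability bounds \<open>parity_gap\<close>, so the decoded function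
  is additive and each decoding errs with probability at most \<open>1 / 100\<close>. Two active
  variables would violate multiplicativity for a quarter of the pairs, and the three decodings
  involved are all correct with probability at least \<open>97 / 100\<close>, so rejection would be
  far more likely than \<open>1 / 200\<close>. The value \<open>None\<close> covers blocks decoded
  as False everywhere.\<close>

lemma literal_test_sound:
  assumes "measure_pmf.prob (literal_test n g) {True} < 1 / 200"
  shows "\<exists>\<sigma>. (\<forall>i. \<sigma> = Some i \<longrightarrow> i < n) \<and>
    (\<forall>x\<in>cube n. measure_pmf.prob (parity_at n g x) {a. a \<noteq> literal_value \<sigma> x} \<le> 1 / 100)"
proof -
  let ?\<phi> = "corrected n g"
  have gap: "parity_gap n g < 1 / 200" using parity_gap_le_literal_test[of n g] assms by simp
  have err: "measure_pmf.prob (parity_at n g x) {a. a \<noteq> ?\<phi> x} \<le> 1 / 100" if "x \<in> cube n" for x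
    using corrected_error[OF that, of g] gap by simp
  have add: "?\<phi> (xor_point x y) \<longleftrightarrow> ?\<phi> x \<noteq> ?\<phi> y" if "x \<in> cube n" "y \<in> cube n" for x y
    using corrected_additive[OF that] gap by simp
  have "i = j" if ij: "i < n" "j < n" "?\<phi> (unit_point n i)" "?\<phi> (unit_point n j)" for i j
  proof (rule ccontr)
    assume "i \<noteq> j"
    let ?p = "do {u \<leftarrow> uniform_point n; v \<leftarrow> uniform_point n; return_pmf (u, v)}"
    let ?A = "{(u, v). (?\<phi> u \<and> ?\<phi> v) \<noteq> ?\<phi> (and_point u v)}"
    have 1: "1 / 4 \<le> measure_pmf.prob ?p ?A"
      using add \<open>i \<noteq> j\<close> ij by (intro additive_not_multiplicative[of n ?\<phi> i j]) auto
    have "measure_pmf.prob ?p ?A * (97 / 100) \<le> measure_pmf.prob (literal_test n g) {True}"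
      unfolding literal_test_unfold
    proof (rule prob_bind_ge_mult, clarify)
      fix u v assume uv: "(u, v) \<in> set_pmf ?p" and ne: "(?\<phi> u \<and> ?\<phi> v) \<noteq> ?\<phi> (and_point u v)"
      from uv have uv: "u \<in> cube n" "v \<in> cube n" by (auto simp: set_uniform_point)
      let ?q = "do {a \<leftarrow> parity_at n g u; a' \<leftarrow> parity_at n g u;
         b \<leftarrow> parity_at n g v; c \<leftarrow> parity_at n g (and_point u v);
         return_pmf (a \<noteq> a' \<or> (a \<and> b) \<noteq> c)}"
      have c: "measure_pmf.prob (do {c \<leftarrow> parity_at n g (and_point u v);
          return_pmf (?\<phi> u \<noteq> a' \<or> (?\<phi> u \<and> ?\<phi> v) \<noteq> c)}) {False} \<le> 1 / 100 + 0" for a'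
        by (rule order_trans[OF prob_bind_le_add[where A = "{c. c \<noteq> ?\<phi> (and_point u v)}" and c = 0]])
          (use ne err[of "and_point u v"] uv in \<open>auto simp: indicator_def\<close>)
      have b: "measure_pmf.prob (do {b \<leftarrow> parity_at n g v; c \<leftarrow> parity_at n g (and_point u v);
          return_pmf (?\<phi> u \<noteq> a' \<or> (?\<phi> u \<and> b) \<noteq> c)}) {False} \<le> 1 / 100 + 1 / 100" for a'
        by (rule order_trans[OF prob_bind_le_add[where A = "{b. b \<noteq> ?\<phi> v}" and c = "1 / 100"]])
          (use c err[of v] uv in auto)
      have a': "measure_pmf.prob (do {a' \<leftarrow> parity_at n g u; b \<leftarrow> parity_at n g v;
          c \<leftarrow> parity_at n g (and_point u v);
          return_pmf (?\<phi> u \<noteq> a' \<or> (?\<phi> u \<and> b) \<noteq> c)}) {False} \<le> 2 / 100"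
        by (rule prob_bind_le) (use b in simp)
      have "measure_pmf.prob ?q {False} \<le> 1 / 100 + 2 / 100"
        by (rule order_trans[OF prob_bind_le_add[where A = "{a. a \<noteq> ?\<phi> u}" and c = "2 / 100"]])
          (use a' err[of u] uv in auto)
      moreover have "measure_pmf.prob ?q {True} = 1 - measure_pmf.prob ?q {False}"
        by (subst measure_pmf.prob_compl[symmetric])
          (auto intro!: arg_cong[where f = "measure_pmf.prob _"])
      ultimately show "97 / 100 \<le> measure_pmf.prob ?q {True}" by simp
    qed
    with 1 assms show False by simp
  qed
  then obtain \<sigma> where "\<forall>i. \<sigma> = Some i \<longrightarrow> i < n" "\<forall>x\<in>cube n. ?\<phi> x = literal_value \<sigma> x"
    using additive_literal[of n ?\<phi>] add by blast
  then show ?thesis using err by (intro exI[of _ \<sigma>]) auto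
qed

text \<open>With rejection probability at least \<open>1 / 200\<close> per round, 1000 rounds are
  survived with probability at most \<open>1 / 32\<close>. The number of rounds is independent of
  \<open>k\<close>: exposing one bad block suffices, so no union bound over blocks is taken.\<close>

definition check_block :: "nat \<Rightarrow> (bool list \<Rightarrow> bool) \<Rightarrow> bool \<Rightarrow> bool pmf" where
  "check_block n g = iter_pmf 1000 0 (\<lambda>_ r. map_pmf (\<lambda>t. r \<or> t) (literal_test n g))"

definition check_blocks :: "nat \<Rightarrow> (nat \<Rightarrow> bool list \<Rightarrow> bool) \<Rightarrow> nat \<Rightarrow> bool pmf" where
  "check_blocks n G q = iter_pmf q 0 (\<lambda>l. check_block n (G l)) False"

lemma check_block_True: "set_pmf (check_block n g True) = {True}"
proof -
  have "y = True" if "y \<in> set_pmf (check_block n g True)" for y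
    using iter_pmf_invariant[OF that[unfolded check_block_def], of "\<lambda>_ y. y"] by auto
  then show ?thesis using set_pmf_not_empty[of "check_block n g True"] by blast
qed

lemma check_block_sound:
  assumes "measure_pmf.prob (literal_test n g) {True} \<ge> 1 / 200"
  shows "measure_pmf.prob (check_block n g r) {False} \<le> 1 / 32"
proof -
  have "measure_pmf.prob (literal_test n g) {False} = 1 - measure_pmf.prob (literal_test n g) {True}"
    by (subst measure_pmf.prob_compl[symmetric])
      (auto intro!: arg_cong[where f = "measure_pmf.prob _"])
  then have F: "measure_pmf.prob (literal_test n g) {False} \<le> 199 / 200" using assms by simp
  have "measure_pmf.prob (check_block n g r) {False} \<le> (1 - 1 / 200) ^ 1000"
    unfolding check_block_def
  proof (rule prob_iter_pmf_le_power)
    show "measure_pmf.prob (map_pmf (\<lambda>t. r \<or> t) (literal_test n g)) {False} \<le> 1 - 1 / 200"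
      if "r \<in> {False}" for r
      using F that by (simp add: vimage_def)
  qed auto
  also have "\<dots> \<le> (1 / 2 :: real) ^ 5"
    by (rule power_one_minus_le) simp_all
  also have "\<dots> = 1 / 32" by (simp add: power_divide)
  finally show ?thesis .
qed

lemma check_blocks_sound:
  assumes "l < q" "measure_pmf.prob (literal_test n (G l)) {True} \<ge> 1 / 200"
  shows "measure_pmf.prob (check_blocks n G q) {False} \<le> 1 / 32"
  unfolding check_blocks_def
  by (rule prob_iter_pmf_le_single[OF assms(1)])
    (use check_block_sound[OF assms(2)] check_block_True in auto)

text \<open>Disagreeing readings lead to rejection instead of a majority vote: for a decision list
  without collisions all readings coincide, and otherwise a wrong value goes unnoticed only if all
  \<open>R\<close> repetitions are wrong too.\<close>

definition read_value :: "nat \<Rightarrow> (bool list \<Rightarrow> bool) \<Rightarrow> nat \<Rightarrow> bool list \<Rightarrow> bool \<Rightarrow> (bool \<times> bool) pmf" where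
  "read_value n g R x r = do {
     b \<leftarrow> parity_at n g x;
     r' \<leftarrow> iter_pmf R 0 (\<lambda>_ r. map_pmf (\<lambda>b'. r \<or> b' \<noteq> b) (parity_at n g x)) r;
     return_pmf (r', b)}"

definition read_row ::
    "nat \<Rightarrow> (nat \<Rightarrow> bool list \<Rightarrow> bool) \<Rightarrow> nat \<Rightarrow> nat \<Rightarrow> bool list \<Rightarrow> bool \<Rightarrow> (bool \<times> bool list) pmf" where
  "read_row n G q R x r = iter_pmf q 0 (\<lambda>l (r, vs). do {
     (r', b) \<leftarrow> read_value n (G l) R x r; return_pmf (r', vs @ [b])}) (r, [])"

definition read_table ::
    "nat \<Rightarrow> bool list pmf \<Rightarrow> (bool list \<Rightarrow> bool) \<Rightarrow> (nat \<Rightarrow> bool list \<Rightarrow> bool) \<Rightarrow> nat \<Rightarrow> nat \<Rightarrow> nat \<Rightarrow>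
     bool \<Rightarrow> (bool \<times> (bool list \<times> bool) list) pmf" where
  "read_table n D h G q R m r = iter_pmf m 0 (\<lambda>_ (r, tab). do {
     x \<leftarrow> D; (r', vs) \<leftarrow> read_row n G q R x r; return_pmf (r', tab @ [(vs, h x)])}) (r, [])"

lemma read_value_sticky: "(r', b) \<in> set_pmf (read_value n g R x True) \<Longrightarrow> r'"
  unfolding read_value_def using iter_pmf_invariant[where I = "\<lambda>_ y. y"] by fastforce

lemma read_value_sound:
  assumes "measure_pmf.prob (parity_at n g x) {a. a \<noteq> \<phi>} \<le> 1 / 100"
  shows "measure_pmf.prob (read_value n g R x r) {(r', b). \<not> r' \<and> b \<noteq> \<phi>} \<le> (1 / 100) ^ R"
  unfolding read_value_def
proof (rule prob_bind_le)
  fix b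
  show "measure_pmf.prob (do {
      r' \<leftarrow> iter_pmf R 0 (\<lambda>_ r. map_pmf (\<lambda>b'. r \<or> b' \<noteq> b) (parity_at n g x)) r;
      return_pmf (r', b)}) {(r', b). \<not> r' \<and> b \<noteq> \<phi>} \<le> (1 / 100) ^ R"
  proof (cases "b = \<phi>")
    case False
    have "measure_pmf.prob (iter_pmf R 0 (\<lambda>_ r. map_pmf (\<lambda>b'. r \<or> b' \<noteq> b) (parity_at n g x)) r) {False}
        \<le> (1 / 100) ^ R"
    proof (rule prob_iter_pmf_le_power)
      fix r assume "r \<in> {False}"
      moreover have "{b'. b' = b} = {a. a \<noteq> \<phi>}" using False by auto
      ultimately show "measure_pmf.prob (map_pmf (\<lambda>b'. r \<or> b' \<noteq> b) (parity_at n g x)) {False} \<le> 1 / 100"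
        using assms by (simp add: vimage_def)
    qed auto
    moreover have "{r'. \<not> r'} = {False}" by auto
    ultimately show ?thesis using False by (simp add: map_pmf_def[symmetric] vimage_def)
  qed (simp add: map_pmf_def[symmetric] vimage_def)
qed

lemma read_row_length: "(r', vs) \<in> set_pmf (read_row n G q R x r) \<Longrightarrow> length vs = q"
  unfolding read_row_def
  by (drule iter_pmf_invariant[where I = "\<lambda>i (r, vs). length vs = i"]) auto

lemma read_row_sticky: "(r', vs) \<in> set_pmf (read_row n G q R x True) \<Longrightarrow> r'"
  unfolding read_row_def
  by (drule iter_pmf_invariant[where I = "\<lambda>i (r, vs). r"])
    (use read_value_sticky in \<open>fastforce+\<close>)

lemma read_row_sound:
  assumes "\<And>l. l < q \<Longrightarrow> measure_pmf.prob (parity_at n (G l) x) {a. a \<noteq> \<phi> l} \<le> 1 / 100"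
  shows "measure_pmf.prob (read_row n G q R x r) {(r', vs). \<not> r' \<and> vs \<noteq> map \<phi> [0..<q]}
    \<le> real q * (1 / 100) ^ R"
proof -
  \<comment> \<open>Stated for the bits read so far, so that the event makes sense after every round
    of the loop.\<close>
  let ?A = "{(r, vs). \<not> r \<and> (\<exists>j<length vs. vs ! j \<noteq> \<phi> j)}"
  have "measure_pmf.prob (read_row n G q R x r) {(r', vs). \<not> r' \<and> vs \<noteq> map \<phi> [0..<q]}
    \<le> measure_pmf.prob (read_row n G q R x r) ?A"
  proof (rule prob_mono_set, clarify)
    fix r' vs
    assume "(r', vs) \<in> set_pmf (read_row n G q R x r)" "vs \<noteq> map \<phi> [0..<q]"
    then show "\<exists>j<length vs. vs ! j \<noteq> \<phi> j"
      using read_row_length[of r' vs] by (auto simp: list_eq_iff_nth_eq)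
  qed
  also have "\<dots> \<le> real q * (1 / 100) ^ R" unfolding read_row_def
  proof (rule prob_iter_pmf_le_mult[where I = "\<lambda>i (r, vs). length vs = i"], goal_cases)
    case (4 l s)
    obtain r vs where s: "s = (r, vs)" by (cases s)
    have "measure_pmf.prob (do {(r', b) \<leftarrow> read_value n (G l) R x r; return_pmf (r', vs @ [b])}) ?A
      \<le> measure_pmf.prob (read_value n (G l) R x r) {(r', b). \<not> r' \<and> b \<noteq> \<phi> l} + 0"
    proof (rule prob_bind_le_add)
      fix t assume t: "t \<in> set_pmf (read_value n (G l) R x r)" "t \<notin> {(r', b). \<not> r' \<and> b \<noteq> \<phi> l}"
      obtain r' b where rb: "t = (r', b)" by (cases t)
      have "r' \<or> \<not> r" using t(1) read_value_sticky rb by (cases r) auto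
      then show "measure_pmf.prob (case t of (r', b) \<Rightarrow> return_pmf (r', vs @ [b])) ?A \<le> 0"
        using 4 t(2) s by (auto simp: rb indicator_def nth_append less_Suc_eq split: if_splits)
    qed simp
    also have "\<dots> \<le> (1 / 100) ^ R" using read_value_sound[OF assms] 4 by simp
    finally show ?case by (simp add: s)
  qed auto
  finally show ?thesis .
qed

text \<open>For a fixed candidate \<open>F\<close>, a sample on which \<open>F\<close> errs on the
  true bits contradicts \<open>F\<close> in the table unless a bit was misread unnoticed. So a round
  is survived with probability at most \<open>(1 - 2 * \<delta>) + \<delta>\<close>.\<close>

lemma read_table_sound_single:
  assumes "\<And>l x. l < q \<Longrightarrow> x \<in> set_pmf D \<Longrightarrow>
      measure_pmf.prob (parity_at n (G l) x) {a. a \<noteq> \<phi> l x} \<le> 1 / 100"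
    and "measure_pmf.prob D {x. h x \<noteq> F (map (\<lambda>l. \<phi> l x) [0..<q])} \<ge> 2 * \<delta>"
    and "real q * (1 / 100) ^ R \<le> \<delta>"
  shows "measure_pmf.prob (read_table n D h G q R m r) {(r, tab). \<not> r \<and> (\<forall>(vs, y)\<in>set tab. F vs = y)}
    \<le> (1 - \<delta>) ^ m"
  unfolding read_table_def
proof (rule prob_iter_pmf_le_power)
  let ?A = "{(r, tab). \<not> r \<and> (\<forall>(vs, y)\<in>set tab. F vs = y)}"
  fix s :: "bool \<times> (bool list \<times> bool) list"
  obtain r tab where s: "s = (r, tab)" by (cases s)
  let ?step = "\<lambda>x. do {(r', vs) \<leftarrow> read_row n G q R x r; return_pmf (r', tab @ [(vs, h x)])}"
  {
    assume "s \<in> ?A"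
    let ?B = "{x. h x = F (map (\<lambda>l. \<phi> l x) [0..<q])}"
    have "measure_pmf.prob (bind_pmf D ?step) ?A \<le> measure_pmf.prob D ?B + \<delta>"
    proof (rule prob_bind_le_add)
      fix x assume x: "x \<in> set_pmf D" "x \<notin> ?B"
      let ?E = "{(r', vs). \<not> r' \<and> vs \<noteq> map (\<lambda>l. \<phi> l x) [0..<q]}"
      have "measure_pmf.prob (?step x) ?A \<le> measure_pmf.prob (read_row n G q R x r) ?E + 0"
        by (rule prob_bind_le_add) (use x in \<open>auto simp: indicator_def\<close>)
      also have "\<dots> \<le> real q * (1 / 100) ^ R"
        using read_row_sound[where \<phi> = "\<lambda>l. \<phi> l x"] assms(1) x(1) by simp
      finally show "measure_pmf.prob (?step x) ?A \<le> \<delta>" using assms(3) by simp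
    qed (use assms(3) order_trans[of 0 "real q * (1 / 100) ^ R" \<delta>] in simp)
    also have "measure_pmf.prob D ?B = 1 - measure_pmf.prob D {x. h x \<noteq> F (map (\<lambda>l. \<phi> l x) [0..<q])}"
      by (subst measure_pmf.prob_compl[symmetric])
        (auto intro!: arg_cong[where f = "measure_pmf.prob _"])
    finally show "measure_pmf.prob (case s of (r, tab) \<Rightarrow> bind_pmf D (\<lambda>x. do {
        (r', vs) \<leftarrow> read_row n G q R x r; return_pmf (r', tab @ [(vs, h x)])})) ?A \<le> 1 - \<delta>"
      using assms(2) by (simp add: s)
  next
    assume "s \<notin> ?A"
    then show "set_pmf (case s of (r, tab) \<Rightarrow> bind_pmf D (\<lambda>x. do {
        (r', vs) \<leftarrow> read_row n G q R x r; return_pmf (r', tab @ [(vs, h x)])})) \<inter> ?A = {}"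
      by (cases r) (auto simp: s dest: read_row_sticky)
  }
next
  show "1 - \<delta> \<ge> 0"
    using assms(2,3) order_trans[OF assms(2) measure_pmf.prob_le_1]
      order_trans[of 0 "real q * (1 / 100) ^ R" \<delta>] by simp
qed

lemma sum_powers_le: "(\<Sum>i\<le>q. a ^ i) \<le> (a + 1) ^ q" for a :: nat
proof (induction q)
  case (Suc q)
  have "a ^ Suc q \<le> a * (a + 1) ^ q" by (simp add: power_mono)
  moreover have "(\<Sum>i\<le>Suc q. a ^ i) = (\<Sum>i\<le>q. a ^ i) + a ^ Suc q" by (rule sum.atMost_Suc)
  moreover have "(a + 1) ^ Suc q = (a + 1) ^ q + a * (a + 1) ^ q" by simp
  ultimately show ?case using Suc by linarith
qed simp

text \<open>The candidates are lists over column indices, so their number does not involve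
  \<open>n\<close>: there are \<open>4 * q\<close> different rules and two defaults.\<close>

definition short_lists :: "nat \<Rightarrow> (rule list \<times> bool) set" where
  "short_lists q = {L. set L \<subseteq> {..<q} \<times> UNIV \<times> UNIV \<and> length L \<le> q} \<times> UNIV"

lemma short_lists: "finite (short_lists q)" "card (short_lists q) \<le> 2 * (4 * q + 1) ^ q"
proof -
  have fin: "finite ({..<q} \<times> (UNIV :: bool set) \<times> (UNIV :: bool set))" by simp
  have c: "card ({..<q} \<times> (UNIV :: bool set) \<times> (UNIV :: bool set)) = 4 * q"
    by (simp add: card_cartesian_product)
  have "card (short_lists q) = card {L :: rule list. set L \<subseteq> {..<q} \<times> UNIV \<times> UNIV \<and> length L \<le> q} * 2"
    unfolding short_lists_def by (subst card_cartesian_product) simp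
  also have "\<dots> = (\<Sum>i\<le>q. (4 * q) ^ i) * 2"
    unfolding card_lists_length_le[OF fin] c by (rule refl)
  finally show "card (short_lists q) \<le> 2 * (4 * q + 1) ^ q"
    using sum_powers_le[of "4 * q" q] by simp
  show "finite (short_lists q)" unfolding short_lists_def
    using finite_lists_length_le[OF fin] by simp
qed

text \<open>The fitted list depends on the table, but it always lies in \<open>short_lists\<close>;
  so the estimate for a fixed candidate is summed over all of them.\<close>

lemma read_table_sound:
  assumes "\<And>l x. l < q \<Longrightarrow> x \<in> set_pmf D \<Longrightarrow>
      measure_pmf.prob (parity_at n (G l) x) {a. a \<noteq> \<phi> l x} \<le> 1 / 100"
    and "\<And>L b. rule_vars L \<subseteq> {..<q} \<Longrightarrow> length L \<le> q \<Longrightarrow>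
      measure_pmf.prob D {x. h x \<noteq> dl_eval L b (map (\<lambda>l. \<phi> l x) [0..<q])} \<ge> 2 * \<delta>"
    and "real q * (1 / 100) ^ R \<le> \<delta>"
  shows "measure_pmf.prob (read_table n D h G q R m r) {(r, tab). \<not> r \<and> greedy_fit tab q k}
    \<le> 2 * (4 * real q + 1) ^ q * (1 - \<delta>) ^ m"
proof -
  let ?p = "read_table n D h G q R m r"
  let ?A = "\<lambda>(L, b). {(r, tab). \<not> r \<and> (\<forall>(vs, y)\<in>set tab. dl_eval L b vs = y)}"
  have "0 \<le> real q * (1 / 100) ^ R" by simp
  then have "\<delta> \<ge> 0" using assms(3) by linarith
  \<comment> \<open>The empty list is a candidate, so the distance hypothesis bounds
    \<open>\<delta>\<close> itself.\<close>
  have "2 * \<delta> \<le> 1"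
    by (rule order_trans[OF assms(2)[of "[]" True]]) auto
  then have d: "0 \<le> 1 - \<delta>" using \<open>\<delta> \<ge> 0\<close> by simp
  have "measure_pmf.prob ?p {(r, tab). \<not> r \<and> greedy_fit tab q k}
      \<le> measure_pmf.prob ?p (\<Union>t\<in>short_lists q. ?A t)"
  proof (rule prob_mono_set)
    fix s :: "bool \<times> (bool list \<times> bool) list"
    assume "s \<in> {(r, tab). \<not> r \<and> greedy_fit tab q k}"
    then obtain tab where s: "s = (False, tab)" "greedy_fit tab q k" by auto
    from greedy_fit_sound[OF s(2)] obtain L b where
      "rule_vars L \<subseteq> {..<q}" "length L \<le> q" "\<forall>(vs, y)\<in>set tab. dl_eval L b vs = y" by blast
    moreover from this(1,2) have "(L, b) \<in> short_lists q"
      by (force simp: short_lists_def rule_vars_def)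
    ultimately show "s \<in> (\<Union>t\<in>short_lists q. ?A t)" using s(1) by (intro UN_I[of "(L, b)"]) auto
  qed
  also have "\<dots> \<le> (\<Sum>t\<in>short_lists q. measure_pmf.prob ?p (?A t))"
    by (rule prob_UN_le) (rule short_lists)
  also have "\<dots> \<le> (\<Sum>t\<in>short_lists q. (1 - \<delta>) ^ m)"
  proof (rule sum_mono)
    fix t assume t: "t \<in> short_lists q"
    obtain L b where Lb: "t = (L, b)" by (cases t)
    with t have "rule_vars L \<subseteq> {..<q}" "length L \<le> q"
      by (auto simp: short_lists_def rule_vars_def)
    from read_table_sound_single[OF assms(1) assms(2)[OF this] assms(3)]
    show "measure_pmf.prob ?p (?A t) \<le> (1 - \<delta>) ^ m" by (simp add: Lb)
  qed
  also have "\<dots> \<le> real (2 * (4 * q + 1) ^ q) * (1 - \<delta>) ^ m"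
    unfolding sum_constant using d short_lists(2)[of q]
    by (intro mult_right_mono) (simp_all only: of_nat_le_iff zero_le_power)
  finally show ?thesis by (simp add: add.commute)
qed

subsection \<open>Finding the blocks; correctness of the abstract tester\<close>

definition select :: "nat \<Rightarrow> (nat \<Rightarrow> bool) \<Rightarrow> bool list \<Rightarrow> bool list \<Rightarrow> bool list" where
  "select n P x y = map (\<lambda>i. if P i then x ! i else y ! i) [0..<n]"

lemma select_simps [simp]:
  "length (select n P x y) = n" "i < n \<Longrightarrow> select n P x y ! i = (if P i then x ! i else y ! i)"
  by (simp_all add: select_def)

abbreviation zero_outside :: "nat \<Rightarrow> (nat \<Rightarrow> nat) \<Rightarrow> bool list \<Rightarrow> bool list" where
  "zero_outside n own x \<equiv> select n (\<lambda>i. own i \<noteq> 0) x (replicate n False)"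

definition block_fun ::
    "nat \<Rightarrow> (bool list \<Rightarrow> bool) \<Rightarrow> (nat \<Rightarrow> nat) \<Rightarrow> bool list list \<Rightarrow> nat \<Rightarrow> bool list \<Rightarrow> bool" where
  "block_fun n f own ws l u = f (select n (\<lambda>i. own i = Suc l) u (ws ! l))"

text \<open>All \<open>N1\<close> samples are drawn even after a success, and the last good one is
  kept; the number of oracle calls is thus fixed in advance.\<close>

definition find_point ::
    "nat \<Rightarrow> (bool list \<Rightarrow> bool) \<Rightarrow> bool list pmf \<Rightarrow> nat \<Rightarrow> (nat \<Rightarrow> nat) \<Rightarrow> bool list option pmf" where
  "find_point n f D N1 own = iter_pmf N1 0
     (\<lambda>_ v. map_pmf (\<lambda>x. if f x \<noteq> f (zero_outside n own x) then Some x else v) D) None"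

text \<open>The hybrid replaces the endpoint with the same value of \<open>f\<close>, so the pair
  keeps witnessing a change of \<open>f\<close>, and the value at the first point never
  changes.\<close>

definition halve ::
    "nat \<Rightarrow> (bool list \<Rightarrow> bool) \<Rightarrow> bool list \<times> bool list \<Rightarrow> (bool list \<times> bool list) pmf" where
  "halve n f = (\<lambda>(y, y'). map_pmf (\<lambda>u. let z = select n ((!) u) y y' in
     if f z = f y then (z, y') else (y, z)) (uniform_point n))"

text \<open>\<open>own i = Suc l\<close> puts the variable \<open>i\<close> into block \<open>l\<close>; \<open>own i = 0\<close> leaves it in no block.\<close>

type_synonym blocks = "(nat \<Rightarrow> nat) \<times> bool list list"

definition add_block :: "nat \<Rightarrow> blocks \<Rightarrow> bool list \<times> bool list \<Rightarrow> blocks" where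
  "add_block n = (\<lambda>(own, ws) (y, y').
     ((\<lambda>i. if i < n \<and> y ! i \<noteq> y' ! i then Suc (length ws) else own i), ws @ [y]))"

definition epoch ::
    "nat \<Rightarrow> (bool list \<Rightarrow> bool) \<Rightarrow> bool list pmf \<Rightarrow> nat \<Rightarrow> nat \<Rightarrow> bool \<times> blocks \<Rightarrow> (bool \<times> blocks) pmf" where
  "epoch n f D N1 R = (\<lambda>(fnd, own, ws). if fnd then do {
     v \<leftarrow> find_point n f D N1 own;
     case v of None \<Rightarrow> return_pmf (False, own, ws)
     | Some x \<Rightarrow> map_pmf (\<lambda>p. (True, add_block n (own, ws) p))
         (iter_pmf R 0 (\<lambda>_. halve n f) (x, zero_outside n own x))}
     else return_pmf (False, own, ws))"

text \<open>The flag stays True only while every epoch adds a block; after a failure the remaining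
  epochs are idle. A flag that is still True after \<open>k + 1\<close> epochs certifies
  \<open>k + 1\<close> blocks and makes \<open>verdict\<close> reject.\<close>

definition find_blocks ::
    "nat \<Rightarrow> (bool list \<Rightarrow> bool) \<Rightarrow> bool list pmf \<Rightarrow> nat \<Rightarrow> nat \<Rightarrow> nat \<Rightarrow> (bool \<times> blocks) pmf" where
  "find_blocks n f D k N1 R = iter_pmf (k + 1) 0 (\<lambda>_. epoch n f D N1 R) (True, (\<lambda>_. 0), [])"

text \<open>The labels are values of \<open>f\<close> on the zeroed point. They are functions of the
  block variables alone, so an exact fit exists for a decision list; the difference from
  \<open>f\<close> itself is accounted for by the block search.\<close>

definition verdict ::
    "nat \<Rightarrow> (bool list \<Rightarrow> bool) \<Rightarrow> bool list pmf \<Rightarrow> nat \<Rightarrow> nat \<Rightarrow> nat \<Rightarrow> bool \<times> blocks \<Rightarrow> bool pmf" where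
  "verdict n f D k m R = (\<lambda>(fnd, own, ws). do {
     r \<leftarrow> check_blocks n (block_fun n f own ws) (length ws);
     (r', tab) \<leftarrow> read_table n D (\<lambda>x. f (zero_outside n own x)) (block_fun n f own ws) (length ws) R m r;
     return_pmf (\<not> fnd \<and> \<not> r' \<and> greedy_fit tab (length ws) k)})"

definition tester ::
    "nat \<Rightarrow> (bool list \<Rightarrow> bool) \<Rightarrow> bool list pmf \<Rightarrow> nat \<Rightarrow> nat \<Rightarrow> nat \<Rightarrow> nat \<Rightarrow> bool pmf" where
  "tester n f D k N1 m R = bind_pmf (find_blocks n f D k N1 R) (verdict n f D k m R)"

section \<open>Soundness of the abstract tester\<close>

lemma find_blocks_length:
  assumes "(fnd, own, ws) \<in> set_pmf (find_blocks n f D k N1 R)"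
  shows "if fnd then length ws = k + 1 else length ws \<le> k"
proof -
  let ?I = "\<lambda>j (fnd, own, ws). if fnd then length ws = j else length ws < j"
  have "?I (0 + (k + 1)) (fnd, own, ws)"
  proof (rule iter_pmf_invariant[OF assms[unfolded find_blocks_def], of ?I])
    fix j s t
    assume "?I j s" "t \<in> set_pmf (epoch n f D N1 R s)"
    then show "?I (Suc j) t"
      by (auto simp: epoch_def add_block_def split: if_splits option.splits)
  qed simp
  then show ?thesis by (auto split: if_splits)
qed

lemma find_point_sound:
  assumes "\<epsilon> / 2 < measure_pmf.prob D {x. f x \<noteq> f (zero_outside n own x)}"
  shows "measure_pmf.prob (find_point n f D N1 own) {None} \<le> (1 - \<epsilon> / 2) ^ N1"
  unfolding find_point_def
proof (rule prob_iter_pmf_le_power)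
  let ?B = "{x. f x \<noteq> f (zero_outside n own x)}"
  have "measure_pmf.prob D (- ?B) = 1 - measure_pmf.prob D ?B"
    by (subst measure_pmf.prob_compl[symmetric])
      (auto intro!: arg_cong[where f = "measure_pmf.prob _"])
  then have "measure_pmf.prob D (- ?B) \<le> 1 - \<epsilon> / 2" using assms by simp
  moreover have "(\<lambda>x. if f x \<noteq> f (zero_outside n own x) then Some x else None) -` {None} = - ?B"
    by (auto split: if_splits)
  ultimately have "measure_pmf.prob (map_pmf (\<lambda>x. if f x \<noteq> f (zero_outside n own x) then Some x else None) D) {None}
      \<le> 1 - \<epsilon> / 2"
    unfolding measure_map_pmf by (simp only:)
  then show "measure_pmf.prob (map_pmf (\<lambda>x. if f x \<noteq> f (zero_outside n own x) then Some x else v) D) {None}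
      \<le> 1 - \<epsilon> / 2" if "v \<in> {None}" for v
    using that by (simp only: singleton_iff)
  show "0 \<le> 1 - \<epsilon> / 2"
    using assms measure_pmf.prob_le_1[of D ?B] by linarith
qed auto

text \<open>Each of the \<open>k + 1\<close> epochs can enter the bad event only by missing every
  sample that zeroing affects, although these have mass above \<open>\<epsilon> / 2\<close>.\<close>

lemma find_blocks_sound:
  assumes "0 \<le> 1 - \<epsilon> / 2"
  shows "measure_pmf.prob (find_blocks n f D k N1 R)
     {(fnd, own, ws). \<not> fnd \<and> \<epsilon> / 2 < measure_pmf.prob D {x. f x \<noteq> f (zero_outside n own x)}}
     \<le> real (k + 1) * (1 - \<epsilon> / 2) ^ N1" (is "measure_pmf.prob _ ?A \<le> _")
  unfolding find_blocks_def
proof (rule prob_iter_pmf_le_mult[where I = "\<lambda>_ _. True"], goal_cases)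
  case (4 j s)
  obtain fnd own ws where s: "s = (fnd, own, ws)" by (cases s)
  show ?case
  proof (cases fnd)
    case True
    let ?c = "\<lambda>v. case v of None \<Rightarrow> return_pmf (False, own, ws)
       | Some x \<Rightarrow> map_pmf (\<lambda>p. (True, add_block n (own, ws) p))
         (iter_pmf R 0 (\<lambda>_. halve n f) (x, zero_outside n own x))"
    have some: "measure_pmf.prob (?c (Some x)) ?A = 0" for x
      unfolding prob_eq_0_iff by auto
    have "measure_pmf.prob (bind_pmf (find_point n f D N1 own) ?c) ?A \<le> (1 - \<epsilon> / 2) ^ N1"
    proof (cases "\<epsilon> / 2 < measure_pmf.prob D {x. f x \<noteq> f (zero_outside n own x)}")
      case True
      have "measure_pmf.prob (bind_pmf (find_point n f D N1 own) ?c) ?A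
          \<le> measure_pmf.prob (find_point n f D N1 own) {None} + 0"
      proof (rule prob_bind_le_add)
        fix v assume "v \<notin> {None :: bool list option}"
        then show "measure_pmf.prob (?c v) ?A \<le> 0" using some by (cases v) auto
      qed simp
      then show ?thesis using find_point_sound[OF True, of N1] by simp
    next
      case False
      have "measure_pmf.prob (?c v) ?A = 0" for v
        using some False by (cases v) (auto simp: indicator_def)
      then have "measure_pmf.prob (bind_pmf (find_point n f D N1 own) ?c) ?A \<le> 0"
        by (intro prob_bind_le) simp
      then show ?thesis using assms zero_le_power[of "1 - \<epsilon> / 2" N1] by linarith
    qed
    moreover have "epoch n f D N1 R s = bind_pmf (find_point n f D N1 own) ?c"
      unfolding s epoch_def prod.case using True by (simp only: if_True)
    ultimately show ?thesis by (simp only:)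
  next
    case False
    then show ?thesis using 4 assms by (auto simp: s epoch_def indicator_def)
  qed
qed (use assms in auto)

lemma read_table_sticky: "(r', tab) \<in> set_pmf (read_table n D h G q R m True) \<Longrightarrow> r'"
  unfolding read_table_def
  by (drule iter_pmf_invariant[where I = "\<lambda>i (r, tab). r"])
    (use read_row_sticky in \<open>fastforce+\<close>)

text \<open>The distance is split in halves. Zeroing changes \<open>f\<close> on mass at most
  \<open>\<epsilon> / 2\<close>, so every candidate errs on the zeroed function with mass at least
  \<open>\<epsilon> / 2\<close>, twice the \<open>\<epsilon> / 4\<close> reserved for misread bits.
  If some block is not literal-like, the block check catches it instead.\<close>

lemma verdict_sound:
  assumes D: "set_pmf D \<subseteq> cube n" and far: "far_from D \<epsilon> (length_decision_list n k) f"
    and close: "\<not> fnd \<Longrightarrow> measure_pmf.prob D {x. f x \<noteq> f (zero_outside n own x)} \<le> \<epsilon> / 2"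
    and q: "\<not> fnd \<Longrightarrow> length ws \<le> k"
    and R: "real k * (1 / 100) ^ R \<le> \<epsilon> / 4"
    and m: "2 * (4 * real k + 1) ^ k * (1 - \<epsilon> / 4) ^ m \<le> 1 / 8"
    and \<epsilon>: "0 < \<epsilon>" "\<epsilon> \<le> 1"
  shows "measure_pmf.prob (verdict n f D k m R (fnd, own, ws)) {True} \<le> 1 / 8"
proof (cases fnd)
  case True
  then have "set_pmf (verdict n f D k m R (fnd, own, ws)) \<inter> {True} = {}"
    by (auto simp: verdict_def)
  then have "measure_pmf.prob (verdict n f D k m R (fnd, own, ws)) {True} = 0"
    by (simp only: prob_eq_0_iff)
  then show ?thesis by simp
next
  case False
  let ?q = "length ws"
  let ?G = "block_fun n f own ws"
  let ?h = "\<lambda>x. f (zero_outside n own x)"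
  let ?rest = "\<lambda>r. do {(r', tab) \<leftarrow> read_table n D ?h ?G ?q R m r; return_pmf (\<not> fnd \<and> \<not> r' \<and> greedy_fit tab ?q k)}"
  have v: "verdict n f D k m R (fnd, own, ws) = bind_pmf (check_blocks n ?G ?q) ?rest"
    by (simp add: verdict_def)
  show ?thesis
  proof (cases "\<exists>l<?q. measure_pmf.prob (literal_test n (?G l)) {True} \<ge> 1 / 200")
    case True
    then obtain l where l: "l < ?q" "measure_pmf.prob (literal_test n (?G l)) {True} \<ge> 1 / 200"
      by blast
    have "measure_pmf.prob (bind_pmf (check_blocks n ?G ?q) ?rest) {True}
        \<le> measure_pmf.prob (check_blocks n ?G ?q) {False} + 0"
    proof (rule prob_bind_le_add)
      fix r assume "r \<notin> {False}"
      then have r: "r = True" by simp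
      have "set_pmf (?rest r) \<inter> {True} = {}" unfolding r using read_table_sticky by fastforce
      then have "measure_pmf.prob (?rest r) {True} = 0" by (simp only: prob_eq_0_iff)
      then show "measure_pmf.prob (?rest r) {True} \<le> 0" by simp
    qed simp
    also have "\<dots> \<le> 1 / 32" using check_blocks_sound[of l ?q n ?G] l by simp
    finally show ?thesis unfolding v by simp
  next
    case nlt: False
    have "\<forall>l. \<exists>\<sigma>. l < ?q \<longrightarrow> (\<forall>i. \<sigma> = Some i \<longrightarrow> i < n) \<and>
        (\<forall>x\<in>cube n. measure_pmf.prob (parity_at n (?G l) x) {a. a \<noteq> literal_value \<sigma> x} \<le> 1 / 100)"
      using literal_test_sound nlt by (meson not_le)
    then obtain \<sigma> where \<sigma>: "\<And>l i. l < ?q \<Longrightarrow> \<sigma> l = Some i \<Longrightarrow> i < n"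
      "\<And>l x. l < ?q \<Longrightarrow> x \<in> cube n \<Longrightarrow>
         measure_pmf.prob (parity_at n (?G l) x) {a. a \<noteq> literal_value (\<sigma> l) x} \<le> 1 / 100"
      by metis
    have qk: "?q \<le> k" using q False by blast
    \<comment> \<open>Inserting the decoded literals turns a candidate over block bits into a list
      over the \<open>n\<close> variables; its length stays at most \<open>k\<close>, so
      \<open>f\<close> is far from it.\<close>
    have far': "2 * (\<epsilon> / 4) \<le> measure_pmf.prob D {x. ?h x \<noteq> dl_eval L b (map (\<lambda>l. literal_value (\<sigma> l) x) [0..<?q])}"
      if L: "rule_vars L \<subseteq> {..<?q}" "length L \<le> ?q" for L b
    proof -
      let ?F = "\<lambda>x. dl_eval L b (map (\<lambda>l. literal_value (\<sigma> l) x) [0..<?q])"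
      obtain L' b' where L': "length L' \<le> length L"
        "rule_vars L' \<subseteq> {j. \<exists>i\<in>rule_vars L. \<sigma> i = Some j}"
        "\<And>x y. (\<forall>i\<in>rule_vars L. y ! i = literal_value (\<sigma> i) x) \<Longrightarrow> dl_eval L b y = dl_eval L' b' x"
        using dl_eval_subst[of L \<sigma> b] by blast
      have eq: "?F x = dl_eval L' b' x" for x
        by (rule L'(3)) (use L(1) in auto)
      have "rule_vars L' \<subseteq> {..<n}" using L'(2) L(1) \<sigma>(1) by fastforce
      then have "?F \<in> length_decision_list n k"
        unfolding length_decision_list_iff using L'(1) L(2) qk eq
        by (intro exI[of _ L'] exI[of _ b']) auto
      then have "\<epsilon> \<le> measure_pmf.prob D {x. f x \<noteq> ?F x}"
        using bspec[OF far[unfolded far_from_def], of ?F] by simp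
      also have "\<dots> \<le> measure_pmf.prob D ({x. f x \<noteq> ?h x} \<union> {x. ?h x \<noteq> ?F x})"
        by (rule prob_mono_set) auto
      also have "\<dots> \<le> measure_pmf.prob D {x. f x \<noteq> ?h x} + measure_pmf.prob D {x. ?h x \<noteq> ?F x}"
        by (rule prob_Un_le)
      finally show ?thesis using close[OF False] by simp
    qed
    have R': "real ?q * (1 / 100) ^ R \<le> \<epsilon> / 4"
      using qk by (intro order_trans[OF mult_right_mono R]) auto
    have "measure_pmf.prob (?rest r) {True} \<le> 1 / 8" for r
    proof -
      have "measure_pmf.prob (?rest r) {True} \<le>
          measure_pmf.prob (read_table n D ?h ?G ?q R m r) {(r, tab). \<not> r \<and> greedy_fit tab ?q k} + 0"
      proof (rule prob_bind_le_add)
        fix t assume "t \<notin> {(r, tab). \<not> r \<and> greedy_fit tab ?q k}"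
        then show "measure_pmf.prob (case t of (r', tab) \<Rightarrow>
            return_pmf (\<not> fnd \<and> \<not> r' \<and> greedy_fit tab ?q k)) {True} \<le> 0"
          by (cases t) (auto simp: indicator_def)
      qed simp
      also have "\<dots> \<le> 2 * (4 * real ?q + 1) ^ ?q * (1 - \<epsilon> / 4) ^ m"
      proof -
        have "measure_pmf.prob (read_table n D ?h ?G ?q R m r) {(r, tab). \<not> r \<and> greedy_fit tab ?q k}
            \<le> 2 * (4 * real ?q + 1) ^ ?q * (1 - \<epsilon> / 4) ^ m"
          by (rule read_table_sound[where \<phi> = "\<lambda>l. literal_value (\<sigma> l)"])
            (use \<sigma>(2) D far' R' in blast)+
        then show ?thesis by simp
      qed
      also have "\<dots> \<le> 2 * (4 * real k + 1) ^ k * (1 - \<epsilon> / 4) ^ m"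
      proof -
        have "(4 * real ?q + 1) ^ ?q \<le> (4 * real k + 1) ^ ?q"
          using qk by (intro power_mono) auto
        also have "\<dots> \<le> (4 * real k + 1) ^ k" using qk by (intro power_increasing) auto
        finally show ?thesis using \<epsilon> by (intro mult_right_mono) auto
      qed
      finally show ?thesis using m by simp
    qed
    then show ?thesis unfolding v by (rule prob_bind_le)
  qed
qed

text \<open>A premature stop of the block search and a wrong verdict contribute \<open>1 / 8\<close>
  each.\<close>

theorem tester_sound:
  assumes D: "set_pmf D \<subseteq> cube n" and far: "far_from D \<epsilon> (length_decision_list n k) f"
    and N1: "real (k + 1) * (1 - \<epsilon> / 2) ^ N1 \<le> 1 / 8"
    and R: "real k * (1 / 100) ^ R \<le> \<epsilon> / 4"
    and m: "2 * (4 * real k + 1) ^ k * (1 - \<epsilon> / 4) ^ m \<le> 1 / 8"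
    and \<epsilon>: "0 < \<epsilon>" "\<epsilon> \<le> 1"
  shows "measure_pmf.prob (tester n f D k N1 m R) {True} \<le> 1 / 4"
proof -
  let ?A = "{(fnd, own, ws). \<not> fnd \<and> \<epsilon> / 2 < measure_pmf.prob D {x. f x \<noteq> f (zero_outside n own x)}}"
  have "measure_pmf.prob (tester n f D k N1 m R) {True}
     \<le> measure_pmf.prob (find_blocks n f D k N1 R) ?A + 1 / 8"
    unfolding tester_def
  proof (rule prob_bind_le_add)
    fix s assume s: "s \<in> set_pmf (find_blocks n f D k N1 R)" "s \<notin> ?A"
    obtain fnd own ws where s': "s = (fnd, own, ws)" by (cases s)
    have "measure_pmf.prob D {x. f x \<noteq> f (zero_outside n own x)} \<le> \<epsilon> / 2" if "\<not> fnd"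
      using s(2) that unfolding s' by (simp add: not_less)
    moreover have "length ws \<le> k" if "\<not> fnd"
      using find_blocks_length[OF s(1)[unfolded s']] that by simp
    ultimately show "measure_pmf.prob (verdict n f D k m R s) {True} \<le> 1 / 8"
      unfolding s' by (rule verdict_sound[OF D far _ _ R m \<epsilon>])
  qed simp
  also have "\<dots> \<le> real (k + 1) * (1 - \<epsilon> / 2) ^ N1 + 1 / 8"
    using find_blocks_sound[of \<epsilon> n f D k N1 R] \<epsilon> by simp
  finally show ?thesis using N1 by simp
qed

section \<open>Completeness: blocks with a certificate of relevance\<close>

definition blocks_witnessed :: "nat \<Rightarrow> (bool list \<Rightarrow> bool) \<Rightarrow> blocks \<Rightarrow> bool" where
  "blocks_witnessed n f = (\<lambda>(own, ws). (\<forall>i<n. own i \<le> length ws) \<and>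
     (\<forall>l<length ws. \<exists>y'\<in>cube n. ws ! l \<in> cube n \<and> f (ws ! l) \<noteq> f y' \<and>
        (\<forall>i<n. ws ! l ! i \<noteq> y' ! i \<longleftrightarrow> own i = Suc l)))"

lemma halve_invariant:
  assumes "(z, z') \<in> set_pmf (iter_pmf R 0 (\<lambda>_. halve n f) (y, y'))"
    and "y \<in> cube n" "y' \<in> cube n" "f y \<noteq> f y'"
  shows "z \<in> cube n \<and> z' \<in> cube n \<and> f z \<noteq> f z' \<and> (\<forall>i<n. z ! i \<noteq> z' ! i \<longrightarrow> y ! i \<noteq> y' ! i)"
proof -
  let ?I = "\<lambda>_ :: nat. \<lambda>(z, z'). z \<in> cube n \<and> z' \<in> cube n \<and> f z \<noteq> f z' \<and>
      (\<forall>i<n. z ! i \<noteq> z' ! i \<longrightarrow> y ! i \<noteq> y' ! i)"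
  have "?I (0 + R) (z, z')"
  proof (rule iter_pmf_invariant[OF assms(1), of ?I])
    fix j s t assume s: "?I j s" and t: "t \<in> set_pmf (halve n f s)"
    obtain z z' where z: "s = (z, z')" by (cases s)
    from t obtain u where "t = (let w = select n ((!) u) z z' in if f w = f z then (w, z') else (z, w))"
      by (auto simp: halve_def z)
    then show "?I (Suc j) t" using s by (auto simp: z Let_def split: if_splits)
  qed (use assms(2-) in auto)
  then show ?thesis by simp
qed

lemma find_point_Some:
  assumes "Some x \<in> set_pmf (find_point n f D N1 own)" "set_pmf D \<subseteq> cube n"
  shows "x \<in> cube n \<and> f x \<noteq> f (zero_outside n own x)"
  using iter_pmf_invariant[OF assms(1)[unfolded find_point_def],
      where I = "\<lambda>_ v. \<forall>x. v = Some x \<longrightarrow> x \<in> cube n \<and> f x \<noteq> f (zero_outside n own x)"] assms(2)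
  by (fastforce split: if_splits)

text \<open>The second endpoint of a pair is not recorded; only its existence is kept as an
  invariant, with the block being exactly the set where the endpoints differ. A new block is
  disjoint from the old ones because a sample and its zeroed version agree on all owned variables
  and halving only shrinks the difference.\<close>

lemma epoch_witnessed:
  assumes D: "set_pmf D \<subseteq> cube n" and I: "blocks_witnessed n f bl"
    and t: "(fnd', bl') \<in> set_pmf (epoch n f D N1 R (fnd, bl))"
  shows "blocks_witnessed n f bl'"
proof -
  obtain own ws where bl: "bl = (own, ws)" by (cases bl)
  consider "bl' = bl" | x y y' where "Some x \<in> set_pmf (find_point n f D N1 own)"
      "(y, y') \<in> set_pmf (iter_pmf R 0 (\<lambda>_. halve n f) (x, zero_outside n own x))"
      "bl' = add_block n (own, ws) (y, y')"
    using t by (auto simp: bl epoch_def split: if_splits option.splits)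
  then show ?thesis
  proof cases
    case 2
    note x = find_point_Some[OF 2(1) D]
    have y: "y \<in> cube n" "y' \<in> cube n" "f y \<noteq> f y'"
      "\<And>i. i < n \<Longrightarrow> y ! i \<noteq> y' ! i \<Longrightarrow> x ! i \<noteq> zero_outside n own x ! i"
      using halve_invariant[OF 2(2)] x by auto
    have own: "own i = 0" if "i < n" "y ! i \<noteq> y' ! i" for i
      using y(4)[OF that] that by (auto split: if_splits)
    have le: "own i \<le> length ws" if "i < n" for i
      using I that by (auto simp: blocks_witnessed_def bl)
    show ?thesis
      unfolding blocks_witnessed_def 2(3) add_block_def prod.case
    proof (intro conjI allI impI)
      fix l assume l: "l < length (ws @ [y])"
      let ?own = "\<lambda>i. if i < n \<and> y ! i \<noteq> y' ! i then Suc (length ws) else own i"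
      show "\<exists>y'\<in>cube n. (ws @ [y]) ! l \<in> cube n \<and> f ((ws @ [y]) ! l) \<noteq> f y' \<and>
         (\<forall>i<n. (ws @ [y]) ! l ! i \<noteq> y' ! i \<longleftrightarrow> ?own i = Suc l)"
      proof (cases "l < length ws")
        case True
        then have "\<exists>y'\<in>cube n. ws ! l \<in> cube n \<and> f (ws ! l) \<noteq> f y' \<and>
            (\<forall>i<n. ws ! l ! i \<noteq> y' ! i \<longleftrightarrow> own i = Suc l)"
          using I unfolding blocks_witnessed_def bl prod.case by blast
        then obtain w where w: "w \<in> cube n" "ws ! l \<in> cube n" "f (ws ! l) \<noteq> f w"
          "\<And>i. i < n \<Longrightarrow> ws ! l ! i \<noteq> w ! i \<longleftrightarrow> own i = Suc l" by blast
        show ?thesis using w True own by (intro bexI[of _ w]) (auto simp: nth_append)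
      next
        case False
        then have "l = length ws" using l by simp
        moreover have "own i \<noteq> Suc (length ws)" if "i < n" for i using le[OF that] by simp
        ultimately show ?thesis using y(1-3) by (intro bexI[of _ y']) auto
      qed
    qed (use le in \<open>auto simp: le_Suc_eq\<close>)
  qed (use I in simp)
qed

lemma find_blocks_witnessed:
  assumes "(fnd, bl) \<in> set_pmf (find_blocks n f D k N1 R)" "set_pmf D \<subseteq> cube n"
  shows "blocks_witnessed n f bl"
proof -
  let ?I = "\<lambda>_ :: nat. \<lambda>(fnd :: bool, bl). blocks_witnessed n f bl"
  have "?I (0 + (k + 1)) (fnd, bl)"
  proof (rule iter_pmf_invariant[OF assms(1)[unfolded find_blocks_def], of ?I])
    fix j s t assume "?I j s" "t \<in> set_pmf (epoch n f D N1 R s)"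
    then show "?I (Suc j) t"
      using epoch_witnessed[OF assms(2), of f "snd s" "fst t" "snd t" N1 R "fst s"]
      by (simp add: split_beta)
  qed (simp add: blocks_witnessed_def)
  then show ?thesis by simp
qed

text \<open>Inside the old difference, one of the possible new pairs differs where \<open>u\<close>
  is True, the other where \<open>u\<close> is False. Whichever one \<open>f\<close> selects, two
  variables stay together only if their coins agree.\<close>

lemma halve_separates:
  assumes "i < n" "j < n" "i \<noteq> j"
  shows "measure_pmf.prob (iter_pmf R 0 (\<lambda>_. halve n f) p)
     {(y, y'). y ! i \<noteq> y' ! i \<and> y ! j \<noteq> y' ! j} \<le> (1 / 2) ^ R" (is "measure_pmf.prob _ ?A \<le> _")
proof (rule prob_iter_pmf_le_power)
  fix s :: "bool list \<times> bool list"
  obtain y y' where s: "s = (y, y')" by (cases s)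
  {
    assume "s \<in> ?A"
    have "measure_pmf.prob (halve n f s) ?A \<le> measure_pmf.prob (uniform_point n) {u. u ! i = u ! j}"
      unfolding s halve_def prod.case measure_map_pmf
      by (rule prob_mono_set) (use assms in \<open>auto simp: Let_def split: if_splits\<close>)
    then show "measure_pmf.prob (halve n f s) ?A \<le> 1 / 2"
      using uniform_point_nth_eq[OF assms] by simp
  next
    assume "s \<notin> ?A"
    then show "set_pmf (halve n f s) \<inter> ?A = {}"
      using assms by (auto simp: s halve_def Let_def split: if_splits)
  }
qed simp

definition collision :: "nat set \<Rightarrow> blocks \<Rightarrow> bool" where
  "collision V = (\<lambda>(own, ws). \<exists>i\<in>V. \<exists>j\<in>V. i \<noteq> j \<and> own i \<noteq> 0 \<and> own i = own j)"

text \<open>Union bound over the epochs and the pairs from \<open>V\<close>. A collision can only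
  arise inside the block just added, whose number is larger than all numbers in use, so both
  variables must have survived the halving together.\<close>

lemma find_blocks_collision:
  assumes D: "set_pmf D \<subseteq> cube n" and V: "V \<subseteq> {..<n}"
  shows "measure_pmf.prob (find_blocks n f D k N1 R) {(fnd, bl). collision V bl}
     \<le> real (k + 1) * (real (card V * card V) * (1 / 2) ^ R)" (is "measure_pmf.prob _ ?A \<le> _")
  unfolding find_blocks_def
proof (rule prob_iter_pmf_le_mult[where I = "\<lambda>_ (fnd, bl). blocks_witnessed n f bl"], goal_cases)
  case (2 j s t)
  then show ?case using epoch_witnessed[OF D] by fast
next
  case (4 j s)
  obtain fnd own ws where s: "s = (fnd, own, ws)" by (cases s)
  have finV: "finite V" using V finite_subset by blast
  let ?c = "real (card V * card V) * (1 / 2) ^ R"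
  let ?h = "\<lambda>x. iter_pmf R 0 (\<lambda>_. halve n f) (x, zero_outside n own x)"
  have le: "own i \<le> length ws" if "i < n" for i
    using 4(2) that by (auto simp: blocks_witnessed_def s)
  have nc: "\<not> collision V (own, ws)" using 4(3) by (simp add: s)
  have some: "measure_pmf.prob (map_pmf (\<lambda>p. (True, add_block n (own, ws) p)) (?h x)) ?A \<le> ?c" for x
  proof -
    let ?B = "\<lambda>(i, j). {(y, y'). y ! i \<noteq> y' ! i \<and> y ! j \<noteq> (y' ! j :: bool)}"
    let ?P = "{(i, j) \<in> V \<times> V. i \<noteq> j}"
    have "measure_pmf.prob (map_pmf (\<lambda>p. (True, add_block n (own, ws) p)) (?h x)) ?A
        \<le> measure_pmf.prob (?h x) (\<Union>t\<in>?P. ?B t)"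
      unfolding measure_map_pmf
    proof (rule prob_mono_set)
      fix p assume "p \<in> (\<lambda>p. (True, add_block n (own, ws) p)) -` ?A"
      then obtain y y' i j where p: "p = (y, y')" and ij: "i \<in> V" "j \<in> V" "i \<noteq> j"
        and o: "fst (add_block n (own, ws) (y, y')) i \<noteq> 0"
          "fst (add_block n (own, ws) (y, y')) i = fst (add_block n (own, ws) (y, y')) j"
        by (cases p) (auto simp: collision_def add_block_def)
      have n: "i < n" "j < n" using ij V by auto
      have "\<not> (own i \<noteq> 0 \<and> own i = own j)" using nc ij unfolding collision_def prod.case by metis
      then have "y ! i \<noteq> y' ! i \<and> y ! j \<noteq> y' ! j"
        using o le[OF n(1)] le[OF n(2)] n by (auto simp: add_block_def split: if_splits)
      then show "p \<in> (\<Union>t\<in>?P. ?B t)" using p ij by (intro UN_I[of "(i, j)"]) auto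
    qed
    also have "\<dots> \<le> (\<Sum>t\<in>?P. measure_pmf.prob (?h x) (?B t))"
      by (rule prob_UN_le) (use finV in \<open>auto intro: finite_subset[of _ "V \<times> V"]\<close>)
    also have "\<dots> \<le> (\<Sum>t\<in>?P. (1 / 2) ^ R)"
    proof (rule sum_mono)
      fix t assume "t \<in> ?P"
      then obtain i j where "t = (i, j)" "i < n" "j < n" "i \<noteq> j" using V by auto
      then show "measure_pmf.prob (?h x) (?B t) \<le> (1 / 2) ^ R"
        using halve_separates[of i n j R f "(x, zero_outside n own x)"] by simp
    qed
    also have "\<dots> = real (card ?P) * (1 / 2) ^ R" by simp
    also have "\<dots> \<le> ?c"
    proof (rule mult_right_mono)
      have "card ?P \<le> card (V \<times> V)" using finV by (intro card_mono) auto
      then show "real (card ?P) \<le> real (card V * card V)" by (simp only: of_nat_le_iff card_cartesian_product)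
    qed simp
    finally show ?thesis .
  qed
  show ?case
  proof (cases fnd)
    case True
    have "measure_pmf.prob (case v of None \<Rightarrow> return_pmf (False, own, ws)
       | Some x \<Rightarrow> map_pmf (\<lambda>p. (True, add_block n (own, ws) p)) (?h x)) ?A \<le> ?c" for v
      using some nc by (cases v) (auto simp: indicator_def)
    then have "measure_pmf.prob (bind_pmf (find_point n f D N1 own) (\<lambda>v. case v of
        None \<Rightarrow> return_pmf (False, own, ws)
       | Some x \<Rightarrow> map_pmf (\<lambda>p. (True, add_block n (own, ws) p)) (?h x))) ?A \<le> ?c"
      by (rule prob_bind_le)
    then show ?thesis unfolding s epoch_def prod.case using True by (simp only: if_True)
  next
    case False
    then show ?thesis using nc by (simp add: s epoch_def indicator_def)
  qed
qed (auto simp: blocks_witnessed_def collision_def)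


text \<open>The block contains a relevant variable, since its two witnesses have different values,
  and only one, since there is no collision. So the block function depends on that variable alone
  and takes two different values; every decoding is then correct with certainty.\<close>

lemma collision_free_block:
  assumes f: "\<And>x. x \<in> cube n \<Longrightarrow> f x = dl_eval L b x" and L: "rule_vars L \<subseteq> {..<n}"
    and wit: "blocks_witnessed n f (own, ws)" and nc: "\<not> collision (rule_vars L) (own, ws)"
    and l: "l < length ws"
  shows "\<exists>t\<in>rule_vars L. own t = Suc l \<and>
     (\<forall>x\<in>cube n. set_pmf (parity_at n (block_fun n f own ws l) x) = {x ! t})"
proof -
  have "\<exists>y'\<in>cube n. ws ! l \<in> cube n \<and> f (ws ! l) \<noteq> f y' \<and>
      (\<forall>i<n. ws ! l ! i \<noteq> y' ! i \<longleftrightarrow> own i = Suc l)"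
    using wit l unfolding blocks_witnessed_def prod.case by blast
  then obtain y' where y': "y' \<in> cube n" "ws ! l \<in> cube n" "f (ws ! l) \<noteq> f y'"
    "\<And>i. i < n \<Longrightarrow> ws ! l ! i \<noteq> y' ! i \<longleftrightarrow> own i = Suc l" by blast
  obtain t where t: "t \<in> rule_vars L" "own t = Suc l"
  proof (rule ccontr)
    assume "\<not> thesis"
    then have "ws ! l ! i = y' ! i" if "i \<in> rule_vars L" for i
      using that y'(4)[of i] L that \<open>\<And>t. t \<in> rule_vars L \<Longrightarrow> own t = Suc l \<Longrightarrow> thesis\<close> by auto
    then have "f (ws ! l) = f y'" 
      using f[OF y'(2)] f[OF y'(1)] dl_eval_cong[of L "ws ! l" y' b] by simp
    with y'(3) show False by simp
  qed
  have t': "i = t" if "i \<in> rule_vars L" "own i = Suc l" for i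
  proof (rule ccontr)
    assume "i \<noteq> t"
    moreover have "own i \<noteq> 0" "own i = own t" using that t by simp_all
    ultimately show False using nc that(1) t(1) unfolding collision_def prod.case by blast
  qed
  have "t < n" using t L by auto
  have cong: "f y = f z" if "y \<in> cube n" "z \<in> cube n" "\<And>i. i \<in> rule_vars L \<Longrightarrow> y ! i = z ! i" for y z
    
    using f[OF that(1)] f[OF that(2)] dl_eval_cong[of L y z b] that(3) by simp
  let ?g = "block_fun n f own ws l"
  have g: "?g u = (if u ! t = ws ! l ! t then f (ws ! l) else f y')" for u
  proof (cases "u ! t = ws ! l ! t")
    case True
    have "f (select n (\<lambda>i. own i = Suc l) u (ws ! l)) = f (ws ! l)"
    proof (rule cong)
      fix i assume i: "i \<in> rule_vars L"
      then have "i < n" using L by blast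
      then show "select n (\<lambda>i. own i = Suc l) u (ws ! l) ! i = ws ! l ! i"
        using t'[OF i] True by auto
    qed (use y'(2) in auto)
    then show ?thesis using True by (simp add: block_fun_def)
  next
    case False
    then have ut: "u ! t = y' ! t" using y'(4)[OF \<open>t < n\<close>] t(2) by auto
    have wy: "ws ! l ! i = y' ! i" if "i \<in> rule_vars L" "own i \<noteq> Suc l" for i
      using y'(4)[of i] that L by auto
    have "select n (\<lambda>i. own i = Suc l) u (ws ! l) ! i = y' ! i" if i: "i \<in> rule_vars L" for i
    proof -
      have "i < n" using i L by blast
      with ut wy[OF i] t'[OF i] show ?thesis by auto
    qed
    then have "f (select n (\<lambda>i. own i = Suc l) u (ws ! l)) = f y'"
      by (intro cong) (use y'(1) in auto)
    then show ?thesis using False by (simp add: block_fun_def)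
  qed
  have "(?g u \<noteq> ?g (xor_point u x)) = x ! t" if "u \<in> cube n" "x \<in> cube n" for u x
    unfolding g using that \<open>t < n\<close> y'(3) by (auto simp: point_nth)
  then have "set_pmf (parity_at n ?g x) = {x ! t}" if "x \<in> cube n" for x
    using that by (force simp: parity_at_def set_uniform_point intro: exI[of _ "replicate n False"])
  with t show ?thesis by blast
qed

lemma iter_pmf_constant:
  assumes "\<And>j. j < i + m \<Longrightarrow> g j x = return_pmf x"
  shows "iter_pmf m i g x = return_pmf x"
  using assms
proof (induction m)
  case (Suc m)
  then show ?case unfolding iter_pmf_snoc by (simp add: bind_return_pmf)
qed simp

lemma set_pmf_singletonD: "set_pmf p = {x} \<Longrightarrow> p = return_pmf x"
  by (simp add: set_pmf_subset_singleton[symmetric])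

lemma literal_test_complete:
  assumes "\<And>x. x \<in> cube n \<Longrightarrow> parity_at n g x = return_pmf (x ! t)" "t < n"
  shows "literal_test n g = return_pmf False"
proof -
  have "literal_test n g = bind_pmf (uniform_point n) (\<lambda>u. bind_pmf (uniform_point n) (\<lambda>v. return_pmf False))"
    unfolding literal_test_def
    by (intro bind_pmf_cong refl)
      (use assms in \<open>auto simp: set_uniform_point bind_return_pmf point_nth\<close>)
  then show ?thesis by simp
qed

lemma check_blocks_complete:
  assumes "\<And>l x. l < q \<Longrightarrow> x \<in> cube n \<Longrightarrow> parity_at n (G l) x = return_pmf (x ! \<tau> l)"
    and "\<And>l. l < q \<Longrightarrow> \<tau> l < n"
  shows "check_blocks n G q = return_pmf False"
  unfolding check_blocks_def check_block_def
  by (intro iter_pmf_constant) (use assms literal_test_complete in \<open>auto\<close>)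

lemma read_row_complete:
  assumes "\<And>l. l < q \<Longrightarrow> parity_at n (G l) x = return_pmf (x ! \<tau> l)"
  shows "read_row n G q R x False = return_pmf (False, map (\<lambda>l. x ! \<tau> l) [0..<q])"
  unfolding read_row_def using assms
proof (induction q)
  case (Suc q)
  have "iter_pmf R 0 (\<lambda>_ r. map_pmf (\<lambda>b'. r \<or> b' \<noteq> x ! \<tau> q) (parity_at n (G q) x)) False = return_pmf False"
    using Suc.prems[of q] by (intro iter_pmf_constant) simp
  then have "read_value n (G q) R x False = return_pmf (False, x ! \<tau> q)"
    using Suc.prems[of q] by (simp add: read_value_def bind_return_pmf)
  with Suc show ?case unfolding iter_pmf_snoc by (simp add: bind_return_pmf)
qed simp

lemma read_table_complete:
  assumes "(r, tab) \<in> set_pmf (read_table n D h G q R m False)" "set_pmf D \<subseteq> cube n"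
    and "\<And>l x. l < q \<Longrightarrow> x \<in> cube n \<Longrightarrow> parity_at n (G l) x = return_pmf (x ! \<tau> l)"
  shows "\<not> r \<and> (\<forall>(vs, y)\<in>set tab. \<exists>x\<in>cube n. vs = map (\<lambda>l. x ! \<tau> l) [0..<q] \<and> y = h x)"
proof -
  let ?I = "\<lambda>_ :: nat. \<lambda>(r, tab). \<not> r \<and>
     (\<forall>(vs, y)\<in>set tab. \<exists>x\<in>cube n. vs = map (\<lambda>l. x ! \<tau> l) [0..<q] \<and> y = h x)"
  have "?I (0 + m) (r, tab)"
  proof (rule iter_pmf_invariant[OF assms(1)[unfolded read_table_def], of ?I], goal_cases)
    case (2 j s t)
    obtain tab where s: "s = (False, tab)" using 2(1) by (cases s) auto
    from 2(2) have "t \<in> (\<Union>x\<in>set_pmf D. set_pmf (do {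
        (r', vs) \<leftarrow> read_row n G q R x False; return_pmf (r', tab @ [(vs, h x)])}))"
      unfolding s prod.case set_bind_pmf .
    then obtain x where x: "x \<in> set_pmf D"
      and t: "t \<in> set_pmf (do {(r', vs) \<leftarrow> read_row n G q R x False; return_pmf (r', tab @ [(vs, h x)])})"
      by blast
    from x have "x \<in> cube n" using assms(2) by blast
    with t have "t = (False, tab @ [(map (\<lambda>l. x ! \<tau> l) [0..<q], h x)])"
      using read_row_complete[of q n G x \<tau> R] assms(3) by (simp add: bind_return_pmf)
    then show ?case using 2(1) \<open>x \<in> cube n\<close> by (auto simp: s)
  qed simp
  then show ?thesis by simp
qed

text \<open>Collisions are the only source of error: without one, the remaining phases accept
  surely, for any numbers \<open>N1\<close> and \<open>m\<close> of samples.\<close>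

theorem tester_complete:
  assumes D: "set_pmf D \<subseteq> cube n" and f: "f \<in> length_decision_list n k"
    and R: "real (k + 1) * (real (k * k) * (1 / 2) ^ R) \<le> 1 / 3"
  shows "measure_pmf.prob (tester n f D k N1 m R) {False} \<le> 1 / 3"
proof -
  from f obtain L b where L: "length L \<le> k" "rule_vars L \<subseteq> {..<n}"
    "\<And>x. x \<in> cube n \<Longrightarrow> f x = dl_eval L b x"
    unfolding length_decision_list_iff by blast
  let ?A = "{(fnd :: bool, bl). collision (rule_vars L) bl}"
  have card: "card (rule_vars L) \<le> k" using card_rule_vars(2) L(1) le_trans by blast
  have "measure_pmf.prob (tester n f D k N1 m R) {False} \<le>
      measure_pmf.prob (find_blocks n f D k N1 R) ?A + 0"
    unfolding tester_def
  proof (rule prob_bind_le_add)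
    fix s assume s: "s \<in> set_pmf (find_blocks n f D k N1 R)" "s \<notin> ?A"
    obtain fnd own ws where s': "s = (fnd, own, ws)" by (cases s)
    have nc: "\<not> collision (rule_vars L) (own, ws)" using s(2) by (simp add: s')
    then have nc': "i = j" if "i \<in> rule_vars L" "j \<in> rule_vars L" "own i \<noteq> 0" "own i = own j" for i j
      using that unfolding collision_def prod.case by blast
    note wit = find_blocks_witnessed[OF s(1)[unfolded s'] D]
    let ?G = "block_fun n f own ws" and ?q = "length ws" and ?h = "\<lambda>x. f (zero_outside n own x)"
    have "\<forall>l. \<exists>t. l < ?q \<longrightarrow> t \<in> rule_vars L \<and> own t = Suc l \<and>
       (\<forall>x\<in>cube n. set_pmf (parity_at n (?G l) x) = {x ! t})"
      using collision_free_block[of n f L b, OF L(3,2) wit nc] by blast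
    then obtain \<tau> where \<tau>: "\<And>l. l < ?q \<Longrightarrow> \<tau> l \<in> rule_vars L" "\<And>l. l < ?q \<Longrightarrow> own (\<tau> l) = Suc l"
      "\<And>l x. l < ?q \<Longrightarrow> x \<in> cube n \<Longrightarrow> parity_at n (?G l) x = return_pmf (x ! \<tau> l)"
      by (metis set_pmf_singletonD)
    \<comment> \<open>Blocks inject into the relevant variables, so there are at most
      \<open>k\<close> of them and some epoch must have failed to find a point.\<close>
    have "inj_on \<tau> {..<?q}" using \<tau>(2) by (intro inj_onI) (metis lessThan_iff old.nat.inject)
    then have "card {..<?q} \<le> card (rule_vars L)"
      using \<tau>(1) card_rule_vars(1) by (intro card_inj_on_le[of \<tau>]) auto
    then have "?q \<le> k" using card by simp
    then have "\<not> fnd" using find_blocks_length[OF s(1)[unfolded s']] by auto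
    have check: "check_blocks n ?G ?q = return_pmf False"
      using \<tau>(1,3) L(2) by (intro check_blocks_complete[where \<tau> = \<tau>]) auto
    \<comment> \<open>A relevant variable is read from the column of its block; an unowned one gets
      \<open>None\<close>, matching the False that \<open>zero_outside\<close> puts there. On owned
      relevant variables \<open>\<tau>\<close> inverts this map.\<close>
    define \<sigma> where "\<sigma> i = (if own i = 0 then None else Some (own i - 1))" for i
    obtain L' b' where L': "length L' \<le> length L"
      "rule_vars L' \<subseteq> {j. \<exists>i\<in>rule_vars L. \<sigma> i = Some j}"
      "\<And>x y. (\<forall>i\<in>rule_vars L. y ! i = literal_value (\<sigma> i) x) \<Longrightarrow> dl_eval L b y = dl_eval L' b' x"
      using dl_eval_subst[of L \<sigma> b] by blast
    have own: "own i \<le> ?q" if "i \<in> rule_vars L" for i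
      using wit that L(2) by (auto simp: blocks_witnessed_def)
    have "rule_vars L' \<subseteq> {..<?q}"
      using L'(2) own by (fastforce simp: \<sigma>_def split: if_splits)
    have fit: "dl_eval L' b' (map (\<lambda>l. x ! \<tau> l) [0..<?q]) = ?h x" if "x \<in> cube n" for x
    proof -
      have "zero_outside n own x ! i = literal_value (\<sigma> i) (map (\<lambda>l. x ! \<tau> l) [0..<?q])"
        if i: "i \<in> rule_vars L" for i
      proof (cases "own i = 0")
        case False
        then obtain l where l: "own i = Suc l" "l < ?q" using own[OF i] by (cases "own i") auto
        then have "own i \<noteq> 0" "own i = own (\<tau> l)" using \<tau>(2)[OF l(2)] by simp_all
        then have \<tau>l: "\<tau> l = i" using nc'[OF i \<tau>(1)[OF l(2)]] by auto
        have "i < n" using i L(2) by blast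
        moreover have "\<sigma> i = Some l" using l(1) by (simp add: \<sigma>_def)
        ultimately show ?thesis using l \<tau>l by simp
      next
        case True
        moreover have "i < n" using i L(2) by blast
        ultimately show ?thesis by (simp add: \<sigma>_def)
      qed
      then have "dl_eval L b (zero_outside n own x) = dl_eval L' b' (map (\<lambda>l. x ! \<tau> l) [0..<?q])"
        by (intro L'(3)) blast
      then show ?thesis using L(3)[of "zero_outside n own x"] by simp
    qed
    have greedy: "\<not> r \<and> greedy_fit tab ?q k"
      if "(r, tab) \<in> set_pmf (read_table n D ?h ?G ?q R m False)" for r tab
      using read_table_complete[OF that D \<tau>(3)] fit L'(1) L(1) \<open>rule_vars L' \<subseteq> {..<?q}\<close>
      by (auto intro!: greedy_fit_complete[of L' ?q k tab b'])
    have "set_pmf (verdict n f D k m R s) \<inter> {False} = {}"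
    proof (rule ccontr)
      assume "\<not> ?thesis"
      then have "False \<in> set_pmf (verdict n f D k m R s)" by blast
      then obtain r tab where "(r, tab) \<in> set_pmf (read_table n D ?h ?G ?q R m False)"
        "False = (\<not> fnd \<and> \<not> r \<and> greedy_fit tab ?q k)"
        unfolding verdict_def s' prod.case check bind_return_pmf set_bind_pmf by auto
      with greedy \<open>\<not> fnd\<close> show False by blast
    qed
    then have "measure_pmf.prob (verdict n f D k m R s) {False} = 0" by (simp only: prob_eq_0_iff)
    then show "measure_pmf.prob (verdict n f D k m R s) {False} \<le> 0" by simp
  qed simp
  also have "\<dots> \<le> real (k + 1) * (real (card (rule_vars L) * card (rule_vars L)) * (1 / 2) ^ R)"
    using find_blocks_collision[OF D L(2), of f k N1 R] by simp
  also have "\<dots> \<le> real (k + 1) * (real (k * k) * (1 / 2) ^ R)"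
    using mult_le_mono[OF card card]
    by (intro mult_left_mono mult_right_mono) (simp_all only: of_nat_le_iff, simp_all)
  finally show ?thesis using R by simp
qed

subsection \<open>Memory layout and evaluation of a block\<close>

abbreviation V :: "nat \<Rightarrow> expr" where
  "V r \<equiv> Read (Const r)"

definition dbl :: "expr \<Rightarrow> expr" where
  "dbl e = Add e e"

text \<open>The distance of two numbers, composed of two truncated subtractions; on bits it is the
  exclusive or itself.\<close>

definition neq :: "expr \<Rightarrow> expr \<Rightarrow> expr" where
  "neq d e = Add (Sub d e) (Sub e d)"

definition eqe :: "expr \<Rightarrow> expr \<Rightarrow> expr" where
  "eqe d e = Sub (Const 1) (neq d e)"

definition and_expr :: "expr \<Rightarrow> expr \<Rightarrow> expr" where
  "and_expr d e = Sub (Add d e) (Const 1)"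

lemma of_bool_eq_Suc_0 [simp]: "of_bool b = Suc 0 \<longleftrightarrow> b" "Suc 0 = of_bool b \<longleftrightarrow> b"
  by auto

text \<open>Memory layout: registers below 64, two point buffers of \<open>n\<close> cells, and then 16 unbounded
  arrays, interleaved so that distinct arrays never overlap. The registers 0 to 9 contain
  \<open>n\<close>, \<open>k\<close>, \<open>\<lfloor>1 / \<epsilon>\<rfloor>\<close>, the bit width \<open>W\<close>, the parameters \<open>N1\<close>, \<open>m\<close>, \<open>R\<close>, the epoch, the number of
  blocks, and the flag of the last epoch. Array 0 contains the block numbers, 2 the witnesses,
  9 and 10 the table and its labels, 11 the rows not yet explained by a rule.\<close>

definition loc :: "nat \<Rightarrow> nat \<Rightarrow> nat \<Rightarrow> nat" where
  "loc n a i = 64 + a + 2 * (n + 8 * i)"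

text \<open>The address \<open>64 + a + 2 * n + 16 * i\<close>, with multiplications spelled as
  doublings because expressions only add and subtract. Register 0 supplies \<open>n\<close>.\<close>

definition arr :: "nat \<Rightarrow> expr \<Rightarrow> expr" where
  "arr a e = Add (Const (64 + a)) (dbl (Add (V 0) (dbl (dbl (dbl e)))))"

definition buf0 :: "expr \<Rightarrow> expr" where
  "buf0 e = Add (Const 64) e"

definition buf1 :: "expr \<Rightarrow> expr" where
  "buf1 e = Add (Add (Const 64) (V 0)) e"

lemma eval_dbl [simp]: "eval (dbl e) s = 2 * eval e s"
  by (simp add: dbl_def)

lemma eval_arr [simp]: "eval (arr a e) s = loc (s 0) a (eval e s)"
  by (simp add: arr_def loc_def)

lemma eval_buf [simp]: "eval (buf0 e) s = 64 + eval e s" "eval (buf1 e) s = 64 + s 0 + eval e s"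
  by (simp_all add: buf0_def buf1_def)

lemma eval_neq [simp]: "eval (neq d e) s = 0 \<longleftrightarrow> eval d s = eval e s"
  by (auto simp: neq_def)

lemma eval_eqe [simp]: "eval (eqe d e) s = of_bool (eval d s = eval e s)"
  by (auto simp: eqe_def neq_def)

lemma eval_and [simp]:
  "eval d s = of_bool a \<Longrightarrow> eval e s = of_bool b \<Longrightarrow> eval (and_expr d e) s = of_bool (a \<and> b)"
  by (auto simp: and_expr_def)

lemma loc_eq_iff: "a < 16 \<Longrightarrow> b < 16 \<Longrightarrow> loc n a i = loc n b j \<longleftrightarrow> a = b \<and> i = j"
proof
  assume ab: "a < 16" "b < 16" and "loc n a i = loc n b j"
  then have eq: "a + 16 * i = b + 16 * j" by (simp add: loc_def)
  then have "(a + 16 * i) mod 16 = (b + 16 * j) mod 16" by (rule arg_cong)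
  with ab have "a = b" by simp
  with eq show "a = b \<and> i = j" by simp
qed simp

lemma loc_same_iff [simp]: "loc n a i = loc n a j \<longleftrightarrow> i = j"
  by (simp add: loc_def)

lemma loc_ge: "64 + 2 * n \<le> loc n a i"
  by (simp add: loc_def)

lemma loc_neq [simp]: "x < 64 + 2 * n \<Longrightarrow> loc n a i \<noteq> x" "x < 64 + 2 * n \<Longrightarrow> x \<noteq> loc n a i"
  using loc_ge[of n a i] by auto

text \<open>Protected are only the registers below \<open>lo\<close> and the arrays outside
  \<open>X\<close>; the two point buffers are scratch space. Nested programs work in higher
  registers, so \<open>lo\<close> grows with the nesting depth.\<close>

definition frame :: "nat \<Rightarrow> nat \<Rightarrow> nat set \<Rightarrow> memory \<Rightarrow> memory \<Rightarrow> bool" where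
  "frame n lo X s t \<longleftrightarrow> lo \<le> 64 \<and> X \<subseteq> {..<16} \<and> (\<forall>r<lo. t r = s r) \<and>
     (\<forall>a i. a < 16 \<longrightarrow> a \<notin> X \<longrightarrow> t (loc n a i) = s (loc n a i))"

lemma frame_refl: "lo \<le> 64 \<Longrightarrow> X \<subseteq> {..<16} \<Longrightarrow> frame n lo X s s"
  by (simp add: frame_def)

lemma frame_trans: "frame n lo X s t \<Longrightarrow> frame n lo' X' t u \<Longrightarrow> lo \<le> lo' \<Longrightarrow> X' \<subseteq> X \<Longrightarrow> frame n lo X s u"
  unfolding frame_def by (smt (verit, best) order_less_le_trans subset_iff)

lemma frame_mono: "frame n lo X s t \<Longrightarrow> lo' \<le> lo \<Longrightarrow> X \<subseteq> X' \<Longrightarrow> X' \<subseteq> {..<16} \<Longrightarrow> frame n lo' X' s t"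
  unfolding frame_def by (meson order_less_le_trans order_trans subsetD)

lemma frame_upd:
  "frame n lo X s t \<Longrightarrow> lo \<le> x \<Longrightarrow> x < 64 + 2 * n \<Longrightarrow> frame n lo X s (t(x := v))"
  unfolding frame_def by auto

lemma frame_upd_loc:
  assumes "frame n lo X s t" "a \<in> X"
  shows "frame n lo X s (t(loc n a i := v))"
proof -
  from assms have "a < 16" "lo \<le> 64" unfolding frame_def by auto
  with assms show ?thesis unfolding frame_def by (auto simp: loc_eq_iff)
qed

lemma frame_reg: "frame n lo X s t \<Longrightarrow> r < lo \<Longrightarrow> t r = s r"
  by (simp add: frame_def)

lemma frame_loc: "frame n lo X s t \<Longrightarrow> a \<notin> X \<Longrightarrow> a < 16 \<Longrightarrow> t (loc n a i) = s (loc n a i)"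
  by (simp add: frame_def)

lemma load_point_eqI:
  assumes "x \<in> cube n" "\<And>i. i < n \<Longrightarrow> s (p + i) = of_bool (x ! i)"
  shows "load_point n p s = x"
  using assms by (auto simp: load_point_def intro: nth_equalityI)

definition holds_point :: "nat \<Rightarrow> nat \<Rightarrow> nat \<Rightarrow> bool list \<Rightarrow> memory \<Rightarrow> bool" where
  "holds_point n a off x s \<longleftrightarrow> (\<forall>i<n. s (loc n a (off + i)) = of_bool (x ! i))"

lemma holds_point_frame: "holds_point n a off x s \<Longrightarrow> frame n lo X s t \<Longrightarrow> a \<notin> X \<Longrightarrow> a < 16 \<Longrightarrow> holds_point n a off x t"
  by (simp add: holds_point_def frame_def)

lemma holds_point_upd [simp]: "y < 64 + 2 * n \<Longrightarrow> holds_point n a off x (s(y := v)) \<longleftrightarrow> holds_point n a off x s"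
  by (simp add: holds_point_def)

definition stores :: "nat \<Rightarrow> (nat \<Rightarrow> nat) \<Rightarrow> bool list list \<Rightarrow> memory \<Rightarrow> bool" where
  "stores n own ws s \<longleftrightarrow> s 0 = n \<and> s 8 = length ws \<and> (\<forall>i<n. s (loc n 0 i) = own i) \<and>
     (\<forall>l<length ws. holds_point n 2 (l * n) (ws ! l) s)"

lemma stores_frame:
  "stores n own ws s \<Longrightarrow> frame n lo X s t \<Longrightarrow> 0 \<notin> X \<Longrightarrow> 2 \<notin> X \<Longrightarrow> 9 \<le> lo \<Longrightarrow> stores n own ws t"
  by (simp add: stores_def frame_def holds_point_def)

text \<open>Repeated addition with the first factor as number of rounds; the programs put an index,
  a block count or an input there, so the time stays polynomial.\<close>

definition mul :: "nat \<Rightarrow> nat \<Rightarrow> expr \<Rightarrow> expr \<Rightarrow> cmd" where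
  "mul d t a b = Seq (Assign (Const d) (Const 0)) (For t a (Assign (Const d) (Add (V d) b)))"

lemma replicate_pmf_snoc:
  "replicate_pmf (Suc m) p = bind_pmf (replicate_pmf m p) (\<lambda>us. bind_pmf p (\<lambda>b. return_pmf (us @ [b])))"
  using replicate_pmf_distrib[of m 1 p] by (simp add: bind_assoc_pmf bind_return_pmf)

text \<open>The programs toss coin after coin and append, whereas \<open>replicate_pmf\<close>
  prepends; this identifies the two distributions.\<close>

lemma iter_uniform_point:
  "iter_pmf n 0 (\<lambda>_ us. bind_pmf coin (\<lambda>b. return_pmf (us @ [b]))) [] = uniform_point n"
  by (induction n) (simp_all only: iter_pmf.simps(1) replicate_pmf.simps(1) iter_pmf_snoc replicate_pmf_snoc)

context oracles begin

lemma refines_time: "refines c s T Q a R \<Longrightarrow> T \<le> T' \<Longrightarrow> Q \<le> Q' \<Longrightarrow> refines c s T' Q' a R"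
  by (rule refines_weaken)

lemma refines_mul:
  assumes "d \<noteq> t" "\<And>v w. eval a (s(d := v, t := w)) = eval a s" "\<And>v w. eval b (s(d := v, t := w)) = eval b s"
    and "R x (s(d := eval a s * eval b s, t := eval a s))"
  shows "refines (mul d t a b) s (4 * eval a s + 5) 0 (return_pmf x) R"
  unfolding mul_def
proof (rule refines_time[OF refines_Assign_Seq])
  have "refines (For t a (Assign (Const d) (Add (V d) b))) (s(d := 0)) (eval a s * (1 + 3) + 3) (eval a s * 0)
     (iter_pmf (eval a s) 0 (\<lambda>_. return_pmf) x) R"
  proof (rule refines_For[where I = "\<lambda>i y s'. y = x \<and> s' = s(d := i * eval b s, t := i)"], goal_cases)
    case (3 i y s')
    then have "eval b s' = eval b s" using assms(3) by blast
    with 3 show ?case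
      by (intro refines_Assign) (use assms in \<open>auto intro!: ext\<close>)
  qed (use assms in auto)
  also have "iter_pmf (eval a s) 0 (\<lambda>_. return_pmf) x = return_pmf x"
    by (rule iter_pmf_constant) simp
  finally show "refines (For t a (Assign (Const d) (Add (V d) b)))
      (s(eval (Const d) s := eval (Const 0) s)) (eval a s * (1 + 3) + 3) (eval a s * 0) (return_pmf x) R"
    by (simp only: eval.simps)
qed simp_all

end

text \<open>\<open>phi a\<close> evaluates \<open>parity_at\<close> for the block in register 20 and the point in array \<open>a\<close>.\<close>

definition phi :: "nat \<Rightarrow> cmd" where
  "phi a = Seq (mul 32 33 (V 20) (V 0)) (Seq
     (For 30 (V 0) (Seq (Toss (Const 31))
        (If (eqe (Read (arr 0 (V 30))) (Add (V 20) (Const 1)))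
          (Seq (Assign (buf0 (V 30)) (V 31))
            (Assign (buf1 (V 30)) (neq (V 31) (Read (arr a (V 30))))))
          (Seq (Assign (buf0 (V 30)) (Read (arr 2 (Add (V 32) (V 30)))))
            (Assign (buf1 (V 30)) (Read (arr 2 (Add (V 32) (V 30)))))))))
     (Seq (Query (Const 34) (Const 64)) (Seq (Query (Const 35) (buf1 (Const 0)))
       (Assign (Const 36) (neq (V 34) (V 35))))))"

context oracles begin

text \<open>A coin is tossed at every coordinate and discarded outside the block, so the tossed
  vector has exactly the distribution \<open>uniform_point n\<close> demanded by
  \<open>parity_at\<close>. The buffers receive the hybrids of the witness with \<open>u\<close> and
  with \<open>xor_point u x\<close>.\<close>

lemma refines_phi:
  assumes st: "stores n own ws s" and l: "s 20 = l" "l < length ws" and a: "a < 16" "holds_point n a 0 x s"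
    and x: "x \<in> cube n"
  shows "refines (phi a) s (4 * length ws + 20 * n + 30) 2 (parity_at n (block_fun n f own ws l) x)
     (\<lambda>b s'. s' 36 = of_bool b \<and> frame n 30 {} s s')"
proof -
  let ?P = "\<lambda>i. own i = Suc l" and ?w = "ws ! l"
  let ?g = "block_fun n f own ws l"
  let ?s0 = "s(32 := l * n, 33 := l)"
  let ?I = "\<lambda>i us t. length us = i \<and> frame n 30 {} s t \<and> t 32 = l * n \<and>
     (\<forall>j<i. t (64 + j) = of_bool (if ?P j then us ! j else ?w ! j)) \<and>
     (\<forall>j<i. t (64 + n + j) = of_bool (if ?P j then us ! j \<noteq> x ! j else ?w ! j))"
  let ?body = "Seq (Toss (Const 31))
        (If (eqe (Read (arr 0 (V 30))) (Add (V 20) (Const 1)))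
          (Seq (Assign (buf0 (V 30)) (V 31))
            (Assign (buf1 (V 30)) (neq (V 31) (Read (arr a (V 30))))))
          (Seq (Assign (buf0 (V 30)) (Read (arr 2 (Add (V 32) (V 30)))))
            (Assign (buf1 (V 30)) (Read (arr 2 (Add (V 32) (V 30)))))))"
  note s = st[unfolded stores_def holds_point_def] a(2)[unfolded holds_point_def]
  have fr0: "frame n 30 {} s ?s0"
    by (intro frame_upd frame_refl) auto
  have n0: "s 0 = n" using st by (simp add: stores_def)
  have loop: "refines (For 30 (V 0) ?body) ?s0 (n * (10 + 3) + 3) (n * 0)
      (iter_pmf n 0 (\<lambda>_ us. bind_pmf coin (\<lambda>b. return_pmf (us @ [b]))) [])
      (\<lambda>us t. ?I n us t)"
  proof (rule refines_For[where I = ?I], goal_cases)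
    case 1
    show ?case using fr0 by (auto intro!: frame_upd)
  next
    case (2 i us t)
    then show ?case using s by (auto simp: frame_def)
  next
    case (3 i us t)
    then have fr: "frame n 30 {} s t" and i: "i < n" "t 30 = i" by auto
    have t: "t 0 = n" "t 20 = l" "t (loc n 0 i) = own i" "t (loc n 2 (l * n + i)) = of_bool (?w ! i)"
      "t (loc n a i) = of_bool (x ! i)"
      using frame_reg[OF fr] frame_loc[OF fr] s l a i by auto
    show ?case
    proof (rule refines_time[OF refines_Toss_Seq[OF refines_If[OF refines_Assign_Seq[OF refines_Assign]
            refines_Assign_Seq[OF refines_Assign]]]], goal_cases)
      case (1 b)
      then have "own i = Suc l" using t i by simp
      then show ?case using 3 t i
        by (auto simp: nth_append less_Suc_eq neq_def intro!: frame_upd)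
    next
      case (2 b)
      then have "own i \<noteq> Suc l" using t i by simp
      then show ?case using 3 t i
        by (auto simp: nth_append less_Suc_eq intro!: frame_upd)
    qed simp_all
  qed simp
  have tail: "refines (Seq (Query (Const 34) (Const 64)) (Seq (Query (Const 35) (buf1 (Const 0)))
       (Assign (Const 36) (neq (V 34) (V 35))))) t 5 2 (return_pmf (?g us \<noteq> ?g (xor_point us x)))
       (\<lambda>b s'. s' 36 = of_bool b \<and> frame n 30 {} s s')" if I: "?I n us t" for us t
  proof -
    have t0: "t 0 = n" using I frame_reg[of n 30 "{}" s t 0] n0 by simp
    have us: "us \<in> cube n" using I by simp
    have l0: "load_point n 64 t = select n ?P us ?w"
      using I by (intro load_point_eqI) auto
    have l1: "load_point n (64 + n) (t(34 := v)) = select n ?P (xor_point us x) ?w" for v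
      using I us x by (intro load_point_eqI) (auto simp: point_nth)
    show ?thesis
      by (rule refines_time[OF refines_Query_Seq[OF refines_Query_Seq[OF refines_Assign]]])
        (use I t0 l0 l1 in \<open>auto simp: block_fun_def neq_def intro!: frame_upd\<close>)
  qed
  have mul: "refines (mul 32 33 (V 20) (V 0)) s (4 * eval (V 20) s + 5) 0 (return_pmf ()) (\<lambda>_ t. t = ?s0)"
    by (rule refines_mul) (use l n0 in auto)
  have "refines (phi a) s ((4 * eval (V 20) s + 5) + ((n * (10 + 3) + 3) + 5 + 1) + 1) (0 + (n * 0 + 2))
     (bind_pmf (iter_pmf n 0 (\<lambda>_ us. bind_pmf coin (\<lambda>b. return_pmf (us @ [b]))) [])
       (\<lambda>us. return_pmf (?g us \<noteq> ?g (xor_point us x))))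
     (\<lambda>b s'. s' 36 = of_bool b \<and> frame n 30 {} s s')"
    unfolding phi_def
    by (rule refines_Seq_return[OF mul]) (simp only:, rule refines_Seq[OF loop tail])
  then show ?thesis
    unfolding iter_uniform_point parity_at_def map_pmf_def
    by (rule refines_time) (use l in auto)
qed

end

subsection \<open>Programs for the literal test and the table\<close>

definition fill :: "nat \<Rightarrow> cmd" where
  "fill a = For 23 (V 0) (Seq (Toss (Const 24)) (Assign (arr a (V 23)) (V 24)))"

definition phi_to :: "nat \<Rightarrow> nat \<Rightarrow> cmd" where
  "phi_to a d = Seq (phi a) (Assign (Const d) (V 36))"

text \<open>Points and readings are drawn in the order of \<open>literal_test\<close>, so that the
  coupling proceeds draw by draw.\<close>

definition lit_prog :: cmd where
  "lit_prog = Seq (fill 6) (Seq (fill 7) (Seq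
     (For 23 (V 0) (Assign (arr 8 (V 23)) (and_expr (Read (arr 6 (V 23))) (Read (arr 7 (V 23))))))
     (Seq (phi_to 6 26) (Seq (phi_to 6 27) (Seq (phi_to 7 28) (Seq (phi_to 8 29)
       (If (Add (neq (V 26) (V 27)) (neq (and_expr (V 26) (V 28)) (V 29)))
         (Assign (Const 22) (Const 1)) Skip)))))))"

definition check_blocks_prog :: cmd where
  "check_blocks_prog = Seq (Assign (Const 22) (Const 0)) (For 20 (V 8) (For 21 (Const 1000) lit_prog))"

definition read_value_prog :: cmd where
  "read_value_prog = Seq (phi_to 6 23) (For 21 (V 6) (Seq (phi_to 6 24)
     (If (neq (V 24) (V 23)) (Assign (Const 22) (Const 1)) Skip)))"

definition read_row_prog :: cmd where
  "read_row_prog = For 20 (V 8) (Seq read_value_prog (Assign (arr 9 (Add (V 19) (V 20))) (V 23)))"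

definition zero_outside_prog :: "nat \<Rightarrow> cmd" where
  "zero_outside_prog r = For r (V 0) (If (Read (arr 0 (V r)))
     (Assign (buf1 (V r)) (Read (buf0 (V r)))) (Assign (buf1 (V r)) (Const 0)))"

text \<open>The label is queried before the row is decoded, because decoding overwrites the buffers;
  the sample itself survives in array 6.\<close>

definition read_table_prog :: cmd where
  "read_table_prog = For 18 (V 5) (Seq (Sample (Const 64)) (Seq (zero_outside_prog 23) (Seq
     (For 23 (V 0) (Assign (arr 6 (V 23)) (Read (buf0 (V 23))))) (Seq
     (Query (Const 23) (buf1 (Const 0))) (Seq
     (Assign (arr 10 (V 18)) (V 23)) (Seq
     (mul 19 23 (V 18) (V 8)) read_row_prog))))))"

context oracles begin

lemma refines_fill:
  assumes n0: "s 0 = n" and a: "a < 16"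
  shows "refines (fill a) s (n * 6 + 3) 0 (uniform_point n)
     (\<lambda>u t. u \<in> cube n \<and> holds_point n a 0 u t \<and> frame n 23 {a} s t)"
proof -
  let ?I = "\<lambda>i us t. length us = i \<and> (\<forall>j<i. t (loc n a j) = of_bool (us ! j)) \<and> frame n 23 {a} s t"
  have "refines (fill a) s (n * (3 + 3) + 3) (n * 0)
     (iter_pmf n 0 (\<lambda>_ us. bind_pmf coin (\<lambda>b. return_pmf (us @ [b]))) []) (?I n)"
    unfolding fill_def
  proof (rule refines_For[where I = ?I], goal_cases)
    case 1
    show ?case using a by (auto intro!: frame_upd frame_refl)
  next
    case (2 i us t)
    then show ?case using n0 by (auto simp: frame_def)
  next
    case (3 i us t)
    then have fr: "frame n 23 {a} s t" by blast
    then have t0: "t 0 = n" using n0 by (simp add: frame_def)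
    show ?case
      by (rule refines_time[OF refines_Toss_Seq[OF refines_Assign]])
        (use 3 t0 in \<open>auto simp: nth_append less_Suc_eq intro!: frame_upd frame_upd_loc\<close>)
  qed simp
  then show ?thesis unfolding iter_uniform_point
    by (rule refines_weaken) (auto simp: holds_point_def)
qed

text \<open>The source may lie in a buffer, so the premise on \<open>e\<close> may use that the
  buffers are untouched, and the conclusion passes this on to a second copy.\<close>

lemma refines_copy:
  assumes n0: "s 0 = n" and a: "a < 16" and r: "0 < r" "r < 64"
    and e: "\<And>i t. i < n \<Longrightarrow> frame n r {a} s t \<Longrightarrow> t r = i \<Longrightarrow> (\<forall>j<2*n. t (64 + j) = s (64 + j)) \<Longrightarrow>
      eval e t = of_bool (x ! i)"
  shows "refines (For r (V 0) (Assign (arr a (V r)) e)) s (n * 4 + 3) 0 (return_pmf ())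
     (\<lambda>_ t. holds_point n a 0 x t \<and> frame n r {a} s t \<and> (\<forall>j<2*n. t (64 + j) = s (64 + j)))"
proof -
  let ?I = "\<lambda>i (_::unit) t. (\<forall>j<i. t (loc n a j) = of_bool (x ! j)) \<and> frame n r {a} s t \<and>
     (\<forall>j<2*n. t (64 + j) = s (64 + j))"
  have "refines (For r (V 0) (Assign (arr a (V r)) e)) s (n * (1 + 3) + 3) (n * 0)
     (iter_pmf n 0 (\<lambda>_. return_pmf) ()) (?I n)"
  proof (rule refines_For[where I = ?I], goal_cases)
    case 1
    show ?case using a r by (auto intro!: frame_upd frame_refl)
  next
    case (2 i us t)
    then show ?case using n0 r by (auto simp: frame_def)
  next
    case (3 i us t)
    then have t0: "t 0 = n" using n0 r by (auto simp: frame_def)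
    have "eval e t = of_bool (x ! i)" using 3 by (intro e) auto
    then show ?case using 3 t0 r
      by (intro refines_Assign) (auto simp: less_Suc_eq intro!: frame_upd frame_upd_loc)
  qed simp
  then show ?thesis unfolding iter_pmf_constant[of 0 n "\<lambda>_. return_pmf", OF refl]
    by (rule refines_weaken) (auto simp: holds_point_def)
qed

lemma refines_phi_to:
  assumes "stores n own ws s" "s 20 = l" "l < length ws" "a < 16" "holds_point n a 0 x s" "x \<in> cube n"
    and d: "d \<le> 30"
  shows "refines (phi_to a d) s (4 * length ws + 20 * n + 32) 2 (parity_at n (block_fun n f own ws l) x)
     (\<lambda>b t. t d = of_bool b \<and> frame n d {} s t)"
proof -
  have "refines (phi_to a d) s ((4 * length ws + 20 * n + 30) + 1 + 1) (2 + 0)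
     (bind_pmf (parity_at n (block_fun n f own ws l) x) return_pmf)
     (\<lambda>b t. t d = of_bool b \<and> frame n d {} s t)"
    unfolding phi_to_def
    by (rule refines_Seq[OF refines_phi[OF assms(1-6)]], rule refines_Assign)
      (use d in \<open>auto intro!: frame_upd elim: frame_mono\<close>)
  then show ?thesis unfolding bind_return_pmf' by (rule refines_time) auto
qed

lemma refines_lit_prog:
  assumes st: "stores n own ws s" and l: "s 20 = l" "l < length ws" and r: "s 22 = of_bool r"
  shows "refines lit_prog s (16 * length ws + 100 * n + 200) 8
     (map_pmf (\<lambda>t. r \<or> t) (literal_test n (block_fun n f own ws l)))
     (\<lambda>r' t. t 22 = of_bool r' \<and> t 21 = s 21 \<and> frame n 21 {6, 7, 8} s t)"
proof -
  let ?g = "block_fun n f own ws l" and ?P = "4 * length ws + 20 * n + 32"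
  let ?post = "\<lambda>r' t. t 22 = of_bool r' \<and> t 21 = s 21 \<and> frame n 21 {6, 7, 8} s t"
  let ?If = "If (Add (neq (V 26) (V 27)) (neq (and_expr (V 26) (V 28)) (V 29)))
         (Assign (Const 22) (Const 1)) Skip"
  \<comment> \<open>\<open>K\<close> is what every subprogram preserves, and \<open>H\<close> below
    adds the three test points. The continuations are refined from the last command backwards, since
    each sequencing step needs the refinement of what follows.\<close>
  define K where "K t \<longleftrightarrow> t 20 = l \<and> t 22 = of_bool r \<and> t 21 = s 21 \<and> stores n own ws t \<and>
     frame n 21 {6, 7, 8} s t" for t
  have K: "K t'" if "K t" "frame n lo X t t'" "X \<subseteq> {6, 7, 8}" "23 \<le> lo" for t t' lo X
    unfolding K_def
  proof (intro conjI)
    show "stores n own ws t'"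
      by (rule stores_frame[OF _ that(2)]) (use that in \<open>auto simp: K_def\<close>)
    show "frame n 21 {6, 7, 8} s t'"
      by (rule frame_trans[OF _ that(2)]) (use that in \<open>auto simp: K_def\<close>)
  qed (use that frame_reg[OF that(2)] in \<open>auto simp: K_def\<close>)
  define H where "H u v t \<longleftrightarrow> K t \<and> u \<in> cube n \<and> v \<in> cube n \<and>
     holds_point n 6 0 u t \<and> holds_point n 7 0 v t \<and> holds_point n 8 0 (and_point u v) t" for u v t
  have H: "H u v t'" if "H u v t" "frame n lo {} t t'" "23 \<le> lo" for u v t t' lo
    using that K[OF _ that(2)] holds_point_frame[OF _ that(2)] by (auto simp: H_def)
  have phi: "refines (phi_to a d) t ?P 2 (parity_at n ?g x) (\<lambda>b t'. t' d = of_bool b \<and> frame n d {} t t')"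
    if "K t" "holds_point n a 0 x t" "a < 16" "x \<in> cube n" "d \<le> 30" for a d x t
    using that l(2) by (intro refines_phi_to) (auto simp: K_def)
  have 5: "refines ?If t 3 0 (return_pmf (r \<or> (a \<noteq> a' \<or> (a \<and> b) \<noteq> c))) ?post"
    if "H u v t" "t 26 = of_bool a" "t 27 = of_bool a'" "t 28 = of_bool b" "t 29 = of_bool c"
    for u v t a a' b c
  proof (rule refines_time[OF refines_If[OF refines_Assign refines_Skip]])
    have e: "eval (Add (neq (V 26) (V 27)) (neq (and_expr (V 26) (V 28)) (V 29))) t = 0 \<longleftrightarrow>
        \<not> (a \<noteq> a' \<or> (a \<and> b) \<noteq> c)"
      using that by (cases a; cases a'; cases b; cases c) (simp_all add: and_expr_def neq_def)
    show "?post (r \<or> (a \<noteq> a' \<or> (a \<and> b) \<noteq> c)) (t(eval (Const 22) t := eval (Const 1) t))"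
      if "eval (Add (neq (V 26) (V 27)) (neq (and_expr (V 26) (V 28)) (V 29))) t \<noteq> 0"
      using that e \<open>H u v t\<close> by (auto simp: H_def K_def intro!: frame_upd)
    show "?post (r \<or> (a \<noteq> a' \<or> (a \<and> b) \<noteq> c)) t"
      if "eval (Add (neq (V 26) (V 27)) (neq (and_expr (V 26) (V 28)) (V 29))) t = 0"
      using that e \<open>H u v t\<close> by (auto simp: H_def K_def)
  qed simp_all
  have 4: "refines (Seq (phi_to 8 29) ?If) t (?P + 3 + 1) (2 + 0)
      (bind_pmf (parity_at n ?g (and_point u v)) (\<lambda>c. return_pmf (r \<or> (a \<noteq> a' \<or> (a \<and> b) \<noteq> c)))) ?post"
    if "H u v t" "t 26 = of_bool a" "t 27 = of_bool a'" "t 28 = of_bool b" for u v t a a' b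
  proof (rule refines_Seq[OF phi 5[of u v]], goal_cases)
    case (6 c t')
    then show ?case using H[OF that(1)] by auto
  qed (use that in \<open>auto simp: H_def frame_def\<close>)
  have 3: "refines (Seq (phi_to 7 28) (Seq (phi_to 8 29) ?If)) t (?P + (?P + 3 + 1) + 1) (2 + (2 + 0))
      (bind_pmf (parity_at n ?g v) (\<lambda>b. bind_pmf (parity_at n ?g (and_point u v))
        (\<lambda>c. return_pmf (r \<or> (a \<noteq> a' \<or> (a \<and> b) \<noteq> c))))) ?post"
    if "H u v t" "t 26 = of_bool a" "t 27 = of_bool a'" for u v t a a'
  proof (rule refines_Seq[OF phi 4[of u v]], goal_cases)
    case (6 c t')
    then show ?case using H[OF that(1)] by auto
  qed (use that in \<open>auto simp: H_def frame_def\<close>)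
  have 2: "refines (Seq (phi_to 6 27) (Seq (phi_to 7 28) (Seq (phi_to 8 29) ?If))) t
      (?P + (?P + (?P + 3 + 1) + 1) + 1) (2 + (2 + (2 + 0)))
      (bind_pmf (parity_at n ?g u) (\<lambda>a'. bind_pmf (parity_at n ?g v) (\<lambda>b.
        bind_pmf (parity_at n ?g (and_point u v)) (\<lambda>c. return_pmf (r \<or> (a \<noteq> a' \<or> (a \<and> b) \<noteq> c)))))) ?post"
    if "H u v t" "t 26 = of_bool a" for u v t a
  proof (rule refines_Seq[OF phi 3[of u v]], goal_cases)
    case (6 c t')
    then show ?case using H[OF that(1)] by auto
  qed (use that in \<open>auto simp: H_def frame_def\<close>)
  let ?rest = "Seq (phi_to 6 26) (Seq (phi_to 6 27) (Seq (phi_to 7 28) (Seq (phi_to 8 29) ?If)))"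
  let ?tail = "\<lambda>u v. bind_pmf (parity_at n ?g u) (\<lambda>a. bind_pmf (parity_at n ?g u) (\<lambda>a'.
      bind_pmf (parity_at n ?g v) (\<lambda>b. bind_pmf (parity_at n ?g (and_point u v))
      (\<lambda>c. return_pmf (r \<or> (a \<noteq> a' \<or> (a \<and> b) \<noteq> c))))))"
  have 1: "refines ?rest t (?P + (?P + (?P + (?P + 3 + 1) + 1) + 1) + 1) (2 + (2 + (2 + (2 + 0)))) (?tail u v) ?post"
    if "H u v t" for u v t
  proof (rule refines_Seq[OF phi 2[of u v]], goal_cases)
    case (6 c t')
    then show ?case using H[OF that(1)] by auto
  qed (use that in \<open>auto simp: H_def\<close>)
  let ?and = "For 23 (V 0) (Assign (arr 8 (V 23)) (and_expr (Read (arr 6 (V 23))) (Read (arr 7 (V 23)))))"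
  let ?T1 = "?P + (?P + (?P + (?P + 3 + 1) + 1) + 1) + 1"
  have 0: "refines (Seq ?and ?rest) t ((n * 4 + 3) + ?T1 + 1) (0 + 8) (?tail u v) ?post"
    if "K t" "u \<in> cube n" "v \<in> cube n" "holds_point n 6 0 u t" "holds_point n 7 0 v t" for u v t
  proof (rule refines_Seq_return[OF refines_copy[where x = "and_point u v"]])
    show "t 0 = n" using that by (simp add: K_def stores_def)
    show "eval (and_expr (Read (arr 6 (V 23))) (Read (arr 7 (V 23)))) t' = of_bool (and_point u v ! i)"
      if "i < n" "frame n 23 {8} t t'" "t' 23 = i" for i t'
    proof -
      have "t' 0 = n" using that(2) \<open>t 0 = n\<close> by (simp add: frame_def)
      moreover have "t' (loc n 6 i) = of_bool (u ! i)" "t' (loc n 7 i) = of_bool (v ! i)"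
        using that \<open>holds_point n 6 0 u t\<close> \<open>holds_point n 7 0 v t\<close> by (auto simp: frame_def holds_point_def)
      ultimately show ?thesis using that \<open>u \<in> cube n\<close> \<open>v \<in> cube n\<close>
        by (subst eval_and[where a = "u ! i" and b = "v ! i"]) (auto simp: point_nth)
    qed
    show "refines ?rest t' ?T1 8 (?tail u v) ?post"
      if "holds_point n 8 0 (and_point u v) t' \<and> frame n 23 {8} t t' \<and> (\<forall>j<2 * n. t' (64 + j) = t (64 + j))" for t'
      using 1[of u v t'] that \<open>u \<in> cube n\<close> \<open>v \<in> cube n\<close> K[OF \<open>K t\<close>, of 23 "{8}" t']
        holds_point_frame[OF \<open>holds_point n 6 0 u t\<close>, of 23 "{8}" t'] holds_point_frame[OF \<open>holds_point n 7 0 v t\<close>, of 23 "{8}" t']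
      by (simp add: H_def)
  qed auto
  have Ks: "K s" using assms by (auto simp: K_def intro!: frame_refl)
  let ?T0 = "(n * 4 + 3) + ?T1 + 1"
  have b: "refines (Seq (fill 7) (Seq ?and ?rest)) t ((n * 6 + 3) + ?T0 + 1) (0 + (0 + 8))
      (bind_pmf (uniform_point n) (?tail u)) ?post"
    if "K t" "u \<in> cube n" "holds_point n 6 0 u t" for u t
  proof (rule refines_Seq[OF refines_fill 0[of _ u]], goal_cases)
    case 1
    then show ?case using that by (simp add: K_def stores_def)
  next
    case (3 v t')
    then show ?case using K[OF that(1), of 23 "{7}" t'] by simp
  next
    case (6 v t')
    then show ?case using holds_point_frame[OF that(3), of 23 "{7}" t'] by simp
  qed (use that in auto)
  have main: "refines lit_prog s ((n * 6 + 3) + ((n * 6 + 3) + ?T0 + 1) + 1) (0 + (0 + (0 + 8)))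
      (bind_pmf (uniform_point n) (\<lambda>u. bind_pmf (uniform_point n) (?tail u))) ?post"
    unfolding lit_prog_def
  proof (rule refines_Seq[OF refines_fill b], goal_cases)
    case 1
    then show ?case using st by (simp add: stores_def)
  next
    case (3 v t')
    then show ?case using K[OF Ks, of 23 "{6}" t'] by simp
  qed auto
  have eq: "bind_pmf (uniform_point n) (\<lambda>u. bind_pmf (uniform_point n) (?tail u)) =
      map_pmf (\<lambda>t. r \<or> t) (literal_test n ?g)"
    by (simp add: literal_test_def map_bind_pmf)
  show ?thesis using main unfolding eq by (rule refines_time) auto
qed


text \<open>Only the abstract component of the coupling is relabelled; program and memory stay as
  they are.\<close>

lemma refines_map:
  assumes "refines c s T Q a (\<lambda>x. R (h x))"
  shows "refines c s T Q (map_pmf h a) R"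
proof -
  obtain M where M: "\<And>q. reaches c (s, q) T (map_pmf (\<lambda>(x, s', d). (s', q + d)) M)"
    "map_pmf fst M = a" "\<And>x s' d. (x, s', d) \<in> set_pmf M \<Longrightarrow> R (h x) s' \<and> d \<le> Q"
    using assms by (rule refinesE) blast
  have 1: "map_pmf (\<lambda>(x, s', d). (s', q + d)) (map_pmf (\<lambda>(x, s', d). (h x, s', d)) M)
      = map_pmf (\<lambda>(x, s', d). (s', q + d)) M" for q
    by (simp add: pmf.map_comp o_def split_def)
  have 2: "map_pmf fst (map_pmf (\<lambda>(x, s', d). (h x, s', d)) M) = map_pmf h a"
    unfolding M(2)[symmetric] by (simp add: pmf.map_comp o_def split_def)
  show ?thesis unfolding refines_def
    by (rule exI[of _ "map_pmf (\<lambda>(x, s', d). (h x, s', d)) M"]) (use 1 2 M(1,3) in auto)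
qed

lemma refines_check_block:
  assumes st: "stores n own ws s" and l: "s 20 = l" "l < length ws" and r: "s 22 = of_bool r"
  shows "refines (For 21 (Const 1000) lit_prog) s (1000 * (16 * length ws + 100 * n + 203) + 3) 8000
     (check_block n (block_fun n f own ws l) r)
     (\<lambda>r' t. t 22 = of_bool r' \<and> frame n 21 {6, 7, 8} s t)"
proof -
  let ?I = "\<lambda>(_::nat) r t. t 22 = of_bool r \<and> frame n 21 {6, 7, 8} s t"
  have "refines (For 21 (Const 1000) lit_prog) s (1000 * ((16 * length ws + 100 * n + 200) + 3) + 3) (1000 * 8)
     (check_block n (block_fun n f own ws l) r) (?I 1000)"
    unfolding check_block_def
  proof (rule refines_For[where I = ?I], goal_cases)
    case 1
    show ?case using r by (auto intro!: frame_upd frame_refl)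
  next
    case (3 i r' t)
    then have fr: "frame n 21 {6, 7, 8} s t" by blast
    have "refines lit_prog t (16 * length ws + 100 * n + 200) 8
       (map_pmf (\<lambda>t. r' \<or> t) (literal_test n (block_fun n f own ws l)))
       (\<lambda>r' t'. t' 22 = of_bool r' \<and> t' 21 = t 21 \<and> frame n 21 {6, 7, 8} t t')"
      using 3 l stores_frame[OF st fr] frame_reg[OF fr, of 20] by (intro refines_lit_prog) auto
    then show ?case
      by (rule refines_weaken) (use 3 frame_trans[OF fr] in \<open>auto intro!: frame_upd\<close>)
  qed auto
  then show ?thesis by (rule refines_weaken) auto
qed

lemma refines_check_blocks:
  assumes st: "stores n own ws s"
  shows "refines check_blocks_prog s
     (length ws * (1000 * (16 * length ws + 100 * n + 203) + 6) + 5) (length ws * 8000)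
     (check_blocks n (block_fun n f own ws) (length ws))
     (\<lambda>r t. t 22 = of_bool r \<and> frame n 20 {6, 7, 8} s t)"
proof -
  let ?I = "\<lambda>(_::nat) r t. t 22 = of_bool r \<and> frame n 20 {6, 7, 8} s t"
  have q: "s 8 = length ws" using st by (simp add: stores_def)
  have "refines (For 20 (V 8) (For 21 (Const 1000) lit_prog)) (s(22 := 0))
     (length ws * ((1000 * (16 * length ws + 100 * n + 203) + 3) + 3) + 3) (length ws * 8000)
     (check_blocks n (block_fun n f own ws) (length ws)) (?I (length ws))"
    unfolding check_blocks_def
  proof (rule refines_For[where I = ?I], goal_cases)
    case 1
    show ?case by (auto intro!: frame_upd frame_refl)
  next
    case (2 i r t)
    then show ?case using q by (auto simp: frame_def)
  next
    case (3 i r t)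
    then have fr: "frame n 20 {6, 7, 8} s t" by blast
    have "refines (For 21 (Const 1000) lit_prog) t (1000 * (16 * length ws + 100 * n + 203) + 3) 8000
       (check_block n (block_fun n f own ws i) r)
       (\<lambda>r' t'. t' 22 = of_bool r' \<and> frame n 21 {6, 7, 8} t t')"
      using 3 stores_frame[OF st fr] by (intro refines_check_block) auto
    then show ?case
    proof (rule refines_weaken)
      fix r' t' assume *: "t' 22 = of_bool r' \<and> frame n 21 {6, 7, 8} t t'"
      then have "t' 20 = i" using 3 frame_reg[of n 21 "{6, 7, 8}" t t' 20] by simp
      moreover have "frame n 20 {6, 7, 8} s t'" using * by (auto intro: frame_trans[OF fr])
      ultimately show "t' 20 = i \<and> ?I (Suc i) r' (t'(20 := Suc i))"
        using * by (auto intro!: frame_upd)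
    qed auto
  qed auto
  then have "refines check_blocks_prog s
     ((length ws * ((1000 * (16 * length ws + 100 * n + 203) + 3) + 3) + 3) + 2) (length ws * 8000)
     (check_blocks n (block_fun n f own ws) (length ws)) (?I (length ws))"
    unfolding check_blocks_prog_def by (intro refines_Assign_Seq) simp
  then show ?thesis by (rule refines_time) auto
qed

lemma refines_read_value:
  assumes st: "stores n own ws s" and l: "s 20 = l" "l < length ws" and r: "s 22 = of_bool r"
    and x: "holds_point n 6 0 x s" "x \<in> cube n" and R: "s 6 = R"
  shows "refines read_value_prog s ((R + 1) * (4 * length ws + 20 * n + 50)) (2 * (R + 1))
     (read_value n (block_fun n f own ws l) R x r)
     (\<lambda>(r', b) t. t 22 = of_bool r' \<and> t 23 = of_bool b \<and> frame n 21 {} s t)"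
proof -
  let ?g = "block_fun n f own ws l" and ?P = "4 * length ws + 20 * n + 32"
  let ?body = "Seq (phi_to 6 24) (If (neq (V 24) (V 23)) (Assign (Const 22) (Const 1)) Skip)"
  have loop: "refines (For 21 (V 6) ?body) t (R * ((?P + 2 + 1) + 3) + 3) (R * (2 + 0))
      (map_pmf (\<lambda>r'. (r', b)) (iter_pmf R 0 (\<lambda>_ r. map_pmf (\<lambda>b'. r \<or> b' \<noteq> b) (parity_at n ?g x)) r))
      (\<lambda>(r', b) t. t 22 = of_bool r' \<and> t 23 = of_bool b \<and> frame n 21 {} s t)"
    if t: "t 23 = of_bool b \<and> frame n 23 {} s t" for b t
  proof (rule refines_map)
    let ?I = "\<lambda>(_::nat) r t. t 22 = of_bool r \<and> t 23 = of_bool b \<and> frame n 21 {} s t"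
    have fr0: "frame n 21 {} s t" using t by (auto intro: frame_mono)
    have "refines (For 21 (V 6) ?body) t (R * ((?P + 2 + 1) + 3) + 3) (R * (2 + 0))
      (iter_pmf R 0 (\<lambda>_ r. map_pmf (\<lambda>b'. r \<or> b' \<noteq> b) (parity_at n ?g x)) r) (?I R)"
    proof (rule refines_For[where I = ?I], goal_cases)
      case 1
      show ?case using t r fr0 frame_reg[of n 23 "{}" s t 22] by (auto intro!: frame_upd)
    next
      case (2 i r t)
      then show ?case using R by (auto simp: frame_def)
    next
      case (3 i r t)
      then have fr: "frame n 21 {} s t" by blast
      have "refines (phi_to 6 24) t ?P 2 (parity_at n ?g x) (\<lambda>b t'. t' 24 = of_bool b \<and> frame n 24 {} t t')"
        using stores_frame[OF st fr] frame_reg[OF fr] l holds_point_frame[OF x(1) fr] x(2)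
        by (intro refines_phi_to) auto
      then show ?case unfolding map_pmf_def
      proof (rule refines_Seq)
        fix b' t' assume *: "t' 24 = of_bool b' \<and> frame n 24 {} t t'"
        have fr': "frame n 21 {} s t'" using * by (auto intro: frame_trans[OF fr])
        have t': "t' 21 = i" "t' 22 = of_bool r" "t' 23 = of_bool b"
          using 3 * frame_reg[of n 24 "{}" t t'] by auto
        show "refines (If (neq (V 24) (V 23)) (Assign (Const 22) (Const 1)) Skip) t' 2 0
           (return_pmf (r \<or> b' \<noteq> b)) (\<lambda>x' s'. s' 21 = i \<and> ?I (Suc i) x' (s'(21 := Suc i)))"
          by (rule refines_time[OF refines_If[OF refines_Assign refines_Skip]])
            (use * fr' t' in \<open>auto intro!: frame_upd\<close>)
      qed
    qed auto
    then show "refines (For 21 (V 6) ?body) t (R * ((?P + 2 + 1) + 3) + 3) (R * (2 + 0))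
      (iter_pmf R 0 (\<lambda>_ r. map_pmf (\<lambda>b'. r \<or> b' \<noteq> b) (parity_at n ?g x)) r)
      (\<lambda>r'. (\<lambda>(r', b) t. t 22 = of_bool r' \<and> t 23 = of_bool b \<and> frame n 21 {} s t) (r', b))"
      by simp
  qed
  have "refines read_value_prog s (?P + (R * ((?P + 2 + 1) + 3) + 3) + 1) (2 + R * (2 + 0))
     (bind_pmf (parity_at n ?g x) (\<lambda>b. map_pmf (\<lambda>r'. (r', b))
        (iter_pmf R 0 (\<lambda>_ r. map_pmf (\<lambda>b'. r \<or> b' \<noteq> b) (parity_at n ?g x)) r)))
     (\<lambda>(r', b) t. t 22 = of_bool r' \<and> t 23 = of_bool b \<and> frame n 21 {} s t)"
    unfolding read_value_prog_def
    by (rule refines_Seq[OF refines_phi_to loop]) (use st l x in auto)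
  then show ?thesis unfolding read_value_def map_pmf_def[symmetric]
    by (rule refines_time) (auto simp: algebra_simps)
qed

text \<open>Rows lie one after another, the current one from the offset in register 19 on;
  preserving the cells below this offset keeps the earlier rows.\<close>

lemma refines_read_row:
  assumes st: "stores n own ws s" and r: "s 22 = of_bool r"
    and x: "holds_point n 6 0 x s" "x \<in> cube n" and R: "s 6 = R"
  shows "refines read_row_prog s (length ws * ((R + 1) * (4 * length ws + 20 * n + 50) + 6) + 3)
     (length ws * (2 * (R + 1))) (read_row n (block_fun n f own ws) (length ws) R x r)
     (\<lambda>(r', vs) t. t 22 = of_bool r' \<and> (\<forall>j<length ws. t (loc n 9 (s 19 + j)) = of_bool (vs ! j)) \<and>
        (\<forall>j<s 19. t (loc n 9 j) = s (loc n 9 j)) \<and> frame n 20 {9} s t)"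
proof -
  let ?I = "\<lambda>l (r', vs) t. length vs = l \<and> t 22 = of_bool r' \<and> (\<forall>j<l. t (loc n 9 (s 19 + j)) = of_bool (vs ! j)) \<and>
        (\<forall>j<s 19. t (loc n 9 j) = s (loc n 9 j)) \<and> frame n 20 {9} s t"
  let ?T = "(R + 1) * (4 * length ws + 20 * n + 50)"
  have "refines read_row_prog s (length ws * ((?T + 1 + 1) + 3) + 3) (length ws * (2 * (R + 1) + 0))
     (read_row n (block_fun n f own ws) (length ws) R x r) (?I (length ws))"
    unfolding read_row_prog_def read_row_def
  proof (rule refines_For[where I = ?I], goal_cases)
    case 1
    show ?case using r by (auto intro!: frame_upd frame_refl)
  next
    case (2 i p t)
    then show ?case using st by (auto simp: stores_def frame_def)
  next
    case (3 i p t)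
    obtain r' vs where p: "p = (r', vs)" by (cases p)
    have fr: "frame n 20 {9} s t" using 3 by (simp add: p)
    have rv: "refines read_value_prog t ?T (2 * (R + 1)) (read_value n (block_fun n f own ws i) R x r')
       (\<lambda>(r', b) t'. t' 22 = of_bool r' \<and> t' 23 = of_bool b \<and> frame n 21 {} t t')"
      using 3 stores_frame[OF st fr] frame_reg[OF fr] holds_point_frame[OF x(1) fr] x(2) R
      by (intro refines_read_value) (auto simp: p)
    show ?case unfolding p prod.case
    proof (rule refines_Seq[OF rv])
      fix rb t'
      assume *: "(\<lambda>(r', b) t'. t' 22 = of_bool r' \<and> t' 23 = of_bool b \<and> frame n 21 {} t t') rb t'"
      obtain r'' b where rb: "rb = (r'', b)" by (cases rb)
      from * have fr': "frame n 21 {} t t'" and t'2: "t' 22 = of_bool r''" "t' 23 = of_bool b"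
        by (simp_all add: rb)
      have t': "t' 20 = i" "t' 19 = s 19" "t' 0 = n"
        using 3 frame_reg[OF fr'] frame_reg[OF fr] st by (auto simp: stores_def)
      have l9: "t' (loc n 9 j) = t (loc n 9 j)" for j using frame_loc[OF fr'] by simp
      have "frame n 20 {9} s t'" using fr' by (auto intro: frame_trans[OF fr])
      then show "refines (Assign (arr 9 (Add (V 19) (V 20))) (V 23)) t' 1 0
         (case rb of (r', b) \<Rightarrow> return_pmf (r', vs @ [b]))
         (\<lambda>x' s'. s' 20 = i \<and> ?I (Suc i) x' (s'(20 := Suc i)))"
        unfolding rb prod.case
        by (intro refines_Assign)
          (use 3 t' t'2 l9 in \<open>auto simp: p nth_append less_Suc_eq intro!: frame_upd frame_upd_loc\<close>)
    qed
  qed auto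
  then show ?thesis by (rule refines_weaken) (auto simp: algebra_simps)
qed


lemma refines_zero_outside:
  assumes st: "stores n own ws s" and x: "\<And>j. j < n \<Longrightarrow> s (64 + j) = of_bool (x ! j)" and r: "9 \<le> r" "r < 64"
  shows "refines (zero_outside_prog r) s (n * 5 + 3) 0 (return_pmf ())
     (\<lambda>_ t. (\<forall>j<n. t (64 + j) = of_bool (x ! j)) \<and>
        (\<forall>j<n. t (64 + n + j) = of_bool (zero_outside n own x ! j)) \<and> frame n r {} s t)"
proof -
  let ?I = "\<lambda>i (_::unit) t. (\<forall>j<n. t (64 + j) = of_bool (x ! j)) \<and>
        (\<forall>j<i. t (64 + n + j) = of_bool (zero_outside n own x ! j)) \<and> frame n r {} s t"
  have "refines (zero_outside_prog r) s (n * (2 + 3) + 3) (n * 0) (iter_pmf n 0 (\<lambda>_. return_pmf) ()) (?I n)"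
    unfolding zero_outside_prog_def
  proof (rule refines_For[where I = ?I], goal_cases)
    case 1
    show ?case using x r by (auto intro!: frame_upd frame_refl)
  next
    case (2 i p t)
    then show ?case using st r by (auto simp: stores_def frame_def)
  next
    case (3 i p t)
    then have fr: "frame n r {} s t" by simp
    have t: "t 0 = n" "t (loc n 0 i) = own i"
      using frame_reg[OF fr, of 0] frame_loc[OF fr, of 0 i] st r 3 by (auto simp: stores_def)
    show ?case
      by (rule refines_time[OF refines_If[OF refines_Assign refines_Assign]])
        (use 3 t r in \<open>auto simp: less_Suc_eq intro!: frame_upd\<close>)
  qed auto
  then show ?thesis unfolding iter_pmf_constant[of 0 n "\<lambda>_. return_pmf", OF refl]
    by (rule refines_time) auto
qed

lemma store_point_simps:
  assumes "x \<in> cube n"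
  shows "j < n \<Longrightarrow> store_point 64 x s (64 + j) = of_bool (x ! j)"
    and "lo \<le> 64 \<Longrightarrow> frame n lo {} s (store_point 64 x s)"
proof -
  have "\<not> loc n a i < 64 + n" for a i using loc_ge[of n a i] by linarith
  then show "lo \<le> 64 \<Longrightarrow> frame n lo {} s (store_point 64 x s)"
    using assms by (auto simp: store_point_def frame_def)
qed (use assms in \<open>simp add: store_point_def\<close>)

lemma refines_read_table:
  assumes st: "stores n own ws s" and r: "s 22 = of_bool r" and D: "set_pmf D \<subseteq> cube n"
    and m: "s 5 = m" and R: "s 6 = R"
  shows "refines read_table_prog s
     (m * (length ws * ((R + 1) * (4 * length ws + 20 * n + 50) + 6) + 9 * n + 4 * m + 40) + 3)
     (m * (2 + length ws * (2 * (R + 1))))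
     (read_table n D (\<lambda>x. f (zero_outside n own x)) (block_fun n f own ws) (length ws) R m r)
     (\<lambda>(r', tab) t. t 22 = of_bool r' \<and> length tab = m \<and>
        (\<forall>i<m. t (loc n 10 i) = of_bool (snd (tab ! i))) \<and>
        (\<forall>i<m. \<forall>j<length ws. t (loc n 9 (i * length ws + j)) = of_bool (fst (tab ! i) ! j)) \<and>
        frame n 18 {6, 9, 10} s t)"
proof -
  let ?q = "length ws" and ?h = "\<lambda>x. f (zero_outside n own x)"
  let ?I = "\<lambda>k (r', tab) t. t 22 = of_bool r' \<and> length tab = k \<and>
        (\<forall>i<k. t (loc n 10 i) = of_bool (snd (tab ! i))) \<and>
        (\<forall>i<k. \<forall>j<?q. t (loc n 9 (i * ?q + j)) = of_bool (fst (tab ! i) ! j)) \<and>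
        frame n 18 {6, 9, 10} s t"
  let ?Trow = "?q * ((R + 1) * (4 * ?q + 20 * n + 50) + 6) + 3"
  let ?Qrow = "?q * (2 * (R + 1))"
  let ?row = "read_row n (block_fun n f own ws) ?q R"
  have s: "s 0 = n" "s 8 = ?q" using st by (simp_all add: stores_def)
  have "refines read_table_prog s
     (m * (((n * 5 + 3) + ((n * 4 + 3) + (((4 * m + 5) + ?Trow + 1) + 2 + 2) + 1) + 1 + 2) + 3) + 3)
     (m * ((0 + (0 + (0 + ?Qrow + 1))) + 1))
     (read_table n D ?h (block_fun n f own ws) ?q R m r) (?I m)"
    unfolding read_table_def read_table_prog_def
  proof (rule refines_For[where I = ?I], goal_cases)
    case 1
    show ?case using r by (auto intro!: frame_upd frame_refl)
  next
    case (2 i p t)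
    then show ?case using m by (auto simp: frame_def)
  next
    case (3 i p t)
    obtain r1 tab where p: "p = (r1, tab)" by (cases p)
    have fr: "frame n 18 {6, 9, 10} s t" using 3 by (simp add: p)
    let ?post = "\<lambda>x' s'. s' 18 = i \<and> ?I (Suc i) x' (s'(18 := Suc i))"
    show ?case unfolding p prod.case
    proof (rule refines_Sample_Seq)
      fix x assume "x \<in> set_pmf D"
      then have x: "x \<in> cube n" using D by blast
      let ?t1 = "store_point 64 x t"
      let ?abs = "bind_pmf (?row x r1) (\<lambda>(r', vs). return_pmf (r', tab @ [(vs, ?h x)]))"
      have fr1: "frame n 23 {} t ?t1" using store_point_simps(2)[OF x] by simp
      have last: "refines (Seq (mul 19 23 (V 18) (V 8)) read_row_prog) t4 ((4 * m + 5) + ?Trow + 1) (0 + ?Qrow) ?abs ?post"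
        if fr4: "frame n 23 {6, 10} t t4" and h4: "holds_point n 6 0 x t4"
          and l4: "\<And>j. t4 (loc n 10 j) = (if j = i then of_bool (?h x) else t (loc n 10 j))" for t4
      proof (rule refines_Seq_return)
        let ?t5 = "t4(19 := i * ?q, 23 := i)"
        have t4: "t4 18 = i" "t4 8 = ?q" "t4 22 = of_bool r1"
          using frame_reg[OF fr4] frame_reg[OF fr] 3 s by (auto simp: p)
        show "refines (mul 19 23 (V 18) (V 8)) t4 (4 * m + 5) 0 (return_pmf ()) (\<lambda>_ t. t = ?t5)"
          by (rule refines_time[OF refines_mul]) (use t4 3 in auto)
        fix t5 assume "t5 = ?t5"
        have fr5': "frame n 19 {} t4 t5" unfolding \<open>t5 = ?t5\<close> by (intro frame_upd frame_refl) auto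
        have fr5: "frame n 18 {6, 9, 10} s t5"
          using frame_trans[OF frame_trans[OF fr fr4] fr5'] by auto
        have t5: "t5 19 = i * ?q" "t5 22 = of_bool r1" "t5 18 = i"
          using t4 by (simp_all add: \<open>t5 = ?t5\<close>)
        have l9: "t5 (loc n 9 j) = t (loc n 9 j)" for j
          using frame_loc[OF fr5', of 9] frame_loc[OF fr4, of 9] by simp
        have l10: "t5 (loc n 10 j) = (if j = i then of_bool (?h x) else t (loc n 10 j))" for j
          using frame_loc[OF fr5', of 10] l4 by simp
        have row: "refines read_row_prog t5 ?Trow ?Qrow (?row x r1)
          (\<lambda>(r', vs) t. t 22 = of_bool r' \<and> (\<forall>j<?q. t (loc n 9 (t5 19 + j)) = of_bool (vs ! j)) \<and>
            (\<forall>j<t5 19. t (loc n 9 j) = t5 (loc n 9 j)) \<and> frame n 20 {9} t5 t)"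
          using stores_frame[OF st fr5] holds_point_frame[OF h4 fr5'] t5 x frame_reg[OF fr5, of 6] R
          by (intro refines_read_row) auto
        have post: "?post (r', tab @ [(vs, ?h x)]) t6"
          if "t6 22 = of_bool r'" "\<forall>j<?q. t6 (loc n 9 (t5 19 + j)) = of_bool (vs ! j)"
            "\<forall>j<t5 19. t6 (loc n 9 j) = t5 (loc n 9 j)" "frame n 20 {9} t5 t6" for r' vs t6
        proof -
          have "t6 18 = i" using frame_reg[OF that(4), of 18] t5 by simp
          moreover have "frame n 18 {6, 9, 10} s t6" using frame_trans[OF fr5 that(4)] by auto
          moreover have "t6 (loc n 10 j) = of_bool (snd ((tab @ [(vs, ?h x)]) ! j))" if "j < Suc i" for j
            using frame_loc[OF \<open>frame n 20 {9} t5 t6\<close>, of 10 j] l10[of j] that 3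
            by (auto simp: p nth_append less_Suc_eq)
          moreover have "t6 (loc n 9 (k * ?q + j)) = of_bool (fst ((tab @ [(vs, ?h x)]) ! k) ! j)"
            if "k < Suc i" "j < ?q" for k j
          proof (cases "k = i")
            case True
            then show ?thesis using \<open>\<forall>j<?q. t6 (loc n 9 (t5 19 + j)) = of_bool (vs ! j)\<close> that t5(1) 3
              by (auto simp: p nth_append)
          next
            case False
            then have "k < i" using that by simp
            \<comment> \<open>Row \<open>k\<close> ends before row \<open>i\<close> begins, so its
              cells lie in the preserved range.\<close>
            then have "Suc k * ?q \<le> i * ?q" by (intro mult_le_mono) auto
            then have "k * ?q + j < t5 19" using that t5(1) by simp
            then show ?thesis
              using \<open>\<forall>j<t5 19. t6 (loc n 9 j) = t5 (loc n 9 j)\<close> l9 3 \<open>k < i\<close> that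
              by (auto simp: p nth_append)
          qed
          ultimately show ?thesis using that(1) 3 by (auto simp: p intro!: frame_upd)
        qed
        have "refines read_row_prog t5 ?Trow ?Qrow (?row x r1)
            (\<lambda>rv. ?post ((\<lambda>(r', vs). (r', tab @ [(vs, ?h x)])) rv))"
        proof (rule refines_weaken[OF row])
          fix rv t6
          assume a: "(\<lambda>(r', vs) t. t 22 = of_bool r' \<and> (\<forall>j<?q. t (loc n 9 (t5 19 + j)) = of_bool (vs ! j)) \<and>
            (\<forall>j<t5 19. t (loc n 9 j) = t5 (loc n 9 j)) \<and> frame n 20 {9} t5 t) rv t6"
          obtain r' vs where rv: "rv = (r', vs)" by (cases rv)
          show "?post ((\<lambda>(r', vs). (r', tab @ [(vs, ?h x)])) rv) t6"
            unfolding rv prod.case[of _ r' vs] by (rule post) (use a[unfolded rv prod.case] in blast)+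
        qed simp_all
        from refines_map[where h = "\<lambda>(r', vs). (r', tab @ [(vs, ?h x)])" and R = ?post, OF this]
        have "refines read_row_prog t5 ?Trow ?Qrow
            (map_pmf (\<lambda>(r', vs). (r', tab @ [(vs, ?h x)])) (?row x r1)) ?post" .
        then show "refines read_row_prog t5 ?Trow ?Qrow ?abs ?post"
          by (simp add: map_pmf_def split_def)
      qed
      have "refines (Seq (zero_outside_prog 23) (Seq
         (For 23 (V 0) (Assign (arr 6 (V 23)) (Read (buf0 (V 23))))) (Seq
         (Query (Const 23) (buf1 (Const 0))) (Seq
         (Assign (arr 10 (V 18)) (V 23)) (Seq
         (mul 19 23 (V 18) (V 8)) read_row_prog))))) ?t1
         ((n * 5 + 3) + ((n * 4 + 3) + (((4 * m + 5) + ?Trow + 1) + 2 + 2) + 1) + 1) (0 + (0 + (0 + ?Qrow + 1)))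
         ?abs ?post"
      proof (rule refines_Seq_return[OF refines_zero_outside[where x = x and own = own and ws = ws]], goal_cases)
        case 1
        show ?case using stores_frame[OF stores_frame[OF st fr] fr1] by auto
      next
        case (2 j)
        then show ?case using store_point_simps(1)[OF x] by simp
      next
        case (5 t2)
        then have fr2: "frame n 23 {} t t2" using frame_trans[OF fr1] by auto
        have t20: "t2 0 = n" using frame_reg[OF fr2, of 0] frame_reg[OF fr, of 0] s by simp
        show ?case
        proof (rule refines_Seq_return[OF refines_copy[where x = x]], goal_cases)
          case (5 j t')
          then show ?case using \<open>(\<forall>j<n. t2 (64 + j) = of_bool (x ! j)) \<and> _\<close> by simp
        next
          case (6 t3)
          then have fr3': "frame n 23 {6} t2 t3" and h3: "holds_point n 6 0 x t3"
            and b3: "\<And>j. j < 2 * n \<Longrightarrow> t3 (64 + j) = t2 (64 + j)" by auto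
          have fr3: "frame n 23 {6} t t3" using frame_trans[OF frame_mono[OF fr2] fr3'] by auto
          have t3: "t3 0 = n" "t3 18 = i" using frame_reg[OF fr3] frame_reg[OF fr] s 3 by auto
          have q: "load_point n (64 + n) t3 = zero_outside n own x"
          proof (rule load_point_eqI)
            fix j assume "j < n"
            then show "t3 (64 + n + j) = of_bool (zero_outside n own x ! j)"
              using b3[of "n + j"] 5 by (simp add: add.assoc)
          qed simp
          let ?t4 = "t3(23 := of_bool (?h x), loc n 10 i := of_bool (?h x))"
          have fr4: "frame n 23 {6, 10} t ?t4"
            by (intro frame_upd frame_upd_loc frame_mono[OF fr3]) auto
          have h4: "holds_point n 6 0 x ?t4" using h3 by (auto simp: holds_point_def loc_eq_iff)
          have l4: "?t4 (loc n 10 j) = (if j = i then of_bool (?h x) else t (loc n 10 j))" for j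
            using frame_loc[OF fr3, of 10] by auto
          show ?case
          proof (rule refines_Query_Seq[OF refines_Assign_Seq])
            let ?t' = "t3(eval (Const 23) t3 := of_bool (f (load_point n (eval (buf1 (Const 0)) t3) t3)))"
            have "?t'(eval (arr 10 (V 18)) ?t' := eval (V 23) ?t') = ?t4"
              using t3 q by simp
            then show "refines (Seq (mul 19 23 (V 18) (V 8)) read_row_prog)
              (?t'(eval (arr 10 (V 18)) ?t' := eval (V 23) ?t')) ((4 * m + 5) + ?Trow + 1) (0 + ?Qrow) ?abs ?post"
              using last[OF fr4 h4 l4] by (simp only:)
          qed
        qed (use t20 in auto)
      qed auto
      then show "refines (Seq (zero_outside_prog 23) (Seq
         (For 23 (V 0) (Assign (arr 6 (V 23)) (Read (buf0 (V 23))))) (Seq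
         (Query (Const 23) (buf1 (Const 0))) (Seq
         (Assign (arr 10 (V 18)) (V 23)) (Seq
         (mul 19 23 (V 18) (V 8)) read_row_prog))))) (store_point (eval (Const 64) t) x t)
         ((n * 5 + 3) + ((n * 4 + 3) + (((4 * m + 5) + ?Trow + 1) + 2 + 2) + 1) + 1) (0 + (0 + (0 + ?Qrow + 1)))
         ?abs ?post" by simp
    qed
  qed auto
  then show ?thesis by (rule refines_weaken) (auto simp: algebra_simps)
qed

end

subsection \<open>Program for the greedy fit\<close>

text \<open>Registers 13 and 14 record whether the labels True and False occur among the rows
  selected by \<open>c\<close>; both are set exactly if the selection is not monochromatic. Register
  15 holds the offset of the current row for use in \<open>c\<close>.\<close>

definition scan :: "expr \<Rightarrow> cmd" where
  "scan c = Seq (Assign (Const 13) (Const 0)) (Seq (Assign (Const 14) (Const 0))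
     (For 12 (V 5) (Seq (mul 15 16 (V 12) (V 8))
       (If c (If (Read (arr 10 (V 12))) (Assign (Const 13) (Const 1)) (Assign (Const 14) (Const 1))) Skip))))"

definition literal_cond :: "bool \<Rightarrow> expr" where
  "literal_cond \<xi> = eqe (Read (arr 9 (Add (V 15) (V 11)))) (Const (of_bool \<xi>))"

text \<open>The clearing loop tests only the literal: resetting a row that is already dead changes
  nothing.\<close>

definition kill_prog :: "bool \<Rightarrow> cmd" where
  "kill_prog \<xi> = Seq (scan (and_expr (Read (arr 11 (V 12))) (literal_cond \<xi>)))
     (If (and_expr (V 13) (V 14)) Skip
       (For 12 (V 5) (Seq (mul 15 16 (V 12) (V 8))
         (If (literal_cond \<xi>) (Assign (arr 11 (V 12)) (Const 0)) Skip))))"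

definition fit_prog :: cmd where
  "fit_prog = Seq (For 12 (V 5) (Assign (arr 11 (V 12)) (Const 1)))
     (Seq (For 10 (V 1) (For 11 (V 8) (Seq (kill_prog False) (kill_prog True))))
       (scan (Read (arr 11 (V 12)))))"

definition tabled :: "nat \<Rightarrow> nat \<Rightarrow> (bool list \<times> bool) list \<Rightarrow> memory \<Rightarrow> bool" where
  "tabled n q tab s \<longleftrightarrow> s 0 = n \<and> s 5 = length tab \<and> s 8 = q \<and>
     (\<forall>i<length tab. s (loc n 10 i) = of_bool (snd (tab ! i))) \<and>
     (\<forall>i<length tab. \<forall>j<q. s (loc n 9 (i * q + j)) = of_bool (fst (tab ! i) ! j))"

lemma tabled_frame:
  "tabled n q tab s \<Longrightarrow> frame n lo X s t \<Longrightarrow> 9 \<notin> X \<Longrightarrow> 10 \<notin> X \<Longrightarrow> 9 \<le> lo \<Longrightarrow> tabled n q tab t"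
  by (simp add: tabled_def frame_def)

definition alive :: "nat \<Rightarrow> nat \<Rightarrow> nat set \<Rightarrow> memory \<Rightarrow> bool" where
  "alive n m A s \<longleftrightarrow> (\<forall>i<m. s (loc n 11 i) = of_bool (i \<in> A))"

lemma alive_frame: "alive n m A s \<Longrightarrow> frame n lo X s t \<Longrightarrow> 11 \<notin> X \<Longrightarrow> alive n m A t"
  by (simp add: alive_def frame_def)

context oracles begin

lemma refines_scan:
  assumes tab: "tabled n q tab s" and S: "S \<subseteq> {..<length tab}"
    and c: "\<And>i t. i < length tab \<Longrightarrow> frame n 12 {} s t \<Longrightarrow> t 12 = i \<Longrightarrow> t 15 = i * q \<Longrightarrow> eval c t \<noteq> 0 \<longleftrightarrow> i \<in> S"
  shows "refines (scan c) s (length tab * (4 * length tab + 12) + 7) 0 (return_pmf ())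
     (\<lambda>_ t. t 13 = of_bool (\<exists>i\<in>S. snd (tab ! i)) \<and> t 14 = of_bool (\<exists>i\<in>S. \<not> snd (tab ! i)) \<and> frame n 12 {} s t)"
proof -
  let ?m = "length tab"
  let ?I = "\<lambda>i (_::unit) t. t 13 = of_bool (\<exists>j\<in>S. j < i \<and> snd (tab ! j)) \<and>
     t 14 = of_bool (\<exists>j\<in>S. j < i \<and> \<not> snd (tab ! j)) \<and> frame n 12 {} s t"
  note tab' = tab[unfolded tabled_def]
  have "refines (For 12 (V 5) (Seq (mul 15 16 (V 12) (V 8))
       (If c (If (Read (arr 10 (V 12))) (Assign (Const 13) (Const 1)) (Assign (Const 14) (Const 1))) Skip)))
     (s(13 := 0, 14 := 0)) (?m * (((4 * ?m + 5) + 3 + 1) + 3) + 3) (?m * (0 + 0))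
     (iter_pmf ?m 0 (\<lambda>_. return_pmf) ()) (?I ?m)"
  proof (rule refines_For[where I = ?I], goal_cases)
    case 1
    show ?case by (auto intro!: frame_upd frame_refl)
  next
    case (2 i p t)
    then show ?case using tab' by (auto simp: frame_def)
  next
    case (3 i p t)
    then have fr: "frame n 12 {} s t" by blast
    let ?t1 = "t(15 := i * q, 16 := i)"
    have t: "t 12 = i" "t 8 = q" "t 0 = n" using 3 frame_reg[OF fr] tab' by auto
    show ?case
    proof (rule refines_Seq_return)
      show "refines (mul 15 16 (V 12) (V 8)) t (4 * ?m + 5) 0 (return_pmf ()) (\<lambda>_ t'. t' = ?t1)"
        by (rule refines_time[OF refines_mul]) (use t 3 in auto)
      fix t1 assume t1: "t1 = ?t1"
      have fr1: "frame n 12 {} s t1" unfolding t1 by (intro frame_upd fr) auto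
      have cond: "eval c t1 \<noteq> 0 \<longleftrightarrow> i \<in> S" by (rule c) (use 3 t fr1 t1 in auto)
      have lab: "t1 (loc n 10 i) = of_bool (snd (tab ! i))"
        using frame_loc[OF fr1, of 10] tab' 3 by auto
      have t1': "t1 12 = i" "t1 0 = n" "t1 13 = t 13" "t1 14 = t 14" using t by (simp_all add: t1)
      show "refines (If c (If (Read (arr 10 (V 12))) (Assign (Const 13) (Const 1)) (Assign (Const 14) (Const 1))) Skip)
         t1 3 0 (return_pmf p) (\<lambda>x' s'. s' 12 = i \<and> ?I (Suc i) x' (s'(12 := Suc i)))"
      proof (rule refines_time[OF refines_If[OF refines_If[OF refines_Assign refines_Assign] refines_Skip]], goal_cases)
        case 1
        then have "i \<in> S" "snd (tab ! i)" using cond lab t1' by auto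
        then show ?case using 3 fr1 t1' by (auto simp: less_Suc_eq intro!: frame_upd)
      next
        case 2
        then have "i \<in> S" "\<not> snd (tab ! i)" using cond lab t1' by auto
        then show ?case using 3 fr1 t1' by (auto simp: less_Suc_eq intro!: frame_upd)
      next
        case 3
        then have "i \<notin> S" using cond by simp
        then have "(\<exists>j\<in>S. j < Suc i \<and> P j) \<longleftrightarrow> (\<exists>j\<in>S. j < i \<and> P j)" for P
          using less_Suc_eq by auto
        then show ?case using \<open>?I i p t\<close> fr1 t1' by (auto intro!: frame_upd)
      qed simp_all
    qed
  next
    case (4 p t)
    show ?case using 4(1) .
  qed
  then have "refines (scan c) s ((?m * (((4 * ?m + 5) + 3 + 1) + 3) + 3) + 2 + 2) (?m * (0 + 0))
     (iter_pmf ?m 0 (\<lambda>_. return_pmf) ()) (?I ?m)"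
    unfolding scan_def by (intro refines_Assign_Seq) simp
  moreover have "(\<exists>j\<in>S. j < ?m \<and> P j) \<longleftrightarrow> (\<exists>j\<in>S. P j)" for P using S by auto
  ultimately show ?thesis unfolding iter_pmf_constant[of 0 ?m "\<lambda>_. return_pmf", OF refl]
    by (elim refines_weaken) auto
qed

lemma eval_literal_cond:
  assumes "tabled n q tab s" "frame n lo X s t" "9 \<notin> X" "0 < lo" "i < length tab" "t 15 = i * q" "t 11 = l" "l < q"
  shows "eval (literal_cond \<xi>) t = of_bool (fst (tab ! i) ! l = \<xi>)"
proof -
  have "t 0 = n" "t (loc n 9 (i * q + l)) = of_bool (fst (tab ! i) ! l)"
    using assms by (auto simp: frame_def tabled_def)
  then show ?thesis using assms(6,7) by (auto simp: literal_cond_def)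
qed

lemma refines_kill:
  assumes tab: "tabled n q tab s" and A: "A \<subseteq> {..<length tab}" "alive n (length tab) A s"
    and l: "s 11 = l" "l < q"
  shows "refines (kill_prog \<xi>) s (length tab * (8 * length tab + 30) + 20) 0 (return_pmf ())
     (\<lambda>_ t. alive n (length tab) (kill tab l \<xi> A) t \<and> frame n 12 {11} s t)"
proof -
  let ?m = "length tab"
  let ?S = "{i\<in>A. fst (tab ! i) ! l = \<xi>}"
  let ?post = "\<lambda>(_::unit) t. alive n ?m (kill tab l \<xi> A) t \<and> frame n 12 {11} s t"
  let ?loop = "For 12 (V 5) (Seq (mul 15 16 (V 12) (V 8))
         (If (literal_cond \<xi>) (Assign (arr 11 (V 12)) (Const 0)) Skip))"
  have scan: "refines (scan (and_expr (Read (arr 11 (V 12))) (literal_cond \<xi>))) s (?m * (4 * ?m + 12) + 7) 0 (return_pmf ())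
     (\<lambda>_ t. t 13 = of_bool (\<exists>i\<in>?S. snd (tab ! i)) \<and> t 14 = of_bool (\<exists>i\<in>?S. \<not> snd (tab ! i)) \<and> frame n 12 {} s t)"
  proof (rule refines_scan[OF tab])
    fix i t assume i: "i < ?m" and fr: "frame n 12 {} s t" and t: "t 12 = i" "t 15 = i * q"
    have "t 0 = n" using frame_reg[OF fr] tab by (simp add: tabled_def)
    moreover have "t (loc n 11 i) = of_bool (i \<in> A)"
      using frame_loc[OF fr, of 11] A(2) i by (simp add: alive_def)
    moreover have "eval (literal_cond \<xi>) t = of_bool (fst (tab ! i) ! l = \<xi>)"
      using eval_literal_cond[OF tab fr] i t l frame_reg[OF fr, of 11] by auto
    ultimately show "eval (and_expr (Read (arr 11 (V 12))) (literal_cond \<xi>)) t \<noteq> 0 \<longleftrightarrow> i \<in> ?S"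
      using t by (subst eval_and[where a = "i \<in> A" and b = "fst (tab ! i) ! l = \<xi>"]) auto
  qed (use A in auto)
  have loop: "refines ?loop t0 (?m * (((4 * ?m + 5) + 2 + 1) + 3) + 3) (?m * (0 + 0))
     (iter_pmf ?m 0 (\<lambda>_. return_pmf) ()) (\<lambda>_ t. alive n ?m (A - ?S) t \<and> frame n 12 {11} s t)"
    if fr0: "frame n 12 {} s t0" for t0
  proof (rule refines_For[where I = "\<lambda>i (_::unit) t. (\<forall>j<?m. t (loc n 11 j) = of_bool (j \<in> A \<and> \<not> (j < i \<and> j \<in> ?S))) \<and>
      frame n 12 {11} s t"], goal_cases)
    case 1
    have "t0 (loc n 11 j) = of_bool (j \<in> A)" if "j < ?m" for j
      using frame_loc[OF fr0, of 11] A(2) that by (simp add: alive_def)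
    then show ?case using frame_mono[OF fr0, of 12 "{11}"] by (auto intro!: frame_upd)
  next
    case (2 i p t)
    then show ?case using tab by (auto simp: tabled_def frame_def)
  next
    case (3 i p t)
    then have fr: "frame n 12 {11} s t" by blast
    let ?t1 = "t(15 := i * q, 16 := i)"
    have t: "t 12 = i" "t 8 = q" "t 0 = n" "t 11 = l"
      using 3 frame_reg[OF fr] tab l by (auto simp: tabled_def)
    show ?case
    proof (rule refines_Seq_return)
      show "refines (mul 15 16 (V 12) (V 8)) t (4 * ?m + 5) 0 (return_pmf ()) (\<lambda>_ t'. t' = ?t1)"
        by (rule refines_time[OF refines_mul]) (use t 3 in auto)
      fix t1 assume t1: "t1 = ?t1"
      have fr1: "frame n 12 {11} s t1" unfolding t1 by (intro frame_upd fr) auto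
      have cond: "eval (literal_cond \<xi>) t1 = of_bool (fst (tab ! i) ! l = \<xi>)"
        using eval_literal_cond[OF tab fr1, of i l \<xi>] 3 t l by (auto simp: t1)
      have t1': "t1 12 = i" "t1 0 = n" "t1 (loc n 11 j) = t (loc n 11 j)" for j
        using t by (simp_all add: t1)
      show "refines (If (literal_cond \<xi>) (Assign (arr 11 (V 12)) (Const 0)) Skip) t1 2 0 (return_pmf p)
         (\<lambda>x' s'. s' 12 = i \<and> ((\<forall>j<?m. (s'(12 := Suc i)) (loc n 11 j) = of_bool (j \<in> A \<and> \<not> (j < Suc i \<and> j \<in> ?S))) \<and>
           frame n 12 {11} s (s'(12 := Suc i))))"
      proof (rule refines_time[OF refines_If[OF refines_Assign refines_Skip]], goal_cases)
        case 1
        then show ?case using 3 cond fr1 t1'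
          by (auto simp: less_Suc_eq intro!: frame_upd frame_upd_loc)
      next
        case 2
        then show ?case using 3 cond fr1 t1'
          by (auto simp: less_Suc_eq intro!: frame_upd)
      qed simp_all
    qed
  next
    case (4 p t)
    then show ?case by (auto simp: alive_def)
  qed
  have "refines (kill_prog \<xi>) s ((?m * (4 * ?m + 12) + 7) +
      (max 1 (?m * (((4 * ?m + 5) + 2 + 1) + 3) + 3) + 1) + 1) (0 + max 0 (?m * (0 + 0))) (return_pmf ()) ?post"
    unfolding kill_prog_def
  proof (rule refines_Seq_return[OF scan refines_If])
    fix t
    assume t: "t 13 = of_bool (\<exists>i\<in>?S. snd (tab ! i)) \<and> t 14 = of_bool (\<exists>i\<in>?S. \<not> snd (tab ! i)) \<and> frame n 12 {} s t"
    have e: "eval (and_expr (V 13) (V 14)) t = of_bool (\<not> monochromatic tab ?S)"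
      using t by (subst eval_and[where a = "\<exists>i\<in>?S. snd (tab ! i)" and b = "\<exists>i\<in>?S. \<not> snd (tab ! i)"])
        (auto simp: monochromatic_def)
    have fr: "frame n 12 {11} s t" using t by (auto elim: frame_mono)
    show "refines Skip t 1 0 (return_pmf ()) ?post" if "eval (and_expr (V 13) (V 14)) t \<noteq> 0"
      using that e fr alive_frame[OF A(2), of 12 "{}" t] t
      by (intro refines_Skip) (auto simp: kill_def)
    show "refines ?loop t (?m * (((4 * ?m + 5) + 2 + 1) + 3) + 3) (?m * (0 + 0)) (return_pmf ()) ?post"
      if "eval (and_expr (V 13) (V 14)) t = 0"
    proof (rule refines_weaken[OF loop[unfolded iter_pmf_constant[of 0 ?m "\<lambda>_. return_pmf", OF refl]]])
      show "frame n 12 {} s t" using t by blast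
    qed (use that e in \<open>auto simp: kill_def\<close>)
  qed
  then show ?thesis by (rule refines_time) (auto simp: algebra_simps)
qed

lemma refines_sweep:
  assumes tab: "tabled n q tab s" and A: "A \<subseteq> {..<length tab}" "alive n (length tab) A s"
  shows "refines (For 11 (V 8) (Seq (kill_prog False) (kill_prog True))) s
     (q * (length tab * (16 * length tab + 60) + 50) + 3) 0 (return_pmf ())
     (\<lambda>_ t. alive n (length tab) (sweep tab q A) t \<and> frame n 11 {11} s t)"
proof -
  let ?m = "length tab" and ?T = "length tab * (8 * length tab + 30) + 20"
  let ?I = "\<lambda>l (_::unit) t. alive n ?m (sweep tab l A) t \<and> frame n 11 {11} s t"
  have "refines (For 11 (V 8) (Seq (kill_prog False) (kill_prog True))) s (q * ((?T + ?T + 1) + 3) + 3) (q * (0 + 0))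
     (iter_pmf q 0 (\<lambda>_. return_pmf) ()) (?I q)"
  proof (rule refines_For[where I = ?I], goal_cases)
    case 1
    show ?case using A by (auto simp: alive_def intro!: frame_upd frame_refl)
  next
    case (2 i p t)
    then show ?case using tab by (auto simp: tabled_def frame_def)
  next
    case (3 l p t)
    then have fr: "frame n 11 {11} s t" by blast
    let ?A = "sweep tab l A"
    have sub: "?A \<subseteq> {..<?m}" "kill tab l False ?A \<subseteq> {..<?m}"
      using A(1) sweep_subset kill_subset by blast+
    show ?case
    proof (rule refines_Seq_return[OF refines_kill])
      show "tabled n q tab t" using tabled_frame[OF tab fr] by simp
      fix t1 assume t1: "alive n ?m (kill tab l False ?A) t1 \<and> frame n 12 {11} t t1"
      have fr1: "frame n 11 {11} s t1" using frame_trans[OF fr, of 12 "{11}" t1] t1 by simp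
      have "refines (kill_prog True) t1 ?T 0 (return_pmf ())
         (\<lambda>_ t. alive n ?m (kill tab l True (kill tab l False ?A)) t \<and> frame n 12 {11} t1 t)"
        using 3 t1 tabled_frame[OF tab fr1] sub frame_reg[of n 12 "{11}" t t1 11] by (intro refines_kill) auto
      then show "refines (kill_prog True) t1 ?T 0 (return_pmf p) (\<lambda>x' s'. s' 11 = l \<and> ?I (Suc l) x' (s'(11 := Suc l)))"
      proof (simp, elim refines_weaken)
        fix t2 assume t2: "alive n ?m (kill tab l True (kill tab l False ?A)) t2 \<and> frame n 12 {11} t1 t2"
        have "t2 11 = l" using 3 t1 t2 frame_reg[of n 12 "{11}" t t1 11] frame_reg[of n 12 "{11}" t1 t2 11] by simp
        moreover have "frame n 11 {11} s t2" using frame_trans[OF fr1, of 12 "{11}" t2] t2 by simp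
        ultimately show "t2 11 = l \<and> alive n ?m (kill tab l True (kill tab l False ?A)) (t2(11 := Suc l)) \<and>
            frame n 11 {11} s (t2(11 := Suc l))"
          using t2 by (auto simp: alive_def intro!: frame_upd)
      qed auto
    qed (use 3 sub in auto)
  qed auto
  then show ?thesis unfolding iter_pmf_constant[of 0 q "\<lambda>_. return_pmf", OF refl]
    by (rule refines_time) (auto simp: algebra_simps)
qed

lemma refines_fit:
  assumes tab: "tabled n q tab s" and k: "s 1 = k"
  shows "refines fit_prog s (k * (q * (length tab * (16 * length tab + 60) + 50) + 6) + length tab * (4 * length tab + 20) + 20) 0
     (return_pmf ()) (\<lambda>_ t. (t 13 \<noteq> 0 \<and> t 14 \<noteq> 0 \<longleftrightarrow> \<not> greedy_fit tab q k) \<and> frame n 10 {11} s t)"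
proof -
  let ?m = "length tab"
  let ?surv = "survivors tab q"
  have sub: "?surv j \<subseteq> {..<?m}" for j
    unfolding survivors_def by (induction j) (auto dest: subsetD[OF sweep_subset])
  have init: "refines (For 12 (V 5) (Assign (arr 11 (V 12)) (Const 1))) s (?m * (1 + 3) + 3) (?m * 0)
     (iter_pmf ?m 0 (\<lambda>_. return_pmf) ()) (\<lambda>_ t. alive n ?m (?surv 0) t \<and> frame n 10 {11} s t)"
  proof (rule refines_For[where I = "\<lambda>i (_::unit) t. (\<forall>j<i. t (loc n 11 j) = 1) \<and> frame n 10 {11} s t"], goal_cases)
    case 1
    show ?case by (auto intro!: frame_upd frame_refl)
  next
    case (2 i p t)
    then show ?case using tab by (auto simp: tabled_def frame_def)
  next
    case (3 i p t)
    then have "t 0 = n" using tab by (auto simp: tabled_def frame_def)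
    then show ?case using 3 by (intro refines_Assign) (auto simp: less_Suc_eq intro!: frame_upd frame_upd_loc)
  qed (auto simp: alive_def survivors_def)
  let ?Ts = "q * (?m * (16 * ?m + 60) + 50) + 3"
  have rounds: "refines (For 10 (V 1) (For 11 (V 8) (Seq (kill_prog False) (kill_prog True)))) t0 (k * (?Ts + 3) + 3) (k * 0)
     (iter_pmf k 0 (\<lambda>_. return_pmf) ()) (\<lambda>_ t. alive n ?m (?surv k) t \<and> frame n 10 {11} s t)"
    if t0: "alive n ?m (?surv 0) t0 \<and> frame n 10 {11} s t0" for t0
  proof (rule refines_For[where I = "\<lambda>i (_::unit) t. alive n ?m (?surv i) t \<and> frame n 10 {11} s t"], goal_cases)
    case 1
    show ?case using t0 by (auto simp: alive_def intro!: frame_upd)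
  next
    case (2 i p t)
    then show ?case using k by (auto simp: frame_def)
  next
    case (3 i p t)
    then have fr: "frame n 10 {11} s t" by blast
    have "refines (For 11 (V 8) (Seq (kill_prog False) (kill_prog True))) t ?Ts 0 (return_pmf ())
       (\<lambda>_ t'. alive n ?m (sweep tab q (?surv i)) t' \<and> frame n 11 {11} t t')"
      using 3 tabled_frame[OF tab fr] sub by (intro refines_sweep) auto
    then show ?case
    proof (simp, elim refines_weaken)
      fix t' assume t': "alive n ?m (sweep tab q (?surv i)) t' \<and> frame n 11 {11} t t'"
      have "sweep tab q (?surv i) = ?surv (Suc i)" by (simp add: survivors_def)
      moreover have "t' 10 = i" using 3 t' frame_reg[of n 11 "{11}" t t' 10] by simp
      moreover have "frame n 10 {11} s t'" using frame_trans[OF fr, of 11 "{11}" t'] t' by simp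
      ultimately show "t' 10 = i \<and> alive n ?m (?surv (Suc i)) (t'(10 := Suc i)) \<and> frame n 10 {11} s (t'(10 := Suc i))"
        using t' by (auto simp: alive_def intro!: frame_upd)
    qed auto
  qed auto
  have last: "refines (scan (Read (arr 11 (V 12)))) t0 (?m * (4 * ?m + 12) + 7) 0 (return_pmf ())
     (\<lambda>_ t. (t 13 \<noteq> 0 \<and> t 14 \<noteq> 0 \<longleftrightarrow> \<not> greedy_fit tab q k) \<and> frame n 10 {11} s t)"
    if t0: "alive n ?m (?surv k) t0 \<and> frame n 10 {11} s t0" for t0
  proof (rule refines_weaken[OF refines_scan[where S = "?surv k"]])
    show "tabled n q tab t0" using tabled_frame[OF tab] t0 by auto
    show "eval (Read (arr 11 (V 12))) t \<noteq> 0 \<longleftrightarrow> i \<in> ?surv k"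
      if "i < ?m" "frame n 12 {} t0 t" "t 12 = i" for i t
      using that t0 tab by (auto simp: frame_def alive_def tabled_def)
    fix t assume "t 13 = of_bool (\<exists>i\<in>?surv k. snd (tab ! i)) \<and> t 14 = of_bool (\<exists>i\<in>?surv k. \<not> snd (tab ! i)) \<and> frame n 12 {} t0 t"
    then show "(t 13 \<noteq> 0 \<and> t 14 \<noteq> 0 \<longleftrightarrow> \<not> greedy_fit tab q k) \<and> frame n 10 {11} s t"
      using frame_trans[of n 10 "{11}" s t0 12 "{}" t] t0 by (auto simp: greedy_fit_def monochromatic_def)
  qed (use sub in auto)
  have "refines fit_prog s ((?m * (1 + 3) + 3) + ((k * (?Ts + 3) + 3) + (?m * (4 * ?m + 12) + 7) + 1) + 1)
     (?m * 0 + (k * 0 + 0)) (return_pmf ())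
     (\<lambda>_ t. (t 13 \<noteq> 0 \<and> t 14 \<noteq> 0 \<longleftrightarrow> \<not> greedy_fit tab q k) \<and> frame n 10 {11} s t)"
    unfolding fit_prog_def
    by (rule refines_Seq_return[OF init[unfolded iter_pmf_constant[of 0 ?m "\<lambda>_. return_pmf", OF refl]]
          refines_Seq_return[OF rounds[unfolded iter_pmf_constant[of 0 k "\<lambda>_. return_pmf", OF refl]] last]])
  then show ?thesis by (rule refines_time) (auto simp: algebra_simps)
qed

end

subsection \<open>Programs for finding the blocks\<close>

definition find_prog :: cmd where
  "find_prog = Seq (Assign (Const 11) (Const 0)) (For 10 (V 4)
     (Seq (Sample (Const 64)) (Seq (zero_outside_prog 13) (Seq
       (Query (Const 14) (Const 64)) (Seq (Query (Const 15) (buf1 (Const 0)))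
       (If (neq (V 14) (V 15))
         (Seq (Assign (Const 11) (Const 1)) (Seq (Assign (Const 12) (V 14)) (Seq
           (For 13 (V 0) (Assign (arr 3 (V 13)) (Read (buf0 (V 13)))))
           (For 13 (V 0) (Assign (arr 4 (V 13)) (Read (buf1 (V 13))))))))
         Skip))))))"

text \<open>Register 12 keeps the value of \<open>f\<close> at the first point of the pair. Halving
  never changes that value, so one query per round suffices.\<close>

definition halve_prog :: cmd where
  "halve_prog = Seq
     (For 13 (V 0) (Seq (Toss (Const 14)) (If (V 14)
       (Assign (buf0 (V 13)) (Read (arr 3 (V 13)))) (Assign (buf0 (V 13)) (Read (arr 4 (V 13)))))))
     (Seq (Query (Const 14) (Const 64)) (If (eqe (V 14) (V 12))
       (For 13 (V 0) (Assign (arr 3 (V 13)) (Read (buf0 (V 13)))))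
       (For 13 (V 0) (Assign (arr 4 (V 13)) (Read (buf0 (V 13)))))))"

definition add_prog :: cmd where
  "add_prog = Seq (mul 14 15 (V 8) (V 0)) (Seq
     (For 13 (V 0) (Seq (Assign (arr 2 (Add (V 14) (V 13))) (Read (arr 3 (V 13))))
       (If (neq (Read (arr 3 (V 13))) (Read (arr 4 (V 13))))
         (Assign (arr 0 (V 13)) (Add (V 8) (Const 1))) Skip)))
     (Assign (Const 8) (Add (V 8) (Const 1))))"

definition epoch_prog :: cmd where
  "epoch_prog = If (V 9) (Seq find_prog
     (If (V 11) (Seq (For 10 (V 6) halve_prog) add_prog) (Assign (Const 9) (Const 0)))) Skip"

definition find_blocks_prog :: cmd where
  "find_blocks_prog = Seq (Assign (Const 9) (Const 1)) (For 7 (Add (V 1) (Const 1)) epoch_prog)"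

context oracles begin

lemma refines_return_const:
  assumes "refines c s T Q (return_pmf ()) (\<lambda>_. R x)"
  shows "refines c s T Q (return_pmf x) R"
  using refines_map[of c s T Q "return_pmf ()" R "\<lambda>_. x"] assms by simp

lemma refines_find:
  assumes st: "stores n own ws s" and D: "set_pmf D \<subseteq> cube n" and N1: "s 4 = N1"
  shows "refines find_prog s (N1 * (13 * n + 50) + 20) (N1 * 3) (find_point n f D N1 own)
     (\<lambda>v t. t 11 = of_bool (v \<noteq> None) \<and>
       (\<forall>x. v = Some x \<longrightarrow> t 12 = of_bool (f x) \<and> holds_point n 3 0 x t \<and> holds_point n 4 0 (zero_outside n own x) t) \<and>
       frame n 10 {3, 4} s t)"
proof -
  let ?z = "zero_outside n own"
  let ?I = "\<lambda>(_::nat) v t. t 11 = of_bool (v \<noteq> None) \<and>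
       (\<forall>x. v = Some x \<longrightarrow> t 12 = of_bool (f x) \<and> holds_point n 3 0 x t \<and> holds_point n 4 0 (?z x) t) \<and>
       frame n 10 {3, 4} s t"
  let ?c3 = "For 13 (V 0) (Assign (arr 3 (V 13)) (Read (buf0 (V 13))))"
  let ?c4 = "For 13 (V 0) (Assign (arr 4 (V 13)) (Read (buf1 (V 13))))"
  let ?then = "Seq (Assign (Const 11) (Const 1)) (Seq (Assign (Const 12) (V 14)) (Seq ?c3 ?c4))"
  let ?test = "Seq (Query (Const 14) (Const 64)) (Seq (Query (Const 15) (buf1 (Const 0)))
       (If (neq (V 14) (V 15)) ?then Skip))"
  let ?C = "n * 4 + 3"
  have "refines (For 10 (V 4) (Seq (Sample (Const 64)) (Seq (zero_outside_prog 13) ?test))) (s(11 := 0))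
     (N1 * (((n * 5 + 3) + (?C + ?C + 1 + 2 + 2 + 1 + 2 + 2) + 1 + 2) + 3) + 3) (N1 * (0 + (0 + 1 + 1) + 1))
     (find_point n f D N1 own) (?I N1)"
    unfolding find_point_def
  proof (rule refines_For[where I = ?I], goal_cases)
    case 1
    show ?case by (auto intro!: frame_upd frame_refl)
  next
    case (2 i p t)
    then show ?case using N1 by (auto simp: frame_def)
  next
    case (3 i v t)
    then have fr: "frame n 10 {3, 4} s t" by blast
    have t: "t 0 = n" "t 10 = i" using 3 frame_reg[OF fr, of 0] st by (auto simp: stores_def)
    let ?post = "\<lambda>v' t'. t' 10 = i \<and> ?I (Suc i) v' (t'(10 := Suc i))"
    have "refines (Seq (Sample (Const 64)) (Seq (zero_outside_prog 13) ?test)) t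
       (((n * 5 + 3) + (?C + ?C + 1 + 2 + 2 + 1 + 2 + 2) + 1) + 2) (0 + (0 + 1 + 1) + 1)
       (bind_pmf D (\<lambda>x. return_pmf (if f x \<noteq> f (?z x) then Some x else v))) ?post"
    proof (rule refines_Sample_Seq)
      fix x assume "x \<in> set_pmf D"
      then have x: "x \<in> cube n" using D by blast
      let ?v = "if f x \<noteq> f (?z x) then Some x else v"
      have fr1: "frame n 13 {} t (store_point 64 x t)" using store_point_simps(2)[OF x] by simp
      have test: "refines ?test t2 (?C + ?C + 1 + 2 + 2 + 1 + 2 + 2) (0 + 1 + 1) (return_pmf ?v) ?post"
        if b0: "\<forall>j<n. t2 (64 + j) = of_bool (x ! j)" and b1: "\<forall>j<n. t2 (64 + n + j) = of_bool (?z x ! j)"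
          and fr2: "frame n 13 {} t t2" for t2
      proof -
        have q0: "load_point n 64 t2 = x" using b0 x by (intro load_point_eqI) auto
        have q1: "load_point n (64 + n) (t2(14 := w)) = ?z x" for w
          using b1 by (intro load_point_eqI) auto
        let ?t3 = "t2(14 := of_bool (f x), 15 := of_bool (f (?z x)))"
        have t2: "t2 0 = n" "t2 10 = i" "t2 11 = t 11" "t2 12 = t 12" using frame_reg[OF fr2] t by auto
        have fr3: "frame n 13 {} t ?t3" by (intro frame_upd fr2) auto
        have If: "refines (If (neq (V 14) (V 15)) ?then Skip) ?t3 (max (?C + ?C + 1 + 2 + 2) 1 + 1) (max (0 + 0) 0)
          (return_pmf ?v) ?post"
        proof (rule refines_If)
          assume "eval (neq (V 14) (V 15)) ?t3 \<noteq> 0"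
          then have ne: "f x \<noteq> f (?z x)" by auto
          let ?t4 = "?t3(11 := 1, 12 := of_bool (f x))"
          have fr4: "frame n 11 {3, 4} t ?t4" 
            by (rule frame_upd[OF frame_upd[OF frame_mono[OF fr3]]]) auto
          have "refines (Seq ?c3 ?c4) ?t4 (?C + ?C + 1) (0 + 0) (return_pmf ?v) ?post"
          proof (rule refines_Seq_return[OF refines_copy[where x = x]])
            fix t5 assume t5: "holds_point n 3 0 x t5 \<and> frame n 13 {3} ?t4 t5 \<and> (\<forall>j<2 * n. t5 (64 + j) = ?t4 (64 + j))"
            have t50: "t5 0 = n" using frame_reg[of n 13 "{3}" ?t4 t5 0] t5 t2 by simp
            have b5: "t5 (64 + n + j) = of_bool (?z x ! j)" if "j < n" for j
            proof -
              have "t5 (64 + (n + j)) = ?t4 (64 + (n + j))" using t5 that by simp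
              then show ?thesis using b1 that by (simp add: add.assoc)
            qed
            have c4: "refines ?c4 t5 ?C 0 (return_pmf ())
              (\<lambda>_ t. holds_point n 4 0 (?z x) t \<and> frame n 13 {4} t5 t \<and> (\<forall>j<2 * n. t (64 + j) = t5 (64 + j)))"
            proof (rule refines_copy)
              fix j t' assume j: "j < n" "frame n 13 {4} t5 t'" "t' 13 = j" "\<forall>j<2 * n. t' (64 + j) = t5 (64 + j)"
              have "t' (64 + (n + j)) = t5 (64 + (n + j))" using j by simp
              then show "eval (Read (buf1 (V 13))) t' = of_bool (?z x ! j)"
                using j b5[OF j(1)] t50 frame_reg[OF j(2), of 0] by (simp add: add.assoc)
            qed (use t50 in auto)
            show "refines ?c4 t5 ?C 0 (return_pmf ?v) ?post"
            proof (rule refines_return_const, rule refines_weaken[OF c4])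
              fix t6
              assume "holds_point n 4 0 (?z x) t6 \<and> frame n 13 {4} t5 t6 \<and> (\<forall>j<2 * n. t6 (64 + j) = t5 (64 + j))"
              then have t6: "holds_point n 4 0 (?z x) t6" "frame n 13 {4} t5 t6" by blast+
              have r: "t6 10 = i" "t6 11 = 1" "t6 12 = of_bool (f x)"
                using frame_reg[OF t6(2)] t5 frame_reg[of n 13 "{3}" ?t4 t5] t2 by auto
              have "holds_point n 3 0 x t6" using holds_point_frame[of n 3 0 x t5 13 "{4}" t6] t5 t6 by simp
              moreover have "frame n 10 {3, 4} s t6"
              proof -
                have "frame n 11 {3, 4} t t5" using frame_trans[OF fr4, of 13 "{3}" t5] t5 by auto
                then have "frame n 11 {3, 4} t t6" using frame_trans[of n 11 "{3, 4}" t t5 13 "{4}" t6] t6 by auto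
                then show ?thesis using frame_trans[OF fr, of 11 "{3, 4}" t6] by auto
              qed
              ultimately show "?post ?v t6" using ne r t6(1) by (auto simp: holds_point_def intro!: frame_upd)
            qed simp_all
          next
            fix j t' assume j: "j < n" "frame n 13 {3} ?t4 t'" "t' 13 = j" "\<forall>j<2 * n. t' (64 + j) = ?t4 (64 + j)"
            then show "eval (Read (buf0 (V 13))) t' = of_bool (x ! j)" using b0 by simp
          qed (use t2 in auto)
          then show "refines ?then ?t3 (?C + ?C + 1 + 2 + 2) (0 + 0) (return_pmf ?v) ?post"
            by (intro refines_Assign_Seq) simp
        next
          assume "eval (neq (V 14) (V 15)) ?t3 = 0"
          then have eq: "f x = f (?z x)" by (auto split: if_splits)
          have fr4: "frame n 10 {3, 4} s (?t3(10 := Suc i))" 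
            by (rule frame_upd[OF frame_trans[OF fr fr3]]) auto
          have h: "holds_point n 3 0 y t2 \<longleftrightarrow> holds_point n 3 0 y t" "holds_point n 4 0 y t2 \<longleftrightarrow> holds_point n 4 0 y t" for y
            using frame_loc[OF fr2] by (auto simp: holds_point_def)
          have post: "?post v ?t3"
          proof (intro conjI allI impI)
            show "?t3 10 = i" using t2 by simp
            show "(?t3(10 := Suc i)) 11 = of_bool (v \<noteq> None)" using t2 3 by simp
            fix y assume "v = Some y"
            then have y: "t 12 = of_bool (f y)" "holds_point n 3 0 y t" "holds_point n 4 0 (?z y) t" using 3 by blast+
            show "(?t3(10 := Suc i)) 12 = of_bool (f y)" using t2 y(1) by simp
            show "holds_point n 3 0 y (?t3(10 := Suc i))" using h(1) y(2) by simp
            show "holds_point n 4 0 (?z y) (?t3(10 := Suc i))" using h(2)[of "?z y"] y(3) by (simp only: holds_point_upd)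
          qed (rule fr4)
          have v: "?v = v" using eq by (simp only: if_False simp_thms)
          show "refines Skip ?t3 1 0 (return_pmf ?v) ?post"
            unfolding v by (rule refines_Skip[where R = ?post]) (rule post)
        qed
        have e1: "t2(eval (Const 14) t2 := of_bool (f (load_point n (eval (Const 64) t2) t2))) = t2(14 := of_bool (f x))"
          using q0 by simp
        have e2: "(t2(14 := of_bool (f x)))(eval (Const 15) (t2(14 := of_bool (f x))) :=
            of_bool (f (load_point n (eval (buf1 (Const 0)) (t2(14 := of_bool (f x)))) (t2(14 := of_bool (f x)))))) = ?t3"
          using q1 t2 by simp
        have Q: "refines (Seq (Query (Const 15) (buf1 (Const 0))) (If (neq (V 14) (V 15)) ?then Skip))
            (t2(14 := of_bool (f x))) (max (?C + ?C + 1 + 2 + 2) 1 + 1 + 2) (max (0 + 0) 0 + 1) (return_pmf ?v) ?post"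
          by (rule refines_Query_Seq, unfold e2, rule If)
        have "refines ?test t2 (max (?C + ?C + 1 + 2 + 2) 1 + 1 + 2 + 2) (max (0 + 0) 0 + 1 + 1) (return_pmf ?v) ?post"
          by (rule refines_Query_Seq, unfold e1, rule Q)
        then show ?thesis by (rule refines_time) auto
      qed
      have "refines (Seq (zero_outside_prog 13) ?test) (store_point 64 x t)
         ((n * 5 + 3) + (?C + ?C + 1 + 2 + 2 + 1 + 2 + 2) + 1) (0 + (0 + 1 + 1)) (return_pmf ?v) ?post"
      proof (rule refines_Seq_return[OF refines_zero_outside[where x = x and own = own and ws = ws]])
        show "stores n own ws (store_point 64 x t)"
          using stores_frame[OF stores_frame[OF st fr] fr1] by auto
        show "store_point 64 x t (64 + j) = of_bool (x ! j)" if "j < n" for j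
          using store_point_simps(1)[OF x that] .
        show "refines ?test t2 (?C + ?C + 1 + 2 + 2 + 1 + 2 + 2) (0 + 1 + 1) (return_pmf ?v) ?post"
          if "(\<forall>j<n. t2 (64 + j) = of_bool (x ! j)) \<and> (\<forall>j<n. t2 (64 + n + j) = of_bool (?z x ! j)) \<and>
            frame n 13 {} (store_point 64 x t) t2" for t2
          using that frame_trans[OF fr1, of 13 "{}" t2] by (intro test) auto
      qed auto
      then show "refines (Seq (zero_outside_prog 13) ?test) (store_point (eval (Const 64) t) x t)
         ((n * 5 + 3) + (?C + ?C + 1 + 2 + 2 + 1 + 2 + 2) + 1) (0 + (0 + 1 + 1)) (return_pmf ?v) ?post"
        by simp
    qed
    then show ?case unfolding map_pmf_def .
  next
    case (4 v t)
    show ?case using 4(1) .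
  qed
  then have "refines find_prog s
     ((N1 * (((n * 5 + 3) + (?C + ?C + 1 + 2 + 2 + 1 + 2 + 2) + 1 + 2) + 3) + 3) + 2) (N1 * (0 + (0 + 1 + 1) + 1))
     (find_point n f D N1 own) (?I N1)"
    unfolding find_prog_def by (intro refines_Assign_Seq) simp
  then show ?thesis by (rule refines_time) (auto simp: algebra_simps)
qed

lemma refines_halve:
  assumes n0: "s 0 = n" and y: "holds_point n 3 0 y s" "holds_point n 4 0 y' s" and fy: "s 12 = of_bool (f y)"
  shows "refines halve_prog s (11 * n + 30) 1 (halve n f (y, y'))
     (\<lambda>(z, z') t. t 12 = of_bool (f z) \<and> holds_point n 3 0 z t \<and> holds_point n 4 0 z' t \<and> frame n 13 {3, 4} s t)"
proof -
  let ?z = "\<lambda>u. select n ((!) u) y y'"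
  let ?I = "\<lambda>i us t. length us = i \<and> (\<forall>j<i. t (64 + j) = of_bool (if us ! j then y ! j else y' ! j)) \<and> frame n 13 {} s t"
  let ?res = "\<lambda>u. if f (?z u) = f y then (?z u, y') else (y, ?z u)"
  let ?post = "\<lambda>(z, z') t. t 12 = of_bool (f z) \<and> holds_point n 3 0 z t \<and> holds_point n 4 0 z' t \<and> frame n 13 {3, 4} s t"
  let ?c = "\<lambda>a. For 13 (V 0) (Assign (arr a (V 13)) (Read (buf0 (V 13))))"
  have loop: "refines (For 13 (V 0) (Seq (Toss (Const 14)) (If (V 14)
       (Assign (buf0 (V 13)) (Read (arr 3 (V 13)))) (Assign (buf0 (V 13)) (Read (arr 4 (V 13)))))))
     s (n * (4 + 3) + 3) (n * 0) (iter_pmf n 0 (\<lambda>_ us. bind_pmf coin (\<lambda>b. return_pmf (us @ [b]))) []) (?I n)"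
  proof (rule refines_For[where I = ?I], goal_cases)
    case 1
    show ?case by (auto intro!: frame_upd frame_refl)
  next
    case (2 i us t)
    then show ?case using n0 by (auto simp: frame_def)
  next
    case (3 i us t)
    then have fr: "frame n 13 {} s t" by blast
    have t: "t 0 = n" "t (loc n 3 i) = of_bool (y ! i)" "t (loc n 4 i) = of_bool (y' ! i)"
      using frame_reg[OF fr] frame_loc[OF fr] n0 y 3 by (auto simp: holds_point_def)
    show ?case
      by (rule refines_time[OF refines_Toss_Seq[OF refines_If[OF refines_Assign refines_Assign]]])
        (use 3 t in \<open>auto simp: nth_append less_Suc_eq intro!: frame_upd split: if_splits\<close>)
  qed auto
  have tail: "refines (Seq (Query (Const 14) (Const 64)) (If (eqe (V 14) (V 12)) (?c 3) (?c 4))) t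
      (max (n * 4 + 3) (n * 4 + 3) + 1 + 2) (max 0 0 + 1) (return_pmf (?res u)) ?post"
    if I: "?I n u t" for u t
  proof (rule refines_Query_Seq)
    have q: "load_point n 64 t = ?z u" using I by (intro load_point_eqI) auto
    let ?t1 = "t(14 := of_bool (f (?z u)))"
    have fr: "frame n 13 {} s ?t1" using I by (auto intro!: frame_upd)
    have t1: "?t1 0 = n" "?t1 12 = of_bool (f y)" using frame_reg[OF fr] n0 fy by auto
    have b: "?t1 (64 + j) = of_bool (?z u ! j)" if "j < n" for j using I that by auto
    have h: "holds_point n 3 0 y ?t1" "holds_point n 4 0 y' ?t1"
      using holds_point_frame[OF y(1) fr] holds_point_frame[OF y(2) fr] by auto
    have copy: "refines (?c a) ?t1 (n * 4 + 3) 0 (return_pmf ())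
        (\<lambda>_ t'. holds_point n a 0 (?z u) t' \<and> frame n 13 {a} ?t1 t' \<and> (\<forall>j<2*n. t' (64 + j) = ?t1 (64 + j)))"
      if "a < 16" for a
      by (rule refines_copy) (use that t1 b in auto)
    have "refines (If (eqe (V 14) (V 12)) (?c 3) (?c 4)) ?t1 (max (n * 4 + 3) (n * 4 + 3) + 1) (max 0 0)
       (return_pmf (?res u)) ?post"
    proof (rule refines_If; rule refines_return_const)
      assume "eval (eqe (V 14) (V 12)) ?t1 \<noteq> 0"
      then have eq: "f (?z u) = f y" using t1 by (auto split: if_splits)
      show "refines (?c 3) ?t1 (n * 4 + 3) 0 (return_pmf ()) (\<lambda>_. ?post (?res u))"
      proof (rule refines_weaken[OF copy])
        fix t' assume t': "holds_point n 3 0 (?z u) t' \<and> frame n 13 {3} ?t1 t' \<and> (\<forall>j<2*n. t' (64 + j) = ?t1 (64 + j))"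
        then have fr': "frame n 13 {3} ?t1 t'" by blast
        show "?post (?res u) t'"
          using eq t' frame_reg[OF fr', of 12] t1 holds_point_frame[OF h(2) fr'] frame_trans[OF frame_mono[OF fr] frame_mono[OF fr'], of 13 "{3,4}" 13 "{3,4}"]
          by auto
      qed auto
    next
      assume "eval (eqe (V 14) (V 12)) ?t1 = 0"
      then have eq: "f (?z u) \<noteq> f y" using t1 by (auto split: if_splits)
      show "refines (?c 4) ?t1 (n * 4 + 3) 0 (return_pmf ()) (\<lambda>_. ?post (?res u))"
      proof (rule refines_weaken[OF copy])
        fix t' assume t': "holds_point n 4 0 (?z u) t' \<and> frame n 13 {4} ?t1 t' \<and> (\<forall>j<2*n. t' (64 + j) = ?t1 (64 + j))"
        then have fr': "frame n 13 {4} ?t1 t'" by blast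
        show "?post (?res u) t'"
          using eq t' frame_reg[OF fr', of 12] t1 holds_point_frame[OF h(1) fr'] frame_trans[OF frame_mono[OF fr] frame_mono[OF fr'], of 13 "{3,4}" 13 "{3,4}"]
          by auto
      qed auto
    qed
    then show "refines (If (eqe (V 14) (V 12)) (?c 3) (?c 4))
       (t(eval (Const 14) t := of_bool (f (load_point n (eval (Const 64) t) t)))) (max (n * 4 + 3) (n * 4 + 3) + 1) (max 0 0)
       (return_pmf (?res u)) ?post"
      by (simp only: q eval.simps)
  qed
  have "refines halve_prog s ((n * (4 + 3) + 3) + (max (n * 4 + 3) (n * 4 + 3) + 1 + 2) + 1) (n * 0 + (max 0 0 + 1))
     (bind_pmf (iter_pmf n 0 (\<lambda>_ us. bind_pmf coin (\<lambda>b. return_pmf (us @ [b]))) []) (\<lambda>u. return_pmf (?res u))) ?post"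
    unfolding halve_prog_def by (rule refines_Seq[OF loop tail])
  then show ?thesis unfolding iter_uniform_point halve_def prod.case Let_def map_pmf_def
    by (rule refines_time) auto
qed


lemma refines_add:
  assumes st: "stores n own ws s" and y: "holds_point n 3 0 y s" "holds_point n 4 0 y' s"
  shows "refines add_prog s (4 * length ws + 7 * n + 30) 0 (return_pmf ())
     (\<lambda>_ t. (case add_block n (own, ws) (y, y') of (own', ws') \<Rightarrow> stores n own' ws' t) \<and>
        (\<forall>r<8. t r = s r) \<and> (\<forall>r\<in>{9..12}. t r = s r))"
proof -
  let ?q = "length ws"
  let ?own = "\<lambda>i. if i < n \<and> y ! i \<noteq> y' ! i then Suc ?q else own i"
  let ?s1 = "s(14 := ?q * n, 15 := ?q)"
  let ?I = "\<lambda>i (_::unit) t. (\<forall>j<n. t (loc n 0 j) = (if j < i then ?own j else own j)) \<and>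
     (\<forall>j<?q * n. t (loc n 2 j) = s (loc n 2 j)) \<and> (\<forall>j<i. t (loc n 2 (?q * n + j)) = of_bool (y ! j)) \<and>
     t 14 = ?q * n \<and> frame n 13 {0, 2} s t"
  let ?loop = "For 13 (V 0) (Seq (Assign (arr 2 (Add (V 14) (V 13))) (Read (arr 3 (V 13))))
       (If (neq (Read (arr 3 (V 13))) (Read (arr 4 (V 13))))
         (Assign (arr 0 (V 13)) (Add (V 8) (Const 1))) Skip))"
  have s: "s 0 = n" "s 8 = ?q" "\<And>i. i < n \<Longrightarrow> s (loc n 0 i) = own i" using st by (simp_all add: stores_def)
  have mul: "refines (mul 14 15 (V 8) (V 0)) s (4 * eval (V 8) s + 5) 0 (return_pmf ()) (\<lambda>_ t. t = ?s1)"
    by (rule refines_mul) (use s in auto)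
  have loop: "refines ?loop ?s1 (n * (4 + 3) + 3) (n * 0) (iter_pmf n 0 (\<lambda>_. return_pmf) ()) (?I n)"
  proof (rule refines_For[where I = ?I], goal_cases)
    case 1
    show ?case using s by (auto intro!: frame_upd frame_refl)
  next
    case (2 i p t)
    then show ?case using s by (auto simp: frame_def)
  next
    case (3 i p t)
    then have fr: "frame n 13 {0, 2} s t" by blast
    have t: "t 0 = n" "t 8 = ?q" "t (loc n 3 i) = of_bool (y ! i)" "t (loc n 4 i) = of_bool (y' ! i)"
      "t 14 = ?q * n" "t 13 = i"
      using frame_reg[OF fr] frame_loc[OF fr] s y 3 by (auto simp: holds_point_def)
    have ne: "loc n 3 i \<noteq> loc n 2 j" "loc n 4 i \<noteq> loc n 2 j" "loc n 0 i \<noteq> loc n 2 j" "loc n 2 i \<noteq> loc n 0 j" for i j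
      by (simp_all add: loc_eq_iff)
    let ?t1 = "t(loc n 2 (?q * n + i) := of_bool (y ! i))"
    have fr1: "frame n 13 {0, 2} s ?t1" by (intro frame_upd_loc fr) auto
    have "refines (If (neq (Read (arr 3 (V 13))) (Read (arr 4 (V 13))))
         (Assign (arr 0 (V 13)) (Add (V 8) (Const 1))) Skip) ?t1 2 0 (return_pmf p)
         (\<lambda>x' s'. s' 13 = i \<and> ?I (Suc i) x' (s'(13 := Suc i)))"
    proof (rule refines_time[OF refines_If[OF refines_Assign refines_Skip]], goal_cases)
      case 1
      then have "y ! i \<noteq> y' ! i" using t ne by auto
      then show ?case using 3 frame_upd[OF frame_upd_loc[OF fr1, of 0 i "Suc ?q"], of 13 "Suc i"]
        by (auto simp: less_Suc_eq t ne)
    next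
      case 2
      then have "y ! i = y' ! i" using t ne by auto
      then show ?case using 3 frame_upd[OF fr1, of 13 "Suc i"]
        by (auto simp: less_Suc_eq t ne)
    qed simp_all
    moreover have "t(eval (arr 2 (Add (V 14) (V 13))) t := eval (Read (arr 3 (V 13))) t) = ?t1"
      using t by simp
    ultimately have "refines (Seq (Assign (arr 2 (Add (V 14) (V 13))) (Read (arr 3 (V 13))))
       (If (neq (Read (arr 3 (V 13))) (Read (arr 4 (V 13))))
         (Assign (arr 0 (V 13)) (Add (V 8) (Const 1))) Skip)) t (2 + 2) 0 (return_pmf p)
         (\<lambda>x' s'. s' 13 = i \<and> ?I (Suc i) x' (s'(13 := Suc i)))"
      by (intro refines_Assign_Seq) (simp only:)
    then show ?case by (rule refines_time) auto
  next
    case (4 p t)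
    show ?case using 4(1) .
  qed
  have last: "refines (Assign (Const 8) (Add (V 8) (Const 1))) t 1 0 (return_pmf ())
     (\<lambda>_ t. (case add_block n (own, ws) (y, y') of (own', ws') \<Rightarrow> stores n own' ws' t) \<and>
        (\<forall>r<8. t r = s r) \<and> (\<forall>r\<in>{9..12}. t r = s r))" if I: "?I n () t" for t
  proof (rule refines_Assign)
    have fr: "frame n 13 {0, 2} s t" using I by blast
    let ?t1 = "t(8 := Suc ?q)"
    have "stores n ?own (ws @ [y]) ?t1"
      unfolding stores_def
    proof (intro conjI allI impI)
      fix l assume l: "l < length (ws @ [y])"
      show "holds_point n 2 (l * n) ((ws @ [y]) ! l) ?t1"
      proof (cases "l < ?q")
        case True
        have "l * n + i < ?q * n" if "i < n" for i
        proof -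
          have "Suc l * n \<le> ?q * n" using True by (intro mult_le_mono) auto
          then show ?thesis using that by simp
        qed
        then show ?thesis using True I st by (auto simp: holds_point_def stores_def nth_append)
      next
        case False
        then have "l = ?q" using l by simp
        then show ?thesis using I by (auto simp: holds_point_def)
      qed
    qed (use I s frame_reg[OF fr] in auto)
    moreover have "eval (Add (V 8) (Const 1)) t = Suc ?q" using frame_reg[OF fr, of 8] s by simp
    ultimately show "(case add_block n (own, ws) (y, y') of (own', ws') \<Rightarrow>
        stores n own' ws' (t(eval (Const 8) t := eval (Add (V 8) (Const 1)) t))) \<and>
        (\<forall>r<8. (t(eval (Const 8) t := eval (Add (V 8) (Const 1)) t)) r = s r) \<and>
        (\<forall>r\<in>{9..12}. (t(eval (Const 8) t := eval (Add (V 8) (Const 1)) t)) r = s r)"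
      using frame_reg[OF fr] by (auto simp: add_block_def simp del: eval.simps(3) simp: eval.simps(1))
  qed
  have "refines add_prog s ((4 * eval (V 8) s + 5) + ((n * (4 + 3) + 3) + 1 + 1) + 1) (0 + (n * 0 + 0)) (return_pmf ())
     (\<lambda>_ t. (case add_block n (own, ws) (y, y') of (own', ws') \<Rightarrow> stores n own' ws' t) \<and>
        (\<forall>r<8. t r = s r) \<and> (\<forall>r\<in>{9..12}. t r = s r))"
    unfolding add_prog_def
    by (rule refines_Seq_return[OF mul], simp only:,
        rule refines_Seq_return[OF loop[unfolded iter_pmf_constant[of 0 n "\<lambda>_. return_pmf", OF refl]] last])
  then show ?thesis by (rule refines_time) (use s in auto)
qed

text \<open>The bound \<open>B\<close> stands in for the current number of blocks, so that the time
  is the same in all epochs, as \<open>refines_For\<close> demands.\<close>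

lemma refines_epoch:
  assumes st: "stores n own ws s" and fnd: "s 9 = of_bool fnd" and D: "set_pmf D \<subseteq> cube n"
    and N1: "s 4 = N1" and R: "s 6 = R" and B: "length ws \<le> B"
  shows "refines epoch_prog s (N1 * (13 * n + 50) + R * (11 * n + 40) + 4 * B + 7 * n + 80) (N1 * 3 + R)
     (epoch n f D N1 R (fnd, own, ws))
     (\<lambda>(fnd', own', ws') t. t 9 = of_bool fnd' \<and> stores n own' ws' t \<and> (\<forall>r<8. t r = s r))"
proof -
  let ?z = "zero_outside n own"
  let ?post = "\<lambda>(fnd', own', ws') t. t 9 = of_bool fnd' \<and> stores n own' ws' t \<and> (\<forall>r<8. t r = s r)"
  let ?body = "If (V 11) (Seq (For 10 (V 6) halve_prog) add_prog) (Assign (Const 9) (Const 0))"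
  let ?cont = "\<lambda>v. case v of None \<Rightarrow> return_pmf (False, own, ws)
     | Some x \<Rightarrow> map_pmf (\<lambda>p. (True, add_block n (own, ws) p)) (iter_pmf R 0 (\<lambda>_. halve n f) (x, ?z x))"
  let ?Th = "R * ((11 * n + 30) + 3) + 3" and ?Ta = "4 * B + 7 * n + 30"
  have body: "refines ?body t (max (?Th + ?Ta + 1) 1 + 1) (max (R * 1 + 0) 0) (?cont v) ?post"
    if fnd and t: "t 11 = of_bool (v \<noteq> None) \<and>
       (\<forall>x. v = Some x \<longrightarrow> t 12 = of_bool (f x) \<and> holds_point n 3 0 x t \<and> holds_point n 4 0 (?z x) t) \<and>
       frame n 10 {3, 4} s t" for v t
  proof -
    have fr: "frame n 10 {3, 4} s t" using t by blast
    have stt: "stores n own ws t" using stores_frame[OF st fr] by simp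
    have t9: "t 9 = 1" using frame_reg[OF fr, of 9] fnd \<open>fnd\<close> by simp
    show ?thesis
    proof (rule refines_If)
      assume "eval (V 11) t \<noteq> 0"
      then obtain x where v: "v = Some x" using t by auto
      let ?I = "\<lambda>(_::nat) (z, z') t'. t' 12 = of_bool (f z) \<and> holds_point n 3 0 z t' \<and> holds_point n 4 0 z' t' \<and> frame n 10 {3, 4} s t'"
      have loop: "refines (For 10 (V 6) halve_prog) t ?Th (R * 1) (iter_pmf R 0 (\<lambda>_. halve n f) (x, ?z x)) (?I R)"
      proof (rule refines_For[where I = ?I], goal_cases)
        case 1
        show ?case using t v by (auto simp: holds_point_def intro!: frame_upd)
      next
        case (2 i p t')
        then show ?case using R by (auto simp: frame_def)
      next
        case (3 i p t')
        obtain z z' where p: "p = (z, z')" by (cases p)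
        have fr': "frame n 10 {3, 4} s t'" using 3 by (simp add: p)
        have "refines halve_prog t' (11 * n + 30) 1 (halve n f (z, z'))
           (\<lambda>(z, z') t. t 12 = of_bool (f z) \<and> holds_point n 3 0 z t \<and> holds_point n 4 0 z' t \<and> frame n 13 {3, 4} t' t)"
          using 3 frame_reg[OF fr', of 0] st by (intro refines_halve) (auto simp: p stores_def)
        then show ?case unfolding p
        proof (rule refines_weaken)
          fix p2 t2 assume a: "(\<lambda>(z, z') t. t 12 = of_bool (f z) \<and> holds_point n 3 0 z t \<and> holds_point n 4 0 z' t \<and> frame n 13 {3, 4} t' t) p2 t2"
          obtain w w' where p2: "p2 = (w, w')" by (cases p2)
          have "frame n 13 {3, 4} t' t2" using a by (simp add: p2)
          then have "t2 10 = i" "frame n 10 {3, 4} s t2"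
            using 3 frame_reg[of n 13 "{3, 4}" t' t2 10] frame_trans[OF fr', of 13 "{3, 4}" t2] by auto
          then show "t2 10 = i \<and> ?I (Suc i) p2 (t2(10 := Suc i))"
            using a by (auto simp: p2 holds_point_def intro!: frame_upd)
        qed auto
      next
        case (4 p t')
        show ?case using 4(1) .
      qed
      have "refines (Seq (For 10 (V 6) halve_prog) add_prog) t (?Th + ?Ta + 1) (R * 1 + 0)
         (bind_pmf (iter_pmf R 0 (\<lambda>_. halve n f) (x, ?z x)) (\<lambda>p. return_pmf (True, add_block n (own, ws) p))) ?post"
      proof (rule refines_Seq[OF loop])
        fix p t' assume a: "?I R p t'"
        obtain z z' where p: "p = (z, z')" by (cases p)
        have fr': "frame n 10 {3, 4} s t'" using a by (simp add: p)
        obtain own' ws' where ab: "add_block n (own, ws) (z, z') = (own', ws')" by fastforce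
        have add: "refines add_prog t' (4 * length ws + 7 * n + 30) 0 (return_pmf ())
           (\<lambda>_ t. (case add_block n (own, ws) (z, z') of (own', ws') \<Rightarrow> stores n own' ws' t) \<and>
             (\<forall>r<8. t r = t' r) \<and> (\<forall>r\<in>{9..12}. t r = t' r))"
          using a stores_frame[OF st fr'] by (intro refines_add) (auto simp: p)
        show "refines add_prog t' ?Ta 0 (return_pmf (True, add_block n (own, ws) p)) ?post"
          unfolding p ab
          by (rule refines_return_const, rule refines_weaken[OF add])
            (use B frame_reg[OF fr'] fnd \<open>fnd\<close> ab in auto)
      qed
      then show "refines (Seq (For 10 (V 6) halve_prog) add_prog) t (?Th + ?Ta + 1) (R * 1 + 0) (?cont v) ?post"
        by (simp add: v map_pmf_def)
    next
      assume "eval (V 11) t = 0"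
      then have v: "v = None" using t by auto
      have "stores n own ws (t(9 := 0))" using stt by (auto simp: stores_def holds_point_def)
      then show "refines (Assign (Const 9) (Const 0)) t 1 0 (?cont v) ?post"
        unfolding v option.case using frame_reg[OF fr] by (intro refines_Assign) auto
    qed
  qed
  have "refines epoch_prog s (max ((N1 * (13 * n + 50) + 20) + (max (?Th + ?Ta + 1) 1 + 1) + 1) 1 + 1)
     (max (N1 * 3 + max (R * 1 + 0) 0) 0) (epoch n f D N1 R (fnd, own, ws)) ?post"
    unfolding epoch_prog_def
  proof (rule refines_If)
    assume "eval (V 9) s \<noteq> 0"
    then have fnd using fnd by simp
    have "refines (Seq find_prog ?body) s ((N1 * (13 * n + 50) + 20) + (max (?Th + ?Ta + 1) 1 + 1) + 1) (N1 * 3 + max (R * 1 + 0) 0)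
       (bind_pmf (find_point n f D N1 own) ?cont) ?post"
      by (rule refines_Seq[OF refines_find[OF st D N1] body]) (use \<open>fnd\<close> in auto)
    then show "refines (Seq find_prog ?body) s ((N1 * (13 * n + 50) + 20) + (max (?Th + ?Ta + 1) 1 + 1) + 1) (N1 * 3 + max (R * 1 + 0) 0)
       (epoch n f D N1 R (fnd, own, ws)) ?post"
      unfolding epoch_def prod.case using \<open>fnd\<close> by (simp only: if_True)
  next
    assume "eval (V 9) s = 0"
    then have "\<not> fnd" using fnd by simp
    then show "refines Skip s 1 0 (epoch n f D N1 R (fnd, own, ws)) ?post"
      unfolding epoch_def prod.case using st fnd by (auto intro!: refines_Skip[simplified])
  qed
  then show ?thesis by (rule refines_time) (auto simp: algebra_simps)
qed

lemma refines_find_blocks: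
  assumes st: "stores n (\<lambda>_. 0) [] s" and D: "set_pmf D \<subseteq> cube n" and k: "s 1 = k"
    and N1: "s 4 = N1" and R: "s 6 = R"
  shows "refines find_blocks_prog s
     ((k + 1) * (N1 * (13 * n + 50) + R * (11 * n + 40) + 4 * (k + 1) + 7 * n + 90) + 10) ((k + 1) * (N1 * 3 + R))
     (find_blocks n f D k N1 R)
     (\<lambda>(fnd, own, ws) t. t 9 = of_bool fnd \<and> stores n own ws t \<and> length ws \<le> k + 1 \<and> (\<forall>r<7. t r = s r))"
proof -
  let ?T = "N1 * (13 * n + 50) + R * (11 * n + 40) + 4 * (k + 1) + 7 * n + 80"
  let ?I = "\<lambda>i (fnd, own, ws) t. t 9 = of_bool fnd \<and> stores n own ws t \<and> length ws \<le> i \<and> (\<forall>r<7. t r = s r)"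
  have "refines (For 7 (Add (V 1) (Const 1)) epoch_prog) (s(9 := 1)) ((k + 1) * (?T + 3) + 3) ((k + 1) * (N1 * 3 + R))
     (find_blocks n f D k N1 R) (?I (k + 1))"
    unfolding find_blocks_def
  proof (rule refines_For[where I = ?I], goal_cases)
    case 1
    show ?case using st by (auto simp: stores_def)
  next
    case (2 i p t)
    then show ?case using k by auto
  next
    case (3 i p t)
    obtain fnd own ws where p: "p = (fnd, own, ws)" by (cases p)
    have "refines epoch_prog t ?T (N1 * 3 + R) (epoch n f D N1 R (fnd, own, ws))
       (\<lambda>(fnd', own', ws') t'. t' 9 = of_bool fnd' \<and> stores n own' ws' t' \<and> (\<forall>r<8. t' r = t r))"
      using 3 N1 R D by (intro refines_epoch) (auto simp: p)
    then show ?case unfolding p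
    proof (rule refines_weaken)
      fix p' t' assume p': "p' \<in> set_pmf (epoch n f D N1 R (fnd, own, ws))"
        and a: "(\<lambda>(fnd', own', ws') t'. t' 9 = of_bool fnd' \<and> stores n own' ws' t' \<and> (\<forall>r<8. t' r = t r)) p' t'"
      obtain fnd' own' ws' where e: "p' = (fnd', own', ws')" by (cases p')
      have "length ws' \<le> Suc (length ws)"
        using p' unfolding e epoch_def by (auto simp: add_block_def split: if_splits option.splits)
      then show "t' 7 = i \<and> ?I (Suc i) p' (t'(7 := Suc i))"
        using a 3 by (auto simp: e p stores_def holds_point_def)
    qed auto
  next
    case (4 p t)
    show ?case using 4(1) .
  qed
  then have "refines find_blocks_prog s (((k + 1) * (?T + 3) + 3) + 2) ((k + 1) * (N1 * 3 + R))
     (find_blocks n f D k N1 R) (?I (k + 1))"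
    unfolding find_blocks_prog_def by (intro refines_Assign_Seq) simp
  then show ?thesis by (rule refines_time) (auto simp: algebra_simps)
qed

end

subsection \<open>The complete program\<close>

text \<open>The bit length, defined by the very recursion that the doubling loop of
  \<open>setup_prog\<close> performs.\<close>

primrec width :: "nat \<Rightarrow> nat" where
  "width 0 = 0"
| "width (Suc i) = (if Suc i < 2 ^ width i then width i else Suc (width i))"

lemma width: "i < 2 ^ width i" "2 ^ width i \<le> 2 * i + 1" "width i \<le> i"
  by (induction i) auto

text \<open>During the loop register 10 holds \<open>2 ^ W\<close> for the current width
  \<open>W\<close> in register 3. The number of table rows is computed as \<open>4 * k\<close> times
  the number of samples per epoch.\<close>

definition setup_prog :: cmd where
  "setup_prog = Seq (Assign (Const 10) (Const 1)) (Seq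
     (For 11 (Add (V 1) (V 2)) (If (Sub (V 10) (Add (V 11) (Const 1))) Skip
       (Seq (Assign (Const 10) (dbl (V 10))) (Assign (Const 3) (Add (V 3) (Const 1))))))
     (Seq (mul 4 10 (V 2) (V 3)) (Seq (Assign (Const 4) (dbl (dbl (dbl (dbl (V 4)))))) (Seq
     (mul 5 10 (V 1) (V 4)) (Seq (Assign (Const 5) (dbl (dbl (V 5))))
     (Assign (Const 6) (Add (dbl (dbl (V 3))) (Const 10))))))))"

text \<open>Adding register 22 to register 9 merges the flags of the block search and of the
  readings: the sum is nonzero if either is set. Otherwise the final scan decides, rejecting only if
  both labels survive.\<close>

definition main_prog :: cmd where
  "main_prog = Seq setup_prog (Seq find_blocks_prog (Seq check_blocks_prog (Seq read_table_prog
     (Seq (Assign (Const 9) (Add (V 9) (V 22))) (Seq fit_prog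
       (If (V 9) (Assign (Const 0) (Const 0)) (If (V 13) (If (V 14)
         (Assign (Const 0) (Const 0)) (Assign (Const 0) (Const 1))) (Assign (Const 0) (Const 1)))))))))"

text \<open>The input integer is 0 exactly for \<open>\<epsilon> > 1\<close>; accepting at once is
  then correct, because no function is that far from the class.\<close>

definition tester_prog :: cmd where
  "tester_prog = If (V 2) main_prog (Assign (Const 0) (Const 1))"

abbreviation init_memory :: "nat \<Rightarrow> nat \<Rightarrow> nat \<Rightarrow> memory" where
  "init_memory n k N \<equiv> (\<lambda>_. 0)(0 := n, 1 := k, 2 := N)"

definition total_time :: "nat \<Rightarrow> nat \<Rightarrow> nat \<Rightarrow> nat \<Rightarrow> nat \<Rightarrow> nat \<Rightarrow> nat" where
  "total_time n k N N1 m R = 20 * (k + N) + 100 +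
     ((k + 1) * (N1 * (13 * n + 50) + R * (11 * n + 40) + 4 * (k + 1) + 7 * n + 90) + 10) +
     ((k + 1) * (1000 * (16 * (k + 1) + 100 * n + 203) + 6) + 5) +
     (m * ((k + 1) * ((R + 1) * (4 * (k + 1) + 20 * n + 50) + 6) + 9 * n + 4 * m + 40) + 3) +
     (k * ((k + 1) * (m * (16 * m + 60) + 50) + 6) + m * (4 * m + 20) + 20)"

text \<open>The last summand dominates: \<open>m\<close> rows, at most \<open>k + 1\<close> columns
  and \<open>R + 1\<close> readings of two queries each, where \<open>m\<close> is of order
  \<open>k / \<epsilon>\<close> up to logarithms.\<close>

definition total_queries :: "nat \<Rightarrow> nat \<Rightarrow> nat \<Rightarrow> nat \<Rightarrow> nat" where
  "total_queries k N1 m R = (k + 1) * (N1 * 3 + R) + (k + 1) * 8000 + m * (2 + (k + 1) * (2 * (R + 1)))"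

context oracles begin

lemma refines_setup:
  fixes k N
  defines "W \<equiv> width (k + N)"
  shows "refines setup_prog (init_memory n k N) (20 * (k + N) + 80) 0 (return_pmf ())
     (\<lambda>_ t. stores n (\<lambda>_. 0) [] t \<and> t 1 = k \<and> t 4 = 16 * N * W \<and> t 5 = 64 * k * N * W \<and> t 6 = 4 * W + 10)"
proof -
  let ?s = "init_memory n k N"
  let ?I = "\<lambda>i (_::unit) t. t = ?s(3 := width i, 10 := 2 ^ width i, 11 := i)"
  let ?rest = "Seq (mul 4 10 (V 2) (V 3)) (Seq (Assign (Const 4) (dbl (dbl (dbl (dbl (V 4)))))) (Seq
     (mul 5 10 (V 1) (V 4)) (Seq (Assign (Const 5) (dbl (dbl (V 5))))
     (Assign (Const 6) (Add (dbl (dbl (V 3))) (Const 10))))))"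
  let ?post = "\<lambda>(_::unit) t. stores n (\<lambda>_. 0) [] t \<and> t 1 = k \<and> t 4 = 16 * N * W \<and> t 5 = 64 * k * N * W \<and> t 6 = 4 * W + 10"
  have loop: "refines (For 11 (Add (V 1) (V 2)) (If (Sub (V 10) (Add (V 11) (Const 1))) Skip
       (Seq (Assign (Const 10) (dbl (V 10))) (Assign (Const 3) (Add (V 3) (Const 1))))))
     (?s(10 := 1)) ((k + N) * (4 + 3) + 3) ((k + N) * 0) (iter_pmf (k + N) 0 (\<lambda>_. return_pmf) ()) (?I (k + N))"
  proof (rule refines_For[where I = ?I], goal_cases)
    case 1
    show ?case by (auto intro!: ext)
  next
    case (3 i p t)
    then have t: "t = ?s(3 := width i, 10 := 2 ^ width i, 11 := i)" by blast
    show ?case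
      by (rule refines_time[OF refines_If[OF refines_Skip refines_Assign_Seq[OF refines_Assign]]])
        (auto simp: t intro!: ext)
  next
    case (4 p t)
    show ?case using 4(1) .
  qed simp
  have rest: "refines ?rest t ((4 * N + 5) + (((4 * k + 5) + (1 + 2) + 1) + 2) + 1) (0 + (0 + 0)) (return_pmf ()) ?post"
    if t: "t = ?s(3 := W, 10 := 2 ^ W, 11 := k + N)" for t
  proof (rule refines_Seq_return)
    let ?t1 = "t(4 := N * W, 10 := N)"
    show "refines (mul 4 10 (V 2) (V 3)) t (4 * N + 5) 0 (return_pmf ()) (\<lambda>_ t'. t' = ?t1)"
      by (rule refines_time[OF refines_mul]) (use t in auto)
    fix t1 assume t1: "t1 = ?t1"
    let ?t2 = "t1(4 := 16 * N * W)"
    let ?t3 = "?t2(5 := k * (16 * N * W), 10 := k)"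
    have "refines (Seq (mul 5 10 (V 1) (V 4)) (Seq (Assign (Const 5) (dbl (dbl (V 5))))
       (Assign (Const 6) (Add (dbl (dbl (V 3))) (Const 10))))) ?t2 ((4 * k + 5) + (1 + 2) + 1) (0 + 0) (return_pmf ()) ?post"
    proof (rule refines_Seq_return)
      show "refines (mul 5 10 (V 1) (V 4)) ?t2 (4 * k + 5) 0 (return_pmf ()) (\<lambda>_ t'. t' = ?t3)"
        by (rule refines_time[OF refines_mul]) (use t t1 in auto)
      fix t3 assume t3: "t3 = ?t3"
      show "refines (Seq (Assign (Const 5) (dbl (dbl (V 5)))) (Assign (Const 6) (Add (dbl (dbl (V 3))) (Const 10)))) t3
         (1 + 2) 0 (return_pmf ()) ?post"
        by (rule refines_Assign_Seq, rule refines_Assign) (auto simp: t t1 t3 stores_def)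
    qed
    moreover have "t1(eval (Const 4) t1 := eval (dbl (dbl (dbl (dbl (V 4))))) t1) = ?t2"
      using t1 by (simp add: mult.assoc)
    ultimately show "refines (Seq (Assign (Const 4) (dbl (dbl (dbl (dbl (V 4)))))) (Seq
       (mul 5 10 (V 1) (V 4)) (Seq (Assign (Const 5) (dbl (dbl (V 5))))
       (Assign (Const 6) (Add (dbl (dbl (V 3))) (Const 10)))))) t1 (((4 * k + 5) + (1 + 2) + 1) + 2) (0 + 0) (return_pmf ()) ?post"
      by (intro refines_Assign_Seq) (simp only:)
  qed
  have "refines setup_prog ?s (((k + N) * (4 + 3) + 3) + ((4 * N + 5) + (((4 * k + 5) + (1 + 2) + 1) + 2) + 1) + 1 + 2)
     ((k + N) * 0 + (0 + (0 + 0))) (return_pmf ()) ?post"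
    unfolding setup_prog_def
  proof (rule refines_Assign_Seq)
    have "?s(eval (Const 10) ?s := eval (Const 1) ?s) = ?s(10 := 1)" by simp
    then show "refines (Seq (For 11 (Add (V 1) (V 2)) (If (Sub (V 10) (Add (V 11) (Const 1))) Skip
       (Seq (Assign (Const 10) (dbl (V 10))) (Assign (Const 3) (Add (V 3) (Const 1)))))) ?rest)
       (?s(eval (Const 10) ?s := eval (Const 1) ?s)) (((k + N) * (4 + 3) + 3) + ((4 * N + 5) + (((4 * k + 5) + (1 + 2) + 1) + 2) + 1) + 1)
       ((k + N) * 0 + (0 + (0 + 0))) (return_pmf ()) ?post"
      by (simp only:) (rule refines_Seq_return[OF loop[unfolded iter_pmf_constant[of 0 "k + N" "\<lambda>_. return_pmf", OF refl]] rest],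
        simp only: W_def)
  qed
  then show ?thesis by (rule refines_time) auto
qed

lemma refines_main:
  fixes k N
  defines "W \<equiv> width (k + N)"
  defines "N1 \<equiv> 16 * N * W" and "m \<equiv> 64 * k * N * W" and "R \<equiv> 4 * W + 10"
  assumes D: "set_pmf D \<subseteq> cube n"
  shows "refines main_prog (init_memory n k N) (total_time n k N N1 m R) (total_queries k N1 m R)
     (tester n f D k N1 m R) (\<lambda>b t. t 0 \<noteq> 0 \<longleftrightarrow> b)"
proof -
  let ?post = "\<lambda>b t. t 0 \<noteq> (0::nat) \<longleftrightarrow> b"
  let ?z = "\<lambda>own x. f (zero_outside n own x)"
  let ?last = "If (V 9) (Assign (Const 0) (Const 0)) (If (V 13) (If (V 14)
         (Assign (Const 0) (Const 0)) (Assign (Const 0) (Const 1))) (Assign (Const 0) (Const 1)))"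
  let ?T2 = "(k + 1) * (N1 * (13 * n + 50) + R * (11 * n + 40) + 4 * (k + 1) + 7 * n + 90) + 10"
  let ?T3 = "(k + 1) * (1000 * (16 * (k + 1) + 100 * n + 203) + 6) + 5"
  let ?T4 = "m * ((k + 1) * ((R + 1) * (4 * (k + 1) + 20 * n + 50) + 6) + 9 * n + 4 * m + 40) + 3"
  let ?T5 = "k * ((k + 1) * (m * (16 * m + 60) + 50) + 6) + m * (4 * m + 20) + 20"
  let ?Q4 = "m * (2 + (k + 1) * (2 * (R + 1)))"
  have final: "refines (Seq (Assign (Const 9) (Add (V 9) (V 22))) (Seq fit_prog ?last)) t (?T5 + 4 + 1 + 2) (0 + 0)
      (return_pmf (\<not> fnd \<and> \<not> r \<and> greedy_fit tab q k)) ?post"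
    if tab: "tabled n q tab t" "length tab = m" and t: "t 9 = of_bool fnd" "t 22 = of_bool r" "t 1 = k" and q: "q \<le> k + 1"
    for fnd r tab q t
  proof -
    let ?t1 = "t(9 := of_bool fnd + of_bool r)"
    have tab1: "tabled n q tab ?t1" using tab by (auto simp: tabled_def)
    have fit: "refines fit_prog ?t1 ?T5 0 (return_pmf ()) (\<lambda>_ t'. (t' 13 \<noteq> 0 \<and> t' 14 \<noteq> 0 \<longleftrightarrow> \<not> greedy_fit tab q k) \<and> frame n 10 {11} ?t1 t')"
    proof (rule refines_time[OF refines_fit[OF tab1, unfolded tab(2)]])
      show "k * (q * (m * (16 * m + 60) + 50) + 6) + m * (4 * m + 20) + 20 \<le> ?T5"
        by (intro add_mono mult_le_mono order_refl q)
    qed (use t in auto)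
    have "refines (Seq fit_prog ?last) ?t1 (?T5 + 4 + 1) (0 + 0) (return_pmf (\<not> fnd \<and> \<not> r \<and> greedy_fit tab q k)) ?post"
    proof (rule refines_Seq_return[OF fit])
      fix t2 assume t2: "(t2 13 \<noteq> 0 \<and> t2 14 \<noteq> 0 \<longleftrightarrow> \<not> greedy_fit tab q k) \<and> frame n 10 {11} ?t1 t2"
      then have 9: "t2 9 = of_bool fnd + of_bool r" using frame_reg[of n 10 "{11}" ?t1 t2 9] by simp
      show "refines ?last t2 4 0 (return_pmf (\<not> fnd \<and> \<not> r \<and> greedy_fit tab q k)) ?post"
        by (rule refines_time[OF refines_If[OF refines_Assign refines_If[OF refines_If[OF refines_Assign refines_Assign] refines_Assign]]])
          (use t2 9 in \<open>auto split: if_splits\<close>)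
    qed
    moreover have "t(eval (Const 9) t := eval (Add (V 9) (V 22)) t) = ?t1" using t by simp
    ultimately show ?thesis by (intro refines_Assign_Seq) (simp only:)
  qed
  have table: "refines (Seq read_table_prog (Seq (Assign (Const 9) (Add (V 9) (V 22))) (Seq fit_prog ?last))) t
      (?T4 + (?T5 + 4 + 1 + 2) + 1) (?Q4 + (0 + 0))
      (bind_pmf (read_table n D (?z own) (block_fun n f own ws) (length ws) R m r)
        (\<lambda>(r', tab). return_pmf (\<not> fnd \<and> \<not> r' \<and> greedy_fit tab (length ws) k))) ?post"
    if st: "stores n own ws t" and t: "t 22 = of_bool r" "t 5 = m" "t 6 = R" "t 9 = of_bool fnd" "t 1 = k"
      and q: "length ws \<le> k + 1" for own ws r fnd t
  proof (rule refines_Seq)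
    show "refines read_table_prog t ?T4 ?Q4 (read_table n D (?z own) (block_fun n f own ws) (length ws) R m r)
     (\<lambda>(r', tab) t'. t' 22 = of_bool r' \<and> length tab = m \<and>
        (\<forall>i<m. t' (loc n 10 i) = of_bool (snd (tab ! i))) \<and>
        (\<forall>i<m. \<forall>j<length ws. t' (loc n 9 (i * length ws + j)) = of_bool (fst (tab ! i) ! j)) \<and>
        frame n 18 {6, 9, 10} t t')"
      by (rule refines_time[OF refines_read_table[OF st t(1) D t(2,3)]])
        (intro add_mono mult_le_mono order_refl q)+
    fix rt t' assume a: "(\<lambda>(r', tab) t'. t' 22 = of_bool r' \<and> length tab = m \<and>
        (\<forall>i<m. t' (loc n 10 i) = of_bool (snd (tab ! i))) \<and>
        (\<forall>i<m. \<forall>j<length ws. t' (loc n 9 (i * length ws + j)) = of_bool (fst (tab ! i) ! j)) \<and>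
        frame n 18 {6, 9, 10} t t') rt t'"
    obtain r' tab where rt: "rt = (r', tab)" by (cases rt)
    have fr: "frame n 18 {6, 9, 10} t t'" using a by (simp add: rt)
    have regs: "t' 0 = n" "t' 5 = m" "t' 8 = length ws" "t' 9 = of_bool fnd" "t' 1 = k"
      using frame_reg[OF fr] t st by (auto simp: stores_def)
    show "refines (Seq (Assign (Const 9) (Add (V 9) (V 22))) (Seq fit_prog ?last)) t' (?T5 + 4 + 1 + 2) (0 + 0)
       (case rt of (r', tab) \<Rightarrow> return_pmf (\<not> fnd \<and> \<not> r' \<and> greedy_fit tab (length ws) k)) ?post"
      unfolding rt prod.case
      by (rule final) (use a regs q in \<open>auto simp: rt tabled_def\<close>)
  qed
  let ?tail = "Seq check_blocks_prog (Seq read_table_prog (Seq (Assign (Const 9) (Add (V 9) (V 22))) (Seq fit_prog ?last)))"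
  have verdict: "refines ?tail t (?T3 + (?T4 + (?T5 + 4 + 1 + 2) + 1) + 1) ((k + 1) * 8000 + (?Q4 + (0 + 0)))
     (verdict n f D k m R (fnd, own, ws)) ?post"
    if st: "stores n own ws t" and t: "t 5 = m" "t 6 = R" "t 9 = of_bool fnd" "t 1 = k"
      and q: "length ws \<le> k + 1" for own ws fnd t
    unfolding verdict_def prod.case
  proof (rule refines_Seq)
    show "refines check_blocks_prog t ?T3 ((k + 1) * 8000) (check_blocks n (block_fun n f own ws) (length ws))
      (\<lambda>r t'. t' 22 = of_bool r \<and> frame n 20 {6, 7, 8} t t')"
      by (rule refines_time[OF refines_check_blocks[OF st]])
        (intro add_mono mult_le_mono order_refl q)+
    fix r t' assume a: "t' 22 = of_bool r \<and> frame n 20 {6, 7, 8} t t'"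
    then have fr: "frame n 20 {6, 7, 8} t t'" by blast
    show "refines (Seq read_table_prog (Seq (Assign (Const 9) (Add (V 9) (V 22))) (Seq fit_prog ?last))) t'
      (?T4 + (?T5 + 4 + 1 + 2) + 1) (?Q4 + (0 + 0))
      (bind_pmf (read_table n D (?z own) (block_fun n f own ws) (length ws) R m r)
        (\<lambda>(r', tab). return_pmf (\<not> fnd \<and> \<not> r' \<and> greedy_fit tab (length ws) k))) ?post"
      by (rule table) (use a stores_frame[OF st fr] frame_reg[OF fr] t q in auto)
  qed
  have "refines main_prog (init_memory n k N)
     ((20 * (k + N) + 80) + (?T2 + (?T3 + (?T4 + (?T5 + 4 + 1 + 2) + 1) + 1) + 1) + 1)
     (0 + ((k + 1) * (N1 * 3 + R) + ((k + 1) * 8000 + (?Q4 + (0 + 0)))))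
     (tester n f D k N1 m R) ?post"
    unfolding main_prog_def tester_def
  proof (rule refines_Seq_return[OF refines_setup])
    fix t assume t: "stores n (\<lambda>_. 0) [] t \<and> t 1 = k \<and> t 4 = 16 * N * width (k + N) \<and>
      t 5 = 64 * k * N * width (k + N) \<and> t 6 = 4 * width (k + N) + 10"
    show "refines (Seq find_blocks_prog ?tail) t (?T2 + (?T3 + (?T4 + (?T5 + 4 + 1 + 2) + 1) + 1) + 1)
      ((k + 1) * (N1 * 3 + R) + ((k + 1) * 8000 + (?Q4 + (0 + 0))))
      (bind_pmf (find_blocks n f D k N1 R) (verdict n f D k m R)) ?post"
    proof (rule refines_Seq)
      show "refines find_blocks_prog t ?T2 ((k + 1) * (N1 * 3 + R)) (find_blocks n f D k N1 R)
       (\<lambda>(fnd, own, ws) t'. t' 9 = of_bool fnd \<and> stores n own ws t' \<and> length ws \<le> k + 1 \<and> (\<forall>r<7. t' r = t r))"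
        by (rule refines_find_blocks) (use t D in \<open>auto simp: N1_def R_def W_def\<close>)
      fix p t' assume a: "(\<lambda>(fnd, own, ws) t'. t' 9 = of_bool fnd \<and> stores n own ws t' \<and> length ws \<le> k + 1 \<and> (\<forall>r<7. t' r = t r)) p t'"
      obtain fnd own ws where p: "p = (fnd, own, ws)" by (cases p)
      show "refines ?tail t' (?T3 + (?T4 + (?T5 + 4 + 1 + 2) + 1) + 1) ((k + 1) * 8000 + (?Q4 + (0 + 0)))
         (verdict n f D k m R p) ?post"
        unfolding p by (rule verdict) (use a t in \<open>auto simp: p m_def R_def W_def\<close>)
    qed
  qed
  then show ?thesis
    by (rule refines_time) (auto simp: total_time_def total_queries_def)
qed

text \<open>The abstract verdict is a marginal of the coupling and register 0 reflects it, so both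
  probabilities and the worst-case bounds transfer to the machine.\<close>

lemma refines_run:
  assumes "refines c s T Q a (\<lambda>b t. t 0 \<noteq> 0 \<longleftrightarrow> b)"
  shows "measure_pmf.prob (run n f D T ([c], s, 0)) {c. accepting c} = measure_pmf.prob a {True}"
    and "measure_pmf.prob (run n f D T ([c], s, 0)) {c. rejecting c} = measure_pmf.prob a {False}"
    and "c' \<in> set_pmf (run n f D T ([c], s, 0)) \<Longrightarrow> halted c' \<and> query_count c' \<le> Q"
proof -
  obtain M where M: "\<And>q. reaches c (s, q) T (map_pmf (\<lambda>(x, s', d). (s', q + d)) M)"
    "map_pmf fst M = a" "\<And>x s' d. (x, s', d) \<in> set_pmf M \<Longrightarrow> (s' 0 \<noteq> 0 \<longleftrightarrow> x) \<and> d \<le> Q"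
    using assms by (rule refinesE) blast
  have run: "run n f D T ([c], s, 0) = map_pmf (\<lambda>(x, s', d). ([], s', d)) M"
    using reaches_run[OF M(1), of 0] by (simp add: pmf.map_comp o_def split_def)
  have "measure_pmf.prob M ((\<lambda>(x, s', d). ([], s', d)) -` {c. accepting c}) = measure_pmf.prob M (fst -` {True})"
    by (rule measure_pmf.finite_measure_eq_AE)
      (auto simp: AE_measure_pmf_iff accepting_def halted_def dest: M(3))
  then show "measure_pmf.prob (run n f D T ([c], s, 0)) {c. accepting c} = measure_pmf.prob a {True}"
    by (simp add: run M(2)[symmetric])
  have "measure_pmf.prob M ((\<lambda>(x, s', d). ([], s', d)) -` {c. rejecting c}) = measure_pmf.prob M (fst -` {False})"
    by (rule measure_pmf.finite_measure_eq_AE)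
      (auto simp: AE_measure_pmf_iff rejecting_def halted_def dest: M(3))
  then show "measure_pmf.prob (run n f D T ([c], s, 0)) {c. rejecting c} = measure_pmf.prob a {False}"
    by (simp add: run M(2)[symmetric])
  show "c' \<in> set_pmf (run n f D T ([c], s, 0)) \<Longrightarrow> halted c' \<and> query_count c' \<le> Q"
    using M(3) by (auto simp: run halted_def query_count_def)
qed

end

subsection \<open>Resource bounds and choice of the parameters\<close>

text \<open>Polynomial boundedness in one variable, closed under the operations of
  \<open>total_time\<close>. Several arguments are treated by monotonicity, each being replaced by
  one common upper bound.\<close>

definition dominated :: "(nat \<Rightarrow> nat) \<Rightarrow> bool" where
  "dominated g \<longleftrightarrow> (\<exists>C d. \<forall>S\<ge>1. g S \<le> C * S ^ d)"

lemma dominated_const: "dominated (\<lambda>_. c)"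
  unfolding dominated_def by (rule exI[of _ c], rule exI[of _ 0]) simp

lemma dominated_id: "dominated (\<lambda>S. S)"
  unfolding dominated_def by (rule exI[of _ 1], rule exI[of _ 1]) simp

lemma dominated_add:
  assumes "dominated g" "dominated h"
  shows "dominated (\<lambda>S. g S + h S)"
proof -
  obtain C d C' d' where *: "\<And>S. S \<ge> 1 \<Longrightarrow> g S \<le> C * S ^ d" "\<And>S. S \<ge> 1 \<Longrightarrow> h S \<le> C' * S ^ d'"
    using assms unfolding dominated_def by blast
  have "g S + h S \<le> (C + C') * S ^ (d + d')" if "S \<ge> 1" for S
  proof -
    have "S ^ d \<le> S ^ (d + d')" "S ^ d' \<le> S ^ (d + d')" using that by (auto intro: power_increasing)
    then have "C * S ^ d + C' * S ^ d' \<le> C * S ^ (d + d') + C' * S ^ (d + d')"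
      by (intro add_mono mult_le_mono) auto
    then show ?thesis using *[OF that] by (simp add: algebra_simps)
  qed
  then show ?thesis unfolding dominated_def by blast
qed

lemma dominated_mult:
  assumes "dominated g" "dominated h"
  shows "dominated (\<lambda>S. g S * h S)"
proof -
  obtain C d C' d' where *: "\<And>S. S \<ge> 1 \<Longrightarrow> g S \<le> C * S ^ d" "\<And>S. S \<ge> 1 \<Longrightarrow> h S \<le> C' * S ^ d'"
    using assms unfolding dominated_def by blast
  have "g S * h S \<le> (C * C') * S ^ (d + d')" if "S \<ge> 1" for S
    using mult_le_mono[OF *[OF that]] by (simp add: power_add algebra_simps)
  then show ?thesis unfolding dominated_def by blast
qed

lemmas dominated_intros = dominated_const dominated_id dominated_add dominated_mult

definition main_time :: "nat \<Rightarrow> nat \<Rightarrow> nat \<Rightarrow> nat \<Rightarrow> nat" where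
  "main_time n k N W = total_time n k N (16 * N * W) (64 * k * N * W) (4 * W + 10)"

lemma main_time_bound: "\<exists>C d. \<forall>n k N. main_time n k N (width (k + N)) \<le> C * (n + k + N + 1) ^ d"
proof -
  have "dominated (\<lambda>S. main_time S S S S)"
    unfolding main_time_def total_time_def by (intro dominated_intros)
  then obtain C d where Cd: "\<And>S. S \<ge> 1 \<Longrightarrow> main_time S S S S \<le> C * S ^ d"
    unfolding dominated_def by blast
  have "main_time n k N (width (k + N)) \<le> C * (n + k + N + 1) ^ d" for n k N
  proof -
    let ?S = "n + k + N + 1" and ?W = "width (k + N)"
    have le: "n \<le> ?S" "k \<le> ?S" "N \<le> ?S" "?W \<le> ?S" using width(3)[of "k + N"] by auto
    have "main_time n k N ?W \<le> main_time ?S ?S ?S ?S"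
      unfolding main_time_def total_time_def
      by (intro add_mono mult_le_mono order_refl le)
    also have "\<dots> \<le> C * ?S ^ d" by (rule Cd) simp
    finally show ?thesis .
  qed
  then show ?thesis by blast
qed

definition main_queries :: "nat \<Rightarrow> nat \<Rightarrow> nat \<Rightarrow> nat" where
  "main_queries k N W = total_queries k (16 * N * W) (64 * k * N * W) (4 * W + 10)"

text \<open>With \<open>k + 1 \<le> 2 * k\<close> and \<open>4 * W + 11 \<le> 15 * W\<close> the
  three phases cost at most 124, 16000 and 3968 times
  \<open>N * k\<^sup>2 * W\<^sup>2\<close>.\<close>

lemma main_queries_bound:
  assumes "k \<ge> 1" "N \<ge> 1" "W \<ge> 1"
  shows "main_queries k N W \<le> 21000 * (N * k\<^sup>2 * W\<^sup>2)"
proof -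
  have k: "k + 1 \<le> 2 * k" and R: "4 * W + 10 \<le> 14 * W" "4 * W + 10 + 1 \<le> 15 * W" using assms by auto
  have W: "W \<le> W\<^sup>2" and kk: "k \<le> k\<^sup>2" using assms by (simp_all add: power2_eq_square)
  have kW: "k * W \<le> N * k\<^sup>2 * W\<^sup>2"
    using mult_le_mono[OF mult_le_mono[OF assms(2) kk] W] by simp
  have NkW: "k * (N * W) \<le> N * k\<^sup>2 * W\<^sup>2"
    using mult_le_mono[OF mult_le_mono[OF order_refl[of N] kk] W] by (simp add: ac_simps)
  have "(k + 1) * (16 * N * W * 3 + (4 * W + 10)) \<le> (2 * k) * (16 * N * W * 3 + 14 * W)"
    using k R by (intro mult_le_mono add_mono) auto
  also have "\<dots> = 96 * (k * (N * W)) + 28 * (k * W)" by (simp add: algebra_simps)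
  also have "\<dots> \<le> 124 * (N * k\<^sup>2 * W\<^sup>2)" using kW NkW by linarith
  finally have 1: "(k + 1) * (16 * N * W * 3 + (4 * W + 10)) \<le> 124 * (N * k\<^sup>2 * W\<^sup>2)" .
  have "k \<le> k * W" using assms by simp
  then have "k \<le> N * k\<^sup>2 * W\<^sup>2" using kW by (rule le_trans)
  then have "16000 * k \<le> 16000 * (N * k\<^sup>2 * W\<^sup>2)" by (rule mult_le_mono2)
  moreover have "(k + 1) * 8000 \<le> 16000 * k" using k by simp
  ultimately have 2: "(k + 1) * 8000 \<le> 16000 * (N * k\<^sup>2 * W\<^sup>2)" by (rule le_trans[rotated])
  have "2 + (k + 1) * (2 * (4 * W + 10 + 1)) \<le> 2 * (k * W) + (2 * k) * (2 * (15 * W))"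
    using k R assms by (intro add_mono mult_le_mono) auto
  also have "\<dots> = 62 * (k * W)" by simp
  finally have "64 * k * N * W * (2 + (k + 1) * (2 * (4 * W + 10 + 1))) \<le> 64 * k * N * W * (62 * (k * W))"
    by (rule mult_le_mono2)
  also have "\<dots> = 3968 * (N * k\<^sup>2 * W\<^sup>2)" by (simp add: power2_eq_square)
  finally show ?thesis using 1 2 unfolding main_queries_def total_queries_def by linarith
qed

text \<open>From \<open>2 ^ W \<le> 4 * (T + 2)\<close> and \<open>ln 2 \<le> ln (T + 2)\<close>
  follows \<open>W * ln 2 \<le> 3 * ln (T + 2)\<close>; the crude bound
  \<open>ln 2 \<ge> 1 / 2\<close> doubles the constant to 6.\<close>

lemma width_le_ln:
  assumes "real (k + N) \<le> 2 * T" "T \<ge> 1"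
  shows "real (width (k + N)) \<le> 6 * ln (T + 2)"
proof -
  let ?W = "width (k + N)"
  have ln2: "ln 2 \<ge> (1 / 2 :: real)"
    using ln_add_one_self_le_self2[of "-1/2"] by (simp add: ln_div)
  have "2 ^ ?W \<le> 2 * (k + N) + 1" by (rule width(2))
  then have "real (2 ^ ?W) \<le> real (2 * (k + N) + 1)" by (simp only: of_nat_le_iff)
  also have "\<dots> \<le> 4 * (T + 2)" using assms by simp
  finally have "ln (2 ^ ?W) \<le> ln (4 * (T + 2))" using assms by simp
  also have "\<dots> = 2 * ln 2 + ln (T + 2)"
    using assms ln_realpow[of 2 2] by (subst ln_mult) auto
  also have "\<dots> \<le> 3 * ln (T + 2)"
    using assms by simp
  finally have "real ?W * ln 2 \<le> 3 * ln (T + 2)" by (simp add: ln_realpow)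
  moreover have "real ?W * (1 / 2) \<le> real ?W * ln 2" using ln2 by (intro mult_left_mono) auto
  ultimately show ?thesis by linarith
qed

lemma width_pos: "k \<ge> 1 \<Longrightarrow> width (k + N) \<ge> 1"
  using width(1)[of "k + N"] by (cases "width (k + N)") auto

text \<open>\<open>k < 2 ^ W\<close> bounds the polynomial factor by \<open>2 ^ (3 * W)\<close>, and
  the exponent \<open>4 * W + 10\<close> leaves a surplus of \<open>W + 10\<close> halvings.\<close>

lemma parameters_complete:
  fixes k N
  defines "W \<equiv> width (k + N)"
  shows "real (k + 1) * (real (k * k) * (1 / 2) ^ (4 * W + 10)) \<le> 1 / 3"
proof -
  have "k < 2 ^ W" using width(1)[of "k + N"] by (simp add: W_def)
  then have k: "k + 1 \<le> 2 ^ W" "k \<le> 2 ^ W" by auto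
  have "(k + 1) * (k * k) \<le> 2 ^ W * (2 ^ W * 2 ^ W)" using k by (intro mult_le_mono)
  then have "real ((k + 1) * (k * k)) \<le> real (2 ^ W * (2 ^ W * 2 ^ W))" by (simp only: of_nat_le_iff)
  moreover have "(2::real) ^ W * (2 ^ W * 2 ^ W) = 2 ^ (3 * W)"
    by (simp add: mult.commute[of 3] power_mult power3_eq_cube)
  ultimately have "real (k + 1) * real (k * k) \<le> 2 ^ (3 * W)"
    by (simp only: of_nat_mult of_nat_power of_nat_numeral)
  then have "real (k + 1) * real (k * k) * (1 / 2) ^ (4 * W + 10) \<le> 2 ^ (3 * W) * (1 / 2) ^ (4 * W + 10)"
    by (intro mult_right_mono) auto
  also have "\<dots> = (1 / 2) ^ (W + 10)"
    by (simp add: power_divide power_add[symmetric] divide_simps)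
  also have "\<dots> \<le> (1 / 2) ^ 10" by (rule power_decreasing) auto
  also have "\<dots> \<le> 1 / 3" by (simp add: power_divide)
  finally show ?thesis by (simp only: mult.assoc)
qed

text \<open>Since \<open>N\<close> is at least \<open>1 / (2 * \<epsilon>)\<close>, the sample
  numbers yield \<open>4 * W\<close> halvings against \<open>k + 1 \<le> 2 ^ W\<close>, and
  \<open>8 * k * W\<close> halvings against \<open>(4 * k + 1) ^ k \<le> 2 ^ (3 * k * W)\<close>.
  Moreover \<open>N \<le> 2 ^ W\<close> bounds \<epsilon> from below, which lets the number of
  readings absorb the factor \<open>\<epsilon> / 4\<close>.\<close>

lemma parameters_sound:
  fixes k N :: nat and \<epsilon> :: real
  defines "W \<equiv> width (k + N)"
  assumes "k \<ge> 1" "N \<ge> 1" and \<epsilon>: "0 < \<epsilon>" "\<epsilon> \<le> 1" "1 / 2 \<le> \<epsilon> * real N"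
  shows "real (k + 1) * (1 - \<epsilon> / 2) ^ (16 * N * W) \<le> 1 / 8"
    and "real k * (1 / 100) ^ (4 * W + 10) \<le> \<epsilon> / 4"
    and "2 * (4 * real k + 1) ^ k * (1 - \<epsilon> / 4) ^ (64 * k * N * W) \<le> 1 / 8"
proof -
  have W: "W \<ge> 1" using width_pos[OF assms(2)] by (simp add: W_def)
  have "k + N < 2 ^ W" using width(1)[of "k + N"] by (simp add: W_def)
  then have kN: "k + 1 \<le> 2 ^ W" "k \<le> 2 ^ W" "N \<le> 2 ^ W" by auto
  then have "real (k + 1) \<le> real (2 ^ W)" "real k \<le> real (2 ^ W)" "real N \<le> real (2 ^ W)"
    by (simp_all only: of_nat_le_iff)
  then have rk: "real (k + 1) \<le> 2 ^ W" "real k \<le> 2 ^ W" "real N \<le> 2 ^ W" by simp_all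
  have "real (4 * W) \<le> \<epsilon> / 2 * real (16 * N * W)"
    using mult_right_mono[OF \<epsilon>(3), of "8 * real W"] by (simp add: algebra_simps)
  then have "(1 - \<epsilon> / 2) ^ (16 * N * W) \<le> (1 / 2) ^ (4 * W)"
    using \<epsilon> by (intro power_one_minus_le) auto
  then have "real (k + 1) * (1 - \<epsilon> / 2) ^ (16 * N * W) \<le> 2 ^ W * (1 / 2) ^ (4 * W)"
    using rk \<epsilon> by (intro mult_mono) auto
  also have "\<dots> = (1 / 2) ^ (3 * W)"
    by (simp add: power_divide power_add[symmetric] divide_simps)
  also have "\<dots> \<le> (1 / 2) ^ 3" using W by (intro power_decreasing) auto
  finally show "real (k + 1) * (1 - \<epsilon> / 2) ^ (16 * N * W) \<le> 1 / 8" by (simp add: power_divide)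
  have "real k * (1 / 100) ^ (4 * W + 10) \<le> 2 ^ W * (1 / 2) ^ (4 * W + 10)"
    using rk by (intro mult_mono power_mono) auto
  also have "\<dots> = (1 / 2) ^ (3 * W + 10)"
    by (simp add: power_divide power_add[symmetric] divide_simps)
  also have "\<dots> \<le> (1 / 2) ^ (W + 3)" by (intro power_decreasing) auto
  also have "\<dots> \<le> \<epsilon> / 4"
  proof -
    have "1 / 2 \<le> \<epsilon> * 2 ^ W"
      using \<epsilon> rk(3) by (intro order_trans[OF \<epsilon>(3)] mult_left_mono) auto
    then show ?thesis by (simp add: power_divide power_add field_simps)
  qed
  finally show "real k * (1 / 100) ^ (4 * W + 10) \<le> \<epsilon> / 4" .
  have "real (8 * (k * W)) \<le> \<epsilon> / 4 * real (64 * k * N * W)"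
    using mult_right_mono[OF \<epsilon>(3), of "16 * (real k * real W)"] by (simp add: algebra_simps)
  then have p: "(1 - \<epsilon> / 4) ^ (64 * k * N * W) \<le> (1 / 2) ^ (8 * (k * W))"
    using \<epsilon> by (intro power_one_minus_le) auto
  have "4 * real k + 1 \<le> 4 * 2 ^ W" using rk(1) by simp
  also have "\<dots> = 2 ^ (W + 2)" by (simp add: power_add)
  also have "\<dots> \<le> 2 ^ (3 * W)" using W by (intro power_increasing) auto
  finally have "(4 * real k + 1) ^ k \<le> (2 ^ (3 * W)) ^ k" by (intro power_mono) auto
  also have "\<dots> = 2 ^ (3 * (k * W))" by (simp add: power_mult[symmetric] ac_simps)
  finally have "(4 * real k + 1) ^ k * (1 - \<epsilon> / 4) ^ (64 * k * N * W) \<le> 2 ^ (3 * (k * W)) * (1 / 2) ^ (8 * (k * W))"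
    using p \<epsilon> by (intro mult_mono) auto
  also have "\<dots> = (1 / 2) ^ (5 * (k * W))"
    by (simp add: power_divide power_add[symmetric] divide_simps)
  also have "\<dots> \<le> (1 / 2) ^ 5"
  proof (rule power_decreasing)
    have "1 * 1 \<le> k * W" using assms(2) W by (rule mult_le_mono)
    then show "5 \<le> 5 * (k * W)" by simp
  qed auto
  finally show "2 * (4 * real k + 1) ^ k * (1 - \<epsilon> / 4) ^ (64 * k * N * W) \<le> 1 / 8"
    by (simp add: power_divide)
qed

section \<open>Correctness, running time and query bound of the program\<close>

context oracles begin

lemma refines_tester_prog:
  fixes k N
  defines "W \<equiv> width (k + N)"
  assumes D: "set_pmf D \<subseteq> cube n"
  shows "refines tester_prog (init_memory n k N) (main_time n k N W + 2)
     (if N = 0 then 0 else main_queries k N W)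
     (if N = 0 then return_pmf True else tester n f D k (16 * N * W) (64 * k * N * W) (4 * W + 10))
     (\<lambda>b t. t 0 \<noteq> 0 \<longleftrightarrow> b)"
proof (cases "N = 0")
  case True
  have "refines tester_prog (init_memory n k N) (max 1 1 + 1) (max 0 0) (return_pmf True) (\<lambda>b t. t 0 \<noteq> 0 \<longleftrightarrow> b)"
    unfolding tester_prog_def by (rule refines_If) (use True in \<open>auto intro!: refines_Assign[simplified]\<close>)
  then have "refines tester_prog (init_memory n k N) (main_time n k N W + 2) 0 (return_pmf True) (\<lambda>b t. t 0 \<noteq> 0 \<longleftrightarrow> b)"
    by (rule refines_time) auto
  then show ?thesis unfolding True by simp
next
  case False
  let ?a = "tester n f D k (16 * N * W) (64 * k * N * W) (4 * W + 10)"
  have main: "refines main_prog (init_memory n k N) (main_time n k N W) (main_queries k N W) ?a (\<lambda>b t. t 0 \<noteq> 0 \<longleftrightarrow> b)"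
    using refines_main[OF D, of k N] by (simp add: main_time_def main_queries_def W_def)
  have "refines tester_prog (init_memory n k N) (max (main_time n k N W) (main_time n k N W) + 1)
      (max (main_queries k N W) (main_queries k N W)) ?a (\<lambda>b t. t 0 \<noteq> 0 \<longleftrightarrow> b)"
    unfolding tester_prog_def by (rule refines_If) (use False main in simp_all)
  then have "refines tester_prog (init_memory n k N) (main_time n k N W + 2) (main_queries k N W) ?a (\<lambda>b t. t 0 \<noteq> 0 \<longleftrightarrow> b)"
    by (rule refines_time) auto
  then show ?thesis by (simp only: False if_False)
qed

end

lemma exec_tester_prog:
  fixes n k :: nat and \<epsilon> :: real and f :: "bool list \<Rightarrow> bool" and D :: "bool list pmf"
  defines "N \<equiv> nat \<lfloor>1 / \<epsilon>\<rfloor>"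
  defines "W \<equiv> width (k + N)"
  defines "T \<equiv> main_time n k N W + 2"
  defines "a \<equiv> (if N = 0 then return_pmf True else tester n f D k (16 * N * W) (64 * k * N * W) (4 * W + 10))"
  assumes "admissible n k \<epsilon> D"
  shows "measure_pmf.prob (exec tester_prog n k \<epsilon> f D T) {c. accepting c} = measure_pmf.prob a {True}"
    and "measure_pmf.prob (exec tester_prog n k \<epsilon> f D T) {c. rejecting c} = measure_pmf.prob a {False}"
    and "c \<in> set_pmf (exec tester_prog n k \<epsilon> f D T) \<Longrightarrow>
      halted c \<and> query_count c \<le> (if N = 0 then 0 else main_queries k N W)"
proof -
  have D: "set_pmf D \<subseteq> cube n" using assms(5) by (simp add: admissible_def)
  have e: "exec tester_prog n k \<epsilon> f D T = run n f D T ([tester_prog], init_memory n k N, 0)"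
    by (simp add: exec_def init_def N_def)
  note r = oracles.refines_tester_prog[OF D, of f k N, folded W_def, folded T_def a_def]
  show "measure_pmf.prob (exec tester_prog n k \<epsilon> f D T) {c. accepting c} = measure_pmf.prob a {True}"
    unfolding e by (rule oracles.refines_run(1)[OF r])
  show "measure_pmf.prob (exec tester_prog n k \<epsilon> f D T) {c. rejecting c} = measure_pmf.prob a {False}"
    unfolding e by (rule oracles.refines_run(2)[OF r])
  show "c \<in> set_pmf (exec tester_prog n k \<epsilon> f D T) \<Longrightarrow>
      halted c \<and> query_count c \<le> (if N = 0 then 0 else main_queries k N W)"
    unfolding e by (rule oracles.refines_run(3)[OF r])
qed

lemma prob_bool_compl: "measure_pmf.prob p {b} = 1 - measure_pmf.prob p {\<not> b}"
proof -
  have "{b} = UNIV - {\<not> b}" by auto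
  then show ?thesis using measure_pmf.prob_compl[of "{\<not> b}" p] by simp
qed

lemma tester_prog_correct: "distribution_free_tester tester_prog length_decision_list"
  unfolding distribution_free_tester_def
proof (intro allI impI conjI)
  fix n k \<epsilon> f D
  assume adm: "admissible n k \<epsilon> D"
  define N where "N = nat \<lfloor>1 / \<epsilon>\<rfloor>"
  define W where "W = width (k + N)"
  let ?t = "tester n f D k (16 * N * W) (64 * k * N * W) (4 * W + 10)"
  note ex = exec_tester_prog[OF adm, where f = f, folded N_def, folded W_def]
  from adm have D: "set_pmf D \<subseteq> cube n" and k: "k \<ge> 1" and \<epsilon>: "\<epsilon> > 0"
    by (auto simp: admissible_def)
  {
    assume f: "f \<in> length_decision_list n k"
    have "measure_pmf.prob ?t {False} \<le> 1 / 3"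
      using parameters_complete[of k N] by (intro tester_complete[OF D f]) (simp add: W_def)
    then have "2 / 3 \<le> measure_pmf.prob (if N = 0 then return_pmf True else ?t) {True}"
      using prob_bool_compl[of ?t True] by simp
    then show "\<exists>t. 2 / 3 \<le> measure_pmf.prob (exec tester_prog n k \<epsilon> f D t) {c. accepting c}"
      using ex(1) by metis
  next
    assume far: "far_from D \<epsilon> (length_decision_list n k) f"
    \<comment> \<open>A constant function is in the class, so being far from it forces
      \<open>\<epsilon> \<le> 1\<close> and hence \<open>N \<ge> 1\<close>.\<close>
    have "dl_eval [] True \<in> length_decision_list n k"
      unfolding length_decision_list_iff by (intro exI[of _ "[]"] exI[of _ True]) simp
    then have "\<epsilon> \<le> measure_pmf.prob D {x. f x \<noteq> dl_eval [] True x}"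
      using far unfolding far_from_def by blast
    then have \<epsilon>1: "\<epsilon> \<le> 1" using measure_pmf.prob_le_1 order_trans by blast
    have fl: "1 \<le> \<lfloor>1 / \<epsilon>\<rfloor>" using \<epsilon> \<epsilon>1 by (simp add: le_floor_iff)
    then have N: "N \<ge> 1" "real N = of_int \<lfloor>1 / \<epsilon>\<rfloor>" unfolding N_def by linarith+
    \<comment> \<open>Rounding \<open>1 / \<epsilon>\<close> down loses at most a factor 2.\<close>
    have "1 / \<epsilon> < real N + 1" unfolding N(2) by linarith
    also have "\<dots> \<le> 2 * real N" using N(1) by simp
    finally have "1 / 2 \<le> \<epsilon> * real N" using \<epsilon> by (simp add: field_simps)
    note par = parameters_sound[OF k N(1) \<epsilon> \<epsilon>1 this, folded W_def]
    have "measure_pmf.prob ?t {True} \<le> 1 / 4"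
      by (rule tester_sound[OF D far par \<epsilon> \<epsilon>1])
    then have "2 / 3 \<le> measure_pmf.prob (if N = 0 then return_pmf True else ?t) {False}"
      using prob_bool_compl[of ?t False] N(1) by simp
    then show "\<exists>t. 2 / 3 \<le> measure_pmf.prob (exec tester_prog n k \<epsilon> f D t) {c. rejecting c}"
      using ex(2) by metis
  }
qed

lemma real_nat_floor_le: "x \<ge> 0 \<Longrightarrow> real (nat \<lfloor>x\<rfloor>) \<le> x"
  by linarith

lemma tester_prog_polynomial: "polynomial_time tester_prog"
proof -
  obtain C d where Cd: "\<And>n k N. main_time n k N (width (k + N)) \<le> C * (n + k + N + 1) ^ d"
    using main_time_bound by blast
  show ?thesis unfolding polynomial_time_def
  proof (rule exI[of _ "real C * 2 ^ d + 2"], rule exI[of _ d], intro allI impI)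
    fix n k \<epsilon> f D
    assume adm: "admissible n k \<epsilon> D"
    define N where "N = nat \<lfloor>1 / \<epsilon>\<rfloor>"
    let ?T = "main_time n k N (width (k + N)) + 2" and ?X = "real n + real k + 1 / \<epsilon>"
    from adm have n: "n \<ge> 1" "\<epsilon> > 0" by (auto simp: admissible_def)
    have N: "real N \<le> 1 / \<epsilon>" unfolding N_def using n(2) by (intro real_nat_floor_le) simp
    \<comment> \<open>\<open>n \<ge> 1\<close> keeps the base at least 1, so that additive constants
      are absorbed by its power.\<close>
    have X1: "1 \<le> ?X" using n by (simp add: add_increasing2)
    have X: "real (n + k + N + 1) \<le> 2 * ?X" using N X1 by simp
    have "real (main_time n k N (width (k + N))) \<le> real (C * (n + k + N + 1) ^ d)"
      using Cd by (simp only: of_nat_le_iff)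
    also have "\<dots> = real C * real (n + k + N + 1) ^ d" by (simp only: of_nat_mult of_nat_power)
    also have "\<dots> \<le> real C * (2 * ?X) ^ d" using X by (intro mult_left_mono power_mono) auto
    also have "\<dots> = real C * 2 ^ d * ?X ^ d" by (simp only: power_mult_distrib mult.assoc)
    finally have "real ?T \<le> real C * 2 ^ d * ?X ^ d + 2 * 1" by linarith
    also have "\<dots> \<le> real C * 2 ^ d * ?X ^ d + 2 * ?X ^ d" using X1 by (intro add_left_mono mult_left_mono one_le_power) auto
    finally have "real ?T \<le> (real C * 2 ^ d + 2) * ?X ^ d" by (simp add: algebra_simps)
    then show "\<exists>t. real t \<le> (real C * 2 ^ d + 2) * ?X ^ d \<and> (\<forall>c\<in>set_pmf (exec tester_prog n k \<epsilon> f D t). halted c)"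
      using exec_tester_prog(3)[OF adm, where f = f, folded N_def] by (intro exI[of _ ?T]) blast
  qed
qed

lemma tester_prog_queries: "soft_O_queries tester_prog (\<lambda>k \<epsilon>. (real k)\<^sup>2 / \<epsilon>)"
  unfolding soft_O_queries_def
\<comment> \<open>21000 comes from \<open>main_queries_bound\<close>; 36 and the exponent 2 come
  from squaring the bound of \<open>width_le_ln\<close>.\<close>
proof (rule exI[of _ "21000 * 36"], rule exI[of _ 2], intro allI impI ballI)
  fix n k \<epsilon> f D t c
  assume adm: "admissible n k \<epsilon> D" and c: "c \<in> set_pmf (exec tester_prog n k \<epsilon> f D t)"
  define N where "N = nat \<lfloor>1 / \<epsilon>\<rfloor>"
  define W where "W = width (k + N)"
  let ?T = "(real k)\<^sup>2 / \<epsilon>"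
  from adm have k: "k \<ge> 1" and \<epsilon>: "\<epsilon> > 0" by (auto simp: admissible_def)
  have q: "query_count c \<le> (if N = 0 then 0 else main_queries k N W)"
    using exec_tester_prog(3)[OF adm, where f = f, folded N_def, folded W_def] c
    unfolding exec_def by (rule run_query_count_bound)
  show "real (query_count c) \<le> 21000 * 36 * ?T * (ln (?T + 2))\<^sup>2"
  proof (cases "N = 0")
    case True
    then show ?thesis using q \<epsilon> by simp
  next
    case False
    then have N1: "N \<ge> 1" by simp
    have N: "real N \<le> 1 / \<epsilon>" unfolding N_def using \<epsilon> by (intro real_nat_floor_le) simp
    have Nk: "real (N * k\<^sup>2) \<le> ?T" using mult_right_mono[OF N, of "(real k)\<^sup>2"] by simp
    \<comment> \<open>Both factors are at least 1, so the sum under \<open>width\<close> is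
      controlled by their product, the only quantity that the bound may mention.\<close>
    have "k + N \<le> 2 * (N * k\<^sup>2)"
    proof -
      have "1 \<le> k\<^sup>2" "k \<le> k\<^sup>2" using k by (simp_all add: power2_eq_square)
      then have "1 * k \<le> N * k\<^sup>2" "N * 1 \<le> N * k\<^sup>2" using N1 by (intro mult_le_mono; simp)+
      then show ?thesis by linarith
    qed
    then have "real (k + N) \<le> real (2 * (N * k\<^sup>2))" by (simp only: of_nat_le_iff)
    then have "real (k + N) \<le> 2 * ?T" using Nk by simp
    moreover have "1 \<le> N * k\<^sup>2" using N1 k by simp
    then have "1 \<le> ?T" using Nk by (metis of_nat_1 of_nat_le_iff order_trans)
    ultimately have W: "real W \<le> 6 * ln (?T + 2)" unfolding W_def by (rule width_le_ln)
    have "real (query_count c) \<le> real (21000 * (N * k\<^sup>2 * W\<^sup>2))"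
      using q False main_queries_bound[OF k N1, of W] width_pos[OF k, of N]
      by (simp only: of_nat_le_iff W_def) simp
    also have "\<dots> = 21000 * (real (N * k\<^sup>2) * (real W)\<^sup>2)" by simp
    also have "\<dots> \<le> 21000 * (?T * (6 * ln (?T + 2))\<^sup>2)"
      using Nk W \<open>1 \<le> ?T\<close> by (intro mult_left_mono mult_mono power_mono) auto
    also have "\<dots> = 21000 * 36 * ?T * (ln (?T + 2))\<^sup>2" by (simp add: power_mult_distrib)
    finally show ?thesis .
  qed
qed

theorem theorem13:
  "\<exists>P. distribution_free_tester P length_decision_list \<and>
       polynomial_time P \<and>
       soft_O_queries P (\<lambda>k \<epsilon>. (real k)\<^sup>2 / \<epsilon>)"
  using tester_prog_correct tester_prog_polynomial tester_prog_queries by blast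

end
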